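(* Fix a universe $\mathscr{U}$. Let $X$ and $X'$ be connected $\mathscr{U}$-small categories. Let $\mathcal{S}p_X$ and $\mathcal{S}p_{X'}$ denote the categories of structure species on $X$ and on $X'$ respectively, and let $X^{\mathrm{op}}$ denote the opposite category of $X$. Then the following two conditions are equivalent: (a) $X$ is equivalent (as a category) to $X'$, or $X^{\mathrm{op}}$ is equivalent to $X'$. (b) The category $\mathcal{S}p_X$ is equivalent to the category $\mathcal{S}p_{X'}$.
   Context: A category $\mathcal{C}$ is connected if it is nonempty and for any two objects $a,b$ there is a finite sequence of objects $c_1=a,c_2,\dots,c_n=b$ such that for each $j$ there is a morphism $c_j\to c_{j+1}$ or a morphism $c_{j+1}\to c_j$. An order is a category in which there is at most one morphism between any two objects (write $a<b$ if there is a morphism $a\to b$; this relation is reflexive and transitive) and in which the only isomorphisms are the identity morphisms (i.e. $<$ is antisymmetric). $\mathcal{O}rd$ is the category of $\mathscr{U}$-small orders and functors between them; $\mathcal{S}et$ is the category of $\mathscr{U}$-small sets. For a set $T$, $\mathcal{D}is(T)$ is the discrete category with object set $T$ (only identity morphisms); this gives a functor $\mathcal{D}is:\mathcal{S}et\to\mathcal{O}rd$. For a category $X$, $X^{\cong}$ is the category with the same objects as $X$ whose morphisms are the isomorphisms of $X$, and $J:X^{\cong}\hookrightarrow X$ is the inclusion. Structure species: a structure species on a $\mathscr{U}$-small category $X$ is a pair $\Sigma=(E,S)$ of functors $E:X\to\mathcal{O}rd$ and $S:X^{\cong}\to\mathcal{S}et$ such that $\mathcal{D}is\circ S$ is a subfunctor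 of $E\circ J$; that is, for every object $a$, $\mathcal{D}is(S(a))$ is a subcategory of $E(a)$ (so $S(a)\subseteq \mathrm{Ob}(E(a))$), and the inclusions are natural in $a\in X^{\cong}$. A morphism of structure species $(E,S)\to(E',S')$ is a natural transformation $\phi:S\to S'$ such that for every morphism $u:a\to b$ in $X$ and all $U\in S(a)$, $V\in S(b)$: if $E(u)(U)<V$ in $E(b)$, then $E'(u)(\phi_a(U))<\phi_b(V)$ in $E'(b)$. $\mathcal{S}p_X$ is the category of structure species on $X$ and morphisms of structure species, with composition of natural transformations. *)

theory Defs
  imports "HOL-Library.FuncSet" "HOL-Library.Equipollence"
begin

section \<open>Universes\<close>

text \<open>
  A Grothendieck universe is given by a type whose inhabitants are the elements of the universe,
  and the map sending each of them to the set of its members. (Transitivity of the universe is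
  thus built in.) The axiom \<open>pow\<close> demands the full power set, so every subset of an element of
  the universe is again an element. Neither an infinite element nor well-foundedness of membership
  is demanded.
\<close>

locale universe =
  fixes U :: "'v \<Rightarrow> 'v set"
  assumes extensional: "inj U"
    and pair: "\<exists>z. U z = {x, y}"
    and pow: "\<exists>z. U ` U z = Pow (U x)"
    and union: "\<exists>z. U z = (\<Union>i\<in>U x. U (f i))"

text \<open>For subsets of the type \<open>'v\<close> itself, \<open>small U A\<close> is the same as \<open>A \<in> range U\<close> in a universe.\<close>

definition small :: "('v \<Rightarrow> 'v set) \<Rightarrow> 'a set \<Rightarrow> bool" where
  "small U A \<longleftrightarrow> (\<exists>x. A \<approx> U x)"


section \<open>Categories\<close>

record ('o, 'm) cat =
  Ob :: "'o set"
  Mor :: "'m set"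
  Dom :: "'m \<Rightarrow> 'o"
  Cod :: "'m \<Rightarrow> 'o"
  Id :: "'o \<Rightarrow> 'm"
  Comp :: "'m \<Rightarrow> 'm \<Rightarrow> 'm"  (infixl "\<cdot>\<index>" 70)

definition hom :: "('o, 'm) cat \<Rightarrow> 'o \<Rightarrow> 'o \<Rightarrow> 'm set" where
  "hom C a b = {f \<in> Mor C. Dom C f = a \<and> Cod C f = b}"

locale category =
  fixes C :: "('o, 'm) cat"  (structure)
  assumes Dom_in: "f \<in> Mor C \<Longrightarrow> Dom C f \<in> Ob C"
    and Cod_in: "f \<in> Mor C \<Longrightarrow> Cod C f \<in> Ob C"
    and Id_in: "a \<in> Ob C \<Longrightarrow> Id C a \<in> hom C a a"
    and Comp_in: "\<lbrakk>f \<in> hom C a b; g \<in> hom C b c\<rbrakk> \<Longrightarrow> g \<cdot> f \<in> hom C a c"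
    and Comp_Id: "f \<in> hom C a b \<Longrightarrow> f \<cdot> Id C a = f"
    and Id_Comp: "f \<in> hom C a b \<Longrightarrow> Id C b \<cdot> f = f"
    and assoc: "\<lbrakk>f \<in> hom C a b; g \<in> hom C b c; h \<in> hom C c d\<rbrakk>
      \<Longrightarrow> h \<cdot> (g \<cdot> f) = (h \<cdot> g) \<cdot> f"

definition small_category :: "('v \<Rightarrow> 'v set) \<Rightarrow> ('o, 'm) cat \<Rightarrow> bool" where
  "small_category U C \<longleftrightarrow> category C \<and> small U (Ob C) \<and> small U (Mor C)"

definition connected_category :: "('o, 'm) cat \<Rightarrow> bool" where
  "connected_category C \<longleftrightarrow> Ob C \<noteq> {} \<and>
    (\<forall>a\<in>Ob C. \<forall>b\<in>Ob C. \<exists>cs. cs \<noteq> [] \<and> set cs \<subseteq> Ob C \<and> hd cs = a \<and> last cs = b \<and>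
      successively (\<lambda>c d. hom C c d \<noteq> {} \<or> hom C d c \<noteq> {}) cs)"

definition is_iso :: "('o, 'm) cat \<Rightarrow> 'm \<Rightarrow> bool" where
  "is_iso C f \<longleftrightarrow> f \<in> Mor C \<and> (\<exists>g\<in>hom C (Cod C f) (Dom C f).
    g \<cdot>\<^bsub>C\<^esub> f = Id C (Dom C f) \<and> f \<cdot>\<^bsub>C\<^esub> g = Id C (Cod C f))"

definition op_cat :: "('o, 'm) cat \<Rightarrow> ('o, 'm) cat" where
  "op_cat C = \<lparr>Ob = Ob C, Mor = Mor C, Dom = Cod C, Cod = Dom C, Id = Id C,
    Comp = (\<lambda>g f. f \<cdot>\<^bsub>C\<^esub> g)\<rparr>"

definition core :: "('o, 'm) cat \<Rightarrow> ('o, 'm) cat" where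
  "core C = C\<lparr>Mor := {f. is_iso C f}\<rparr>"


section \<open>Functors, natural transformations, equivalence\<close>

text \<open>
  The two maps of a functor are required to be undefined outside the source category, so that
  functors between given categories are equal iff they agree on objects and morphisms; likewise
  for natural transformations.
\<close>

record ('o, 'm, 'p, 'n) funct =
  ob_map :: "'o \<Rightarrow> 'p"
  mor_map :: "'m \<Rightarrow> 'n"

definition is_functor :: "('o, 'm) cat \<Rightarrow> ('p, 'n) cat \<Rightarrow> ('o, 'm, 'p, 'n) funct \<Rightarrow> bool" where
  "is_functor C D F \<longleftrightarrow>
    ob_map F \<in> Ob C \<rightarrow>\<^sub>E Ob D \<and>
    mor_map F \<in> Mor C \<rightarrow>\<^sub>E Mor D \<and>
    (\<forall>f\<in>Mor C. mor_map F f \<in> hom D (ob_map F (Dom C f)) (ob_map F (Cod C f))) \<and>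
    (\<forall>a\<in>Ob C. mor_map F (Id C a) = Id D (ob_map F a)) \<and>
    (\<forall>f\<in>Mor C. \<forall>g\<in>Mor C. Cod C f = Dom C g \<longrightarrow>
      mor_map F (g \<cdot>\<^bsub>C\<^esub> f) = mor_map F g \<cdot>\<^bsub>D\<^esub> mor_map F f)"

definition id_funct :: "('o, 'm) cat \<Rightarrow> ('o, 'm, 'o, 'm) funct" where
  "id_funct C = \<lparr>ob_map = (\<lambda>a\<in>Ob C. a), mor_map = (\<lambda>f\<in>Mor C. f)\<rparr>"

text \<open>The composite \<open>G \<circ> F\<close>, where \<open>F\<close> has source \<open>C\<close>.\<close>

definition comp_funct ::
  "('o, 'm) cat \<Rightarrow> ('p, 'n, 'q, 'k) funct \<Rightarrow> ('o, 'm, 'p, 'n) funct \<Rightarrow> ('o, 'm, 'q, 'k) funct" where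
  "comp_funct C G F =
    \<lparr>ob_map = (\<lambda>a\<in>Ob C. ob_map G (ob_map F a)), mor_map = (\<lambda>f\<in>Mor C. mor_map G (mor_map F f))\<rparr>"

definition nat_trans ::
  "('o, 'm) cat \<Rightarrow> ('p, 'n) cat \<Rightarrow> ('o, 'm, 'p, 'n) funct \<Rightarrow> ('o, 'm, 'p, 'n) funct
    \<Rightarrow> ('o \<Rightarrow> 'n) \<Rightarrow> bool" where
  "nat_trans C D F G \<tau> \<longleftrightarrow>
    \<tau> \<in> (\<Pi>\<^sub>E a\<in>Ob C. hom D (ob_map F a) (ob_map G a)) \<and>
    (\<forall>f\<in>Mor C. \<tau> (Cod C f) \<cdot>\<^bsub>D\<^esub> mor_map F f = mor_map G f \<cdot>\<^bsub>D\<^esub> \<tau> (Dom C f))"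

definition nat_isomorphic ::
  "('o, 'm) cat \<Rightarrow> ('p, 'n) cat \<Rightarrow> ('o, 'm, 'p, 'n) funct \<Rightarrow> ('o, 'm, 'p, 'n) funct \<Rightarrow> bool" where
  "nat_isomorphic C D F G \<longleftrightarrow> (\<exists>\<tau>. nat_trans C D F G \<tau> \<and> (\<forall>a\<in>Ob C. is_iso D (\<tau> a)))"

definition equivalent :: "('o, 'm) cat \<Rightarrow> ('p, 'n) cat \<Rightarrow> bool" where
  "equivalent C D \<longleftrightarrow> (\<exists>F G. is_functor C D F \<and> is_functor D C G \<and>
    nat_isomorphic C C (id_funct C) (comp_funct C G F) \<and>
    nat_isomorphic D D (comp_funct D F G) (id_funct D))"


section \<open>Sets and orders\<close>

text \<open>Morphisms carrying their source and target.\<close>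

record ('x, 'f) arrow =
  src :: 'x
  trg :: 'x
  act :: 'f

type_synonym 'v set_map = "('v set, 'v \<Rightarrow> 'v) arrow"

definition set_cat :: "('v \<Rightarrow> 'v set) \<Rightarrow> ('v set, 'v set_map) cat" where
  "set_cat U =
    \<lparr>Ob = {A. small U A},
     Mor = {f. small U (src f) \<and> small U (trg f) \<and> act f \<in> src f \<rightarrow>\<^sub>E trg f},
     Dom = src, Cod = trg,
     Id = (\<lambda>A. \<lparr>src = A, trg = A, act = (\<lambda>x\<in>A. x)\<rparr>),
     Comp = (\<lambda>g f. \<lparr>src = src f, trg = trg g, act = (\<lambda>x\<in>src f. act g (act f x))\<rparr>)\<rparr>"

definition order_category :: "('o, 'm) cat \<Rightarrow> bool" where
  "order_category P \<longleftrightarrow> category P \<and>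
    (\<forall>f\<in>Mor P. \<forall>g\<in>Mor P. Dom P f = Dom P g \<and> Cod P f = Cod P g \<longrightarrow> f = g) \<and>
    (\<forall>f. is_iso P f \<longrightarrow> f = Id P (Dom P f))"

definition le :: "('o, 'm) cat \<Rightarrow> 'o \<Rightarrow> 'o \<Rightarrow> bool" where
  "le P x y \<longleftrightarrow> hom P x y \<noteq> {}"

type_synonym 'v ord = "('v, 'v) cat"
type_synonym 'v ord_map = "('v ord, ('v, 'v, 'v, 'v) funct) arrow"

definition ord_cat :: "('v \<Rightarrow> 'v set) \<Rightarrow> ('v ord, 'v ord_map) cat" where
  "ord_cat U =
    \<lparr>Ob = {P. order_category P \<and> small_category U P},
     Mor = {f. order_category (src f) \<and> small_category U (src f) \<and>
               order_category (trg f) \<and> small_category U (trg f) \<and>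
               is_functor (src f) (trg f) (act f)},
     Dom = src, Cod = trg,
     Id = (\<lambda>P. \<lparr>src = P, trg = P, act = id_funct P\<rparr>),
     Comp = (\<lambda>g f. \<lparr>src = src f, trg = trg g, act = comp_funct (src f) (act g) (act f)\<rparr>)\<rparr>"

text \<open>The identity morphism of \<open>t\<close> in the discrete category on \<open>T\<close> is represented by \<open>t\<close> itself.\<close>

definition dis :: "'v set \<Rightarrow> 'v ord" where
  "dis T = \<lparr>Ob = T, Mor = T, Dom = (\<lambda>t. t), Cod = (\<lambda>t. t), Id = (\<lambda>t. t), Comp = (\<lambda>g f. f)\<rparr>"

definition Dis :: "('v \<Rightarrow> 'v set) \<Rightarrow> ('v set, 'v set_map, 'v ord, 'v ord_map) funct" where
  "Dis U =
    \<lparr>ob_map = (\<lambda>T\<in>Ob (set_cat U). dis T),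
     mor_map = (\<lambda>f\<in>Mor (set_cat U).
       \<lparr>src = dis (src f), trg = dis (trg f), act = \<lparr>ob_map = act f, mor_map = act f\<rparr>\<rparr>)\<rparr>"

text \<open>
  The inclusion functor of the discrete category on \<open>T\<close> into \<open>P\<close>, sending each \<open>t\<close> to \<open>t\<close>. It is a
  morphism of orders only if \<open>T \<subseteq> Ob P\<close>.
\<close>

definition dis_incl :: "'v set \<Rightarrow> 'v ord \<Rightarrow> 'v ord_map" where
  "dis_incl T P =
    \<lparr>src = dis T, trg = P, act = \<lparr>ob_map = (\<lambda>t\<in>T. t), mor_map = (\<lambda>t\<in>T. Id P t)\<rparr>\<rparr>"


section \<open>Structure species\<close>

record ('o, 'm, 'v) species =
  ordf :: "('o, 'm, 'v ord, 'v ord_map) funct"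
  setf :: "('o, 'm, 'v set, 'v set_map) funct"

definition core_incl :: "('o, 'm) cat \<Rightarrow> ('o, 'm, 'o, 'm) funct" where
  "core_incl X = \<lparr>ob_map = (\<lambda>a\<in>Ob X. a), mor_map = (\<lambda>f\<in>Mor (core X). f)\<rparr>"

definition is_species :: "('v \<Rightarrow> 'v set) \<Rightarrow> ('o, 'm) cat \<Rightarrow> ('o, 'm, 'v) species \<Rightarrow> bool" where
  "is_species U X \<Sigma> \<longleftrightarrow>
    is_functor X (ord_cat U) (ordf \<Sigma>) \<and>
    is_functor (core X) (set_cat U) (setf \<Sigma>) \<and>
    nat_trans (core X) (ord_cat U)
      (comp_funct (core X) (Dis U) (setf \<Sigma>)) (comp_funct (core X) (ordf \<Sigma>) (core_incl X))
      (\<lambda>a\<in>Ob X. dis_incl (ob_map (setf \<Sigma>) a) (ob_map (ordf \<Sigma>) a))"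

type_synonym ('o, 'm, 'v) species_map = "(('o, 'm, 'v) species, 'o \<Rightarrow> 'v set_map) arrow"

definition is_species_map ::
  "('v \<Rightarrow> 'v set) \<Rightarrow> ('o, 'm) cat \<Rightarrow> ('o, 'm, 'v) species_map \<Rightarrow> bool" where
  "is_species_map U X \<phi> \<longleftrightarrow>
    (let E = ordf (src \<phi>); S = setf (src \<phi>); E' = ordf (trg \<phi>); S' = setf (trg \<phi>) in
      is_species U X (src \<phi>) \<and> is_species U X (trg \<phi>) \<and>
      nat_trans (core X) (set_cat U) S S' (act \<phi>) \<and>
      (\<forall>a\<in>Ob X. \<forall>b\<in>Ob X. \<forall>u\<in>hom X a b. \<forall>A\<in>ob_map S a. \<forall>B\<in>ob_map S b.
        le (ob_map E b) (ob_map (act (mor_map E u)) A) B \<longrightarrow>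
        le (ob_map E' b) (ob_map (act (mor_map E' u)) (act (act \<phi> a) A)) (act (act \<phi> b) B)))"

definition species_cat ::
  "('v \<Rightarrow> 'v set) \<Rightarrow> ('o, 'm) cat \<Rightarrow> (('o, 'm, 'v) species, ('o, 'm, 'v) species_map) cat" where
  "species_cat U X =
    \<lparr>Ob = {\<Sigma>. is_species U X \<Sigma>},
     Mor = {\<phi>. is_species_map U X \<phi>},
     Dom = src, Cod = trg,
     Id = (\<lambda>\<Sigma>. \<lparr>src = \<Sigma>, trg = \<Sigma>, act = (\<lambda>a\<in>Ob X. Id (set_cat U) (ob_map (setf \<Sigma>) a))\<rparr>),
     Comp = (\<lambda>\<psi> \<phi>. \<lparr>src = src \<phi>, trg = trg \<psi>,
       act = (\<lambda>a\<in>Ob X. act \<psi> a \<cdot>\<^bsub>set_cat U\<^esub> act \<phi> a)\<rparr>)\<rparr>"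

end

theory Submission
  imports Defs
begin

text \<open>
  Only the relations \<open>E(u)(x) < y\<close> of a species matter. They are reflexive over identities, lax
  functorial, antisymmetric over identities and liftable along isomorphisms; any such family of
  relations on small sets \<open>S(a)\<close> comes from a species, and the morphisms are exactly the families of
  maps preserving them. This description is self-dual in \<open>X\<close> and invariant under equivalence of \<open>X\<close>,
  which gives the implication from (a) to (b).

  Conversely, the structures freely generated by one element over an object \<open>a\<close> are, up to isomorphism,
  the objects \<open>p\<close> that are not initial and onto which every morphism from a non-initial object splits.
  So an equivalence of species categories induces a bijection between the isomorphism classes of
  objects of \<open>X\<close> and \<open>X'\<close>, and identifies the elements over \<open>a\<close> with those over \<open>a'\<close>. The structure
  freely generated by a single relation along \<open>u\<close> does not split into two independent parts, so its
  generators are also related along some \<open>w\<close> of \<open>X'\<close>, in one direction or the other; hence the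
  relation of \<open>u\<close> is the relation of \<open>w\<close> or its converse. Directions agree for composable morphisms,
  hence on all of the connected category \<open>X\<close>, and \<open>u \<mapsto> w\<close> is the required equivalence from \<open>X\<close> or
  from its opposite.
\<close>

section \<open>Weak equivalences\<close>

text \<open>Both implications are reduced to the notion of a \<open>presentation\<close>: a category
  whose objects carry small relational structures over a base, whose morphisms are exactly the maps
  preserving them, and in which every such structure occurs up to isomorphism. Two presentations
  over one base have equivalent categories, which gives the first implication. For the second, an
  equivalence makes a single category carry structures over \<open>X\<close> and over
  \<open>X'\<close> at once, and everything has to be expressed through its morphisms, since the two
  families of carriers share nothing else. Non-emptiness, being free on one element and, as a
  factorization property, being covered by two elements can be so expressed. The direction of a
  relation cannot: reversing all relations is a symmetry of the axioms. Hence a sign is carried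
  along and compared afterwards along zigzags of morphisms; separate components could be reversed
  independently, so this is where connectedness enters. Two test structures decide the comparisons:
  the constant chain \<open>False < True\<close> sees only directions, and the covariant
  representable structures see the morphisms themselves.\<close>

definition inverse_pair :: "('o, 'm) cat \<Rightarrow> 'o \<Rightarrow> 'o \<Rightarrow> 'm \<Rightarrow> 'm \<Rightarrow> bool" where
  "inverse_pair C a b f g \<longleftrightarrow> f \<in> hom C a b \<and> g \<in> hom C b a \<and>
    g \<cdot>\<^bsub>C\<^esub> f = Id C a \<and> f \<cdot>\<^bsub>C\<^esub> g = Id C b"

lemma inverse_pair_sym: "inverse_pair C a b f g \<Longrightarrow> inverse_pair C b a g f"
  by (simp add: inverse_pair_def)

lemma inverse_pairD:
  assumes "inverse_pair C a b f g"
  shows "f \<in> hom C a b" "g \<in> hom C b a" "g \<cdot>\<^bsub>C\<^esub> f = Id C a" "f \<cdot>\<^bsub>C\<^esub> g = Id C b"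
  using assms by (simp_all add: inverse_pair_def)

lemma hom_Mor: "f \<in> hom C a b \<Longrightarrow> f \<in> Mor C"
  and hom_Dom: "f \<in> hom C a b \<Longrightarrow> Dom C f = a"
  and hom_Cod: "f \<in> hom C a b \<Longrightarrow> Cod C f = b"
  and Mor_hom: "f \<in> Mor C \<Longrightarrow> f \<in> hom C (Dom C f) (Cod C f)"
  by (simp_all add: hom_def)

lemma is_iso_iff_inverse_pair:
  "f \<in> hom C a b \<Longrightarrow> is_iso C f \<longleftrightarrow> (\<exists>g. inverse_pair C a b f g)"
  by (auto simp: is_iso_def inverse_pair_def hom_def)

lemma inverse_pair_is_iso: "inverse_pair C a b f g \<Longrightarrow> is_iso C f"
  using is_iso_iff_inverse_pair inverse_pairD(1) by metis

context category
begin

lemma hom_Ob: "f \<in> hom C a b \<Longrightarrow> a \<in> Ob C" "f \<in> hom C a b \<Longrightarrow> b \<in> Ob C"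
  using Dom_in Cod_in by (auto simp: hom_def)

lemma inverse_pair_Id: "a \<in> Ob C \<Longrightarrow> inverse_pair C a a (Id C a) (Id C a)"
  using Id_in Comp_Id by (auto simp: inverse_pair_def)

lemma inverse_pair_Comp:
  assumes f: "inverse_pair C a b f f'" and g: "inverse_pair C b c g g'"
  shows "inverse_pair C a c (g \<cdot> f) (f' \<cdot> g')"
proof -
  note F = inverse_pairD[OF f] and G = inverse_pairD[OF g]
  have "(f' \<cdot> g') \<cdot> (g \<cdot> f) = f' \<cdot> ((g' \<cdot> g) \<cdot> f)"
    using assoc[OF F(1) G(1) G(2)] assoc[OF Comp_in[OF F(1) G(1)] G(2) F(2)] by simp
  moreover have "(g \<cdot> f) \<cdot> (f' \<cdot> g') = g \<cdot> ((f \<cdot> f') \<cdot> g')"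
    using assoc[OF G(2) F(2) F(1)] assoc[OF Comp_in[OF G(2) F(2)] F(1) G(1)] by simp
  ultimately show ?thesis
    using F G Comp_in Id_Comp by (auto simp: inverse_pair_def)
qed

lemma inverse_pair_unique:
  assumes "inverse_pair C a b f g" "inverse_pair C a b f h"
  shows "g = h"
  using assms assoc[of g b a f b h] Id_Comp Comp_Id unfolding inverse_pair_def by metis

lemma cancel_inverse_left:
  assumes "inverse_pair C b c g h" "f \<in> hom C a b"
  shows "h \<cdot> (g \<cdot> f) = f"
  using assms assoc[of f a b g c h b] Id_Comp[of f a b] by (simp add: inverse_pair_def)

lemma cancel_inverse_right:
  assumes "inverse_pair C b c g h" "f \<in> hom C c d"
  shows "(f \<cdot> g) \<cdot> h = f"
  using assms assoc[of h c b g c f d] Comp_Id[of f c d] by (simp add: inverse_pair_def)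

end

text \<open>A fully faithful and essentially surjective functor. Equivalences are both built and
  taken apart in this form, because it involves one functor and no natural isomorphisms.\<close>

definition weak_equivalence ::
  "('o, 'm) cat \<Rightarrow> ('p, 'n) cat \<Rightarrow> ('o, 'm, 'p, 'n) funct \<Rightarrow> bool" where
  "weak_equivalence C D F \<longleftrightarrow> is_functor C D F \<and>
    (\<forall>a\<in>Ob C. \<forall>b\<in>Ob C. bij_betw (mor_map F) (hom C a b) (hom D (ob_map F a) (ob_map F b))) \<and>
    (\<forall>d\<in>Ob D. \<exists>c\<in>Ob C. \<exists>f g. inverse_pair D (ob_map F c) d f g)"

lemma functor_Ob: "is_functor C D F \<Longrightarrow> a \<in> Ob C \<Longrightarrow> ob_map F a \<in> Ob D"
  and functor_hom: "is_functor C D F \<Longrightarrow> f \<in> hom C a b \<Longrightarrow>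
    mor_map F f \<in> hom D (ob_map F a) (ob_map F b)"
  and functor_Id: "is_functor C D F \<Longrightarrow> a \<in> Ob C \<Longrightarrow> mor_map F (Id C a) = Id D (ob_map F a)"
  and functor_Comp: "is_functor C D F \<Longrightarrow> f \<in> hom C a b \<Longrightarrow> g \<in> hom C b c \<Longrightarrow>
    mor_map F (g \<cdot>\<^bsub>C\<^esub> f) = mor_map F g \<cdot>\<^bsub>D\<^esub> mor_map F f"
  by (auto simp: is_functor_def hom_def)

lemma is_functorI:
  assumes C: "category C" and ob: "\<And>a. a \<in> Ob C \<Longrightarrow> f a \<in> Ob D"
    and mor: "\<And>u a b. u \<in> hom C a b \<Longrightarrow> m u \<in> hom D (f a) (f b)"
    and Id: "\<And>a. a \<in> Ob C \<Longrightarrow> m (Id C a) = Id D (f a)"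
    and Comp: "\<And>u v a b c. \<lbrakk>u \<in> hom C a b; v \<in> hom C b c\<rbrakk> \<Longrightarrow> m (v \<cdot>\<^bsub>C\<^esub> u) = m v \<cdot>\<^bsub>D\<^esub> m u"
  shows "is_functor C D \<lparr>ob_map = restrict f (Ob C), mor_map = restrict m (Mor C)\<rparr>"
proof -
  interpret category C by fact
  have "v \<cdot>\<^bsub>C\<^esub> u \<in> Mor C \<and> m (v \<cdot>\<^bsub>C\<^esub> u) = m v \<cdot>\<^bsub>D\<^esub> m u" if "u \<in> Mor C" "v \<in> Mor C" "Cod C u = Dom C v" for u v
  proof -
    have u: "u \<in> hom C (Dom C u) (Dom C v)" using that by (simp add: hom_def)
    show ?thesis
      using Comp[OF u Mor_hom[OF that(2)]] hom_Mor[OF Comp_in[OF u Mor_hom[OF that(2)]]] by blast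
  qed
  then show ?thesis
    unfolding is_functor_def
    using ob Id hom_Mor[OF Id_in] Dom_in Cod_in mor[OF Mor_hom] hom_Mor[OF mor[OF Mor_hom]] by simp
qed

lemma functor_inverse_pair:
  assumes "category C" "is_functor C D F" "inverse_pair C a b f g"
  shows "inverse_pair D (ob_map F a) (ob_map F b) (mor_map F f) (mor_map F g)"
proof -
  interpret category C by fact
  note f = inverse_pairD[OF assms(3)]
  show ?thesis
    using f functor_hom[OF assms(2)] functor_Comp[OF assms(2) f(1,2)]
      functor_Comp[OF assms(2) f(2,1)] functor_Id[OF assms(2)] hom_Ob[OF f(1)]
    by (simp add: inverse_pair_def)
qed

lemma equivalent_imp_weak_equivalence:
  assumes C: "category C" and D: "category D" and "equivalent C D"
  shows "\<exists>F. weak_equivalence C D F"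
proof -
  interpret C: category C by fact
  interpret D: category D by fact
  obtain F G \<sigma> \<tau> where F: "is_functor C D F" and G: "is_functor D C G"
    and \<sigma>: "nat_trans C C (id_funct C) (comp_funct C G F) \<sigma>" "\<And>a. a \<in> Ob C \<Longrightarrow> is_iso C (\<sigma> a)"
    and \<tau>: "nat_trans D D (comp_funct D F G) (id_funct D) \<tau>" "\<And>a. a \<in> Ob D \<Longrightarrow> is_iso D (\<tau> a)"
    using assms(3) unfolding equivalent_def nat_isomorphic_def by blast
  have \<sigma>_hom: "\<sigma> a \<in> hom C a (ob_map G (ob_map F a))" if "a \<in> Ob C" for a
    using \<sigma>(1) that by (auto simp: nat_trans_def id_funct_def comp_funct_def dest!: PiE_mem[OF _ that])
  have \<sigma>_nat: "\<sigma> b \<cdot>\<^bsub>C\<^esub> f = mor_map G (mor_map F f) \<cdot>\<^bsub>C\<^esub> \<sigma> a" if "f \<in> hom C a b" for f a b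
    using \<sigma>(1) that by (auto simp: nat_trans_def id_funct_def comp_funct_def hom_def)
  have \<tau>_hom: "\<tau> a \<in> hom D (ob_map F (ob_map G a)) a" if "a \<in> Ob D" for a
    using \<tau>(1) that by (auto simp: nat_trans_def id_funct_def comp_funct_def dest!: PiE_mem[OF _ that])
  have \<tau>_nat: "\<tau> b \<cdot>\<^bsub>D\<^esub> mor_map F (mor_map G f) = f \<cdot>\<^bsub>D\<^esub> \<tau> a" if "f \<in> hom D a b" for f a b
    using \<tau>(1) that by (auto simp: nat_trans_def id_funct_def comp_funct_def hom_def)
  have "\<forall>a\<in>Ob C. \<exists>g. inverse_pair C a (ob_map G (ob_map F a)) (\<sigma> a) g"
    using \<sigma>(2) is_iso_iff_inverse_pair[OF \<sigma>_hom] by blast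
  then obtain \<sigma>' where \<sigma>': "\<And>a. a \<in> Ob C \<Longrightarrow> inverse_pair C a (ob_map G (ob_map F a)) (\<sigma> a) (\<sigma>' a)"
    by metis
  have "\<forall>a\<in>Ob D. \<exists>g. inverse_pair D (ob_map F (ob_map G a)) a (\<tau> a) g"
    using \<tau>(2) is_iso_iff_inverse_pair[OF \<tau>_hom] by blast
  then obtain \<tau>' where \<tau>': "\<And>a. a \<in> Ob D \<Longrightarrow> inverse_pair D (ob_map F (ob_map G a)) a (\<tau> a) (\<tau>' a)"
    by metis
  have F_inj: "f = g" if f: "f \<in> hom C a b" and g: "g \<in> hom C a b"
    and eq: "mor_map F f = mor_map F g" for f g a b
  proof -
    have "\<sigma> b \<cdot>\<^bsub>C\<^esub> f = \<sigma> b \<cdot>\<^bsub>C\<^esub> g"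
      using \<sigma>_nat[OF f] \<sigma>_nat[OF g] eq by simp
    then show ?thesis
      using C.cancel_inverse_left[OF \<sigma>' f] C.cancel_inverse_left[OF \<sigma>' g] C.hom_Ob[OF f] by metis
  qed
  have G_inj: "f = g" if f: "f \<in> hom D a b" and g: "g \<in> hom D a b"
    and eq: "mor_map G f = mor_map G g" for f g a b
  proof -
    have "f \<cdot>\<^bsub>D\<^esub> \<tau> a = g \<cdot>\<^bsub>D\<^esub> \<tau> a"
      using \<tau>_nat[OF f] \<tau>_nat[OF g] eq by simp
    then show ?thesis
      using D.cancel_inverse_right[OF \<tau>' f] D.cancel_inverse_right[OF \<tau>' g] D.hom_Ob[OF f]
      by metis
  qed
  have F_surj: "\<exists>f\<in>hom C a b. mor_map F f = g"
    if ab: "a \<in> Ob C" "b \<in> Ob C" and g: "g \<in> hom D (ob_map F a) (ob_map F b)" for a b g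
  proof -
    \<comment> \<open>Naturality of \<open>\<sigma>\<close> determines a morphism from its image
      under \<open>G F\<close>. The candidate \<open>?f\<close> is the one whose image is
      \<open>G g\<close>; faithfulness of \<open>G\<close> then gives
      \<open>F ?f = g\<close>.\<close>
    let ?f = "\<sigma>' b \<cdot>\<^bsub>C\<^esub> (mor_map G g \<cdot>\<^bsub>C\<^esub> \<sigma> a)"
    note Gg = functor_hom[OF G g]
    have m: "mor_map G g \<cdot>\<^bsub>C\<^esub> \<sigma> a \<in> hom C a (ob_map G (ob_map F b))"
      using C.Comp_in \<sigma>_hom[OF ab(1)] Gg by blast
    have f: "?f \<in> hom C a b"
      using C.Comp_in m inverse_pairD(2)[OF \<sigma>'[OF ab(2)]] by blast
    have "mor_map G (mor_map F ?f) \<cdot>\<^bsub>C\<^esub> \<sigma> a = mor_map G g \<cdot>\<^bsub>C\<^esub> \<sigma> a"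
      using \<sigma>_nat[OF f] C.cancel_inverse_left[OF inverse_pair_sym[OF \<sigma>'[OF ab(2)]] m] by simp
    then have "mor_map G (mor_map F ?f) = mor_map G g"
      using C.cancel_inverse_right[OF \<sigma>'[OF ab(1)]] Gg functor_hom[OF G functor_hom[OF F f]]
      by metis
    then show ?thesis
      using G_inj[OF functor_hom[OF F f] g] f by blast
  qed
  have "bij_betw (mor_map F) (hom C a b) (hom D (ob_map F a) (ob_map F b))"
    if "a \<in> Ob C" "b \<in> Ob C" for a b
    unfolding bij_betw_def inj_on_def using F_inj F_surj[OF that] functor_hom[OF F] by blast
  then show ?thesis
    unfolding weak_equivalence_def using F \<tau>' functor_Ob[OF G] by blast
qed

text \<open>Chosen isomorphisms \<open>\<epsilon> d\<close> from objects in the image of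
  \<open>F\<close> define \<open>G\<close>, and \<open>\<eta> a\<close> is the preimage under
  \<open>F\<close> of the inverse of \<open>\<epsilon>\<close> at \<open>F a\<close>. The last two
  conclusions record this triangle identity: \<open>change_base\<close> relies on an adjoint
  equivalence, not merely on two natural isomorphisms.\<close>

lemma weak_equivalence_inverse:
  assumes C: "category C" and D: "category D" and W: "weak_equivalence C D F"
  obtains G \<epsilon> \<epsilon>' \<eta> \<eta>' where "is_functor D C G"
    and "\<And>d. d \<in> Ob D \<Longrightarrow> inverse_pair D (ob_map F (ob_map G d)) d (\<epsilon> d) (\<epsilon>' d)"
    and "\<And>f a b. f \<in> hom D a b \<Longrightarrow> \<epsilon> b \<cdot>\<^bsub>D\<^esub> mor_map F (mor_map G f) = f \<cdot>\<^bsub>D\<^esub> \<epsilon> a"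
    and "\<And>a. a \<in> Ob C \<Longrightarrow> inverse_pair C a (ob_map G (ob_map F a)) (\<eta> a) (\<eta>' a)"
    and "\<And>f a b. f \<in> hom C a b \<Longrightarrow> \<eta> b \<cdot>\<^bsub>C\<^esub> f = mor_map G (mor_map F f) \<cdot>\<^bsub>C\<^esub> \<eta> a"
    and "\<And>a. a \<in> Ob C \<Longrightarrow> mor_map F (\<eta> a) = \<epsilon>' (ob_map F a)"
    and "\<And>a. a \<in> Ob C \<Longrightarrow> mor_map F (\<eta>' a) = \<epsilon> (ob_map F a)"
proof -
  interpret C: category C by fact
  interpret D: category D by fact
  have F: "is_functor C D F"
    using W by (simp add: weak_equivalence_def)
  have bij: "bij_betw (mor_map F) (hom C a b) (hom D (ob_map F a) (ob_map F b))"
    if "a \<in> Ob C" "b \<in> Ob C" for a b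
    using W that by (auto simp: weak_equivalence_def)
  have F_inj: "f = g" if "f \<in> hom C a b" "g \<in> hom C a b" "mor_map F f = mor_map F g" for f g a b
    using bij C.hom_Ob that unfolding bij_betw_def inj_on_def by blast
  have "\<forall>d\<in>Ob D. \<exists>c f g. c \<in> Ob C \<and> inverse_pair D (ob_map F c) d f g"
    using W unfolding weak_equivalence_def by blast
  then obtain g0 \<epsilon> \<epsilon>' where g0: "\<And>d. d \<in> Ob D \<Longrightarrow> g0 d \<in> Ob C"
    and \<epsilon>: "\<And>d. d \<in> Ob D \<Longrightarrow> inverse_pair D (ob_map F (g0 d)) d (\<epsilon> d) (\<epsilon>' d)"
    by metis
  note \<epsilon>D = inverse_pairD[OF \<epsilon>]
  have conj: "\<epsilon>' b \<cdot>\<^bsub>D\<^esub> (f \<cdot>\<^bsub>D\<^esub> \<epsilon> a) \<in> hom D (ob_map F (g0 a)) (ob_map F (g0 b))"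
    if "f \<in> hom D a b" for f a b
    using that \<epsilon>D D.Comp_in D.hom_Ob by meson
  have "\<exists>h\<in>hom C (g0 (Dom D f)) (g0 (Cod D f)).
      mor_map F h = \<epsilon>' (Cod D f) \<cdot>\<^bsub>D\<^esub> (f \<cdot>\<^bsub>D\<^esub> \<epsilon> (Dom D f))" if "f \<in> Mor D" for f
    using conj[OF Mor_hom[OF that]] bij[OF g0[OF D.Dom_in] g0[OF D.Cod_in], OF that that]
    unfolding bij_betw_def by (metis imageE)
  then obtain g1 where g1: "g1 f \<in> hom C (g0 (Dom D f)) (g0 (Cod D f)) \<and>
      mor_map F (g1 f) = \<epsilon>' (Cod D f) \<cdot>\<^bsub>D\<^esub> (f \<cdot>\<^bsub>D\<^esub> \<epsilon> (Dom D f))" if "f \<in> Mor D" for f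
    by metis
  have g1h: "g1 f \<in> hom C (g0 a) (g0 b)"
    and Fg1: "mor_map F (g1 f) = \<epsilon>' b \<cdot>\<^bsub>D\<^esub> (f \<cdot>\<^bsub>D\<^esub> \<epsilon> a)" if "f \<in> hom D a b" for f a b
    using g1[of f] that by (auto simp: hom_def)
  have \<epsilon>_nat: "\<epsilon> b \<cdot>\<^bsub>D\<^esub> mor_map F (g1 f) = f \<cdot>\<^bsub>D\<^esub> \<epsilon> a" if f: "f \<in> hom D a b" for f a b
    unfolding Fg1[OF f]
    using D.cancel_inverse_left[OF inverse_pair_sym[OF \<epsilon>]] D.Comp_in[OF \<epsilon>D(1) f] D.hom_Ob[OF f]
    by metis
  define G where "G = \<lparr>ob_map = restrict g0 (Ob D), mor_map = restrict g1 (Mor D)\<rparr>"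
  have G_Id: "g1 (Id D a) = Id C (g0 a)" if a: "a \<in> Ob D" for a
  proof (rule F_inj[OF g1h[OF D.Id_in[OF a]] C.Id_in[OF g0[OF a]]])
    show "mor_map F (g1 (Id D a)) = mor_map F (Id C (g0 a))"
      using Fg1[OF D.Id_in[OF a]] D.Id_Comp[OF \<epsilon>D(1)[OF a]] \<epsilon>D(3)[OF a] functor_Id[OF F g0[OF a]]
      by simp
  qed
  \<comment> \<open>Faithfulness of \<open>F\<close> moves the law into \<open>D\<close>, where both
    sides agree after composition with the isomorphism \<open>\<epsilon> c\<close>.\<close>
  have G_Comp: "g1 (g \<cdot>\<^bsub>D\<^esub> f) = g1 g \<cdot>\<^bsub>C\<^esub> g1 f" if f: "f \<in> hom D a b" and g: "g \<in> hom D b c"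
    for f g a b c
  proof (rule F_inj)
    note a = D.hom_Ob(1)[OF f] and b = D.hom_Ob(1)[OF g] and c = D.hom_Ob(2)[OF g]
    note gf = D.Comp_in[OF f g]
    show "g1 (g \<cdot>\<^bsub>D\<^esub> f) \<in> hom C (g0 a) (g0 c)" by (rule g1h[OF gf])
    show *: "g1 g \<cdot>\<^bsub>C\<^esub> g1 f \<in> hom C (g0 a) (g0 c)"
      using C.Comp_in g1h[OF f] g1h[OF g] by blast
    note Ff = functor_hom[OF F g1h[OF f]] and Fg = functor_hom[OF F g1h[OF g]]
    have "\<epsilon> c \<cdot>\<^bsub>D\<^esub> mor_map F (g1 g \<cdot>\<^bsub>C\<^esub> g1 f) = (\<epsilon> c \<cdot>\<^bsub>D\<^esub> mor_map F (g1 g)) \<cdot>\<^bsub>D\<^esub> mor_map F (g1 f)"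
      using functor_Comp[OF F g1h[OF f] g1h[OF g]] D.assoc[OF Ff Fg \<epsilon>D(1)[OF c]] by simp
    also have "\<dots> = g \<cdot>\<^bsub>D\<^esub> (\<epsilon> b \<cdot>\<^bsub>D\<^esub> mor_map F (g1 f))"
      using \<epsilon>_nat[OF g] D.assoc[OF Ff \<epsilon>D(1)[OF b] g] by simp
    also have "\<dots> = (g \<cdot>\<^bsub>D\<^esub> f) \<cdot>\<^bsub>D\<^esub> \<epsilon> a"
      using \<epsilon>_nat[OF f] D.assoc[OF \<epsilon>D(1)[OF a] f g] by simp
    also have "\<dots> = \<epsilon> c \<cdot>\<^bsub>D\<^esub> mor_map F (g1 (g \<cdot>\<^bsub>D\<^esub> f))"
      using \<epsilon>_nat[OF gf] by simp
    finally show "mor_map F (g1 (g \<cdot>\<^bsub>D\<^esub> f)) = mor_map F (g1 g \<cdot>\<^bsub>C\<^esub> g1 f)"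
      using D.cancel_inverse_left[OF \<epsilon>[OF c]] functor_hom[OF F *] functor_hom[OF F g1h[OF gf]]
      by metis
  qed
  have G: "is_functor D C G"
    unfolding G_def using is_functorI[OF D g0 g1h G_Id G_Comp] .
  define y where "y a = ob_map F a" for a
  have y: "y a \<in> Ob D" if "a \<in> Ob C" for a using functor_Ob[OF F that] by (simp add: y_def)
  have "\<exists>h\<in>hom C a (g0 (y a)). mor_map F h = \<epsilon>' (y a)" if "a \<in> Ob C" for a
    using bij[OF that g0[OF y[OF that]]] \<epsilon>D(2)[OF y[OF that]]
    unfolding bij_betw_def y_def by (metis imageE)
  then obtain \<eta> where \<eta>: "\<eta> a \<in> hom C a (g0 (y a))" "mor_map F (\<eta> a) = \<epsilon>' (y a)"
    if "a \<in> Ob C" for a by metis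
  have "\<exists>h. inverse_pair C a (g0 (y a)) (\<eta> a) h \<and> mor_map F h = \<epsilon> (y a)" if a: "a \<in> Ob C" for a
  proof -
    have "\<exists>h\<in>hom C (g0 (y a)) a. mor_map F h = \<epsilon> (y a)"
      using bij[OF g0[OF y[OF that]] that] \<epsilon>D(1)[OF y[OF that]]
      unfolding bij_betw_def y_def by (metis imageE)
    then obtain h where h: "h \<in> hom C (g0 (y a)) a" "mor_map F h = \<epsilon> (y a)" by blast
    have "h \<cdot>\<^bsub>C\<^esub> \<eta> a = Id C a"
      using F_inj[OF C.Comp_in[OF \<eta>(1)[OF a] h(1)] C.Id_in[OF a]] functor_Id[OF F a]
        functor_Comp[OF F \<eta>(1)[OF a] h(1)] \<eta>(2)[OF a] h(2) \<epsilon>D(4)[OF y[OF a]]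
      by (simp add: y_def)
    moreover have "\<eta> a \<cdot>\<^bsub>C\<^esub> h = Id C (g0 (y a))"
      using F_inj[OF C.Comp_in[OF h(1) \<eta>(1)[OF a]] C.Id_in] functor_Id[OF F g0[OF y[OF a]]]
        functor_Comp[OF F h(1) \<eta>(1)[OF a]] \<eta>(2)[OF a] h(2) \<epsilon>D(3)[OF y[OF a]] g0[OF y[OF a]]
      by simp
    ultimately show ?thesis
      using h \<eta>(1)[OF a] by (auto simp: inverse_pair_def)
  qed
  then obtain \<eta>' where \<eta>': "\<And>a. a \<in> Ob C \<Longrightarrow> inverse_pair C a (g0 (y a)) (\<eta> a) (\<eta>' a)"
    "\<And>a. a \<in> Ob C \<Longrightarrow> mor_map F (\<eta>' a) = \<epsilon> (y a)"
    by metis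
  have \<eta>_nat: "\<eta> b \<cdot>\<^bsub>C\<^esub> f = g1 (mor_map F f) \<cdot>\<^bsub>C\<^esub> \<eta> a" if f: "f \<in> hom C a b" for f a b
  proof -
    note a = C.hom_Ob(1)[OF f] and b = C.hom_Ob(2)[OF f]
    have Ff: "mor_map F f \<in> hom D (y a) (y b)" using functor_hom[OF F f] by (simp add: y_def)
    have l: "\<eta> b \<cdot>\<^bsub>C\<^esub> f \<in> hom C a (g0 (y b))" using C.Comp_in[OF f \<eta>(1)[OF b]] .
    have r: "g1 (mor_map F f) \<cdot>\<^bsub>C\<^esub> \<eta> a \<in> hom C a (g0 (y b))"
      using C.Comp_in[OF \<eta>(1)[OF a] g1h[OF Ff]] .
    have "mor_map F (g1 (mor_map F f) \<cdot>\<^bsub>C\<^esub> \<eta> a) =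
        (\<epsilon>' (y b) \<cdot>\<^bsub>D\<^esub> (mor_map F f \<cdot>\<^bsub>D\<^esub> \<epsilon> (y a))) \<cdot>\<^bsub>D\<^esub> \<epsilon>' (y a)"
      using functor_Comp[OF F \<eta>(1)[OF a] g1h[OF Ff]] \<eta>(2)[OF a] Fg1[OF Ff] by simp
    also have "\<dots> = ((\<epsilon>' (y b) \<cdot>\<^bsub>D\<^esub> mor_map F f) \<cdot>\<^bsub>D\<^esub> \<epsilon> (y a)) \<cdot>\<^bsub>D\<^esub> \<epsilon>' (y a)"
      using D.assoc[OF \<epsilon>D(1)[OF y[OF a]] Ff \<epsilon>D(2)[OF y[OF b]]] by simp
    also have "\<dots> = \<epsilon>' (y b) \<cdot>\<^bsub>D\<^esub> mor_map F f"
      using D.cancel_inverse_right[OF \<epsilon>[OF y[OF a]] D.Comp_in[OF Ff \<epsilon>D(2)[OF y[OF b]]]] .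
    also have "\<dots> = mor_map F (\<eta> b \<cdot>\<^bsub>C\<^esub> f)"
      using functor_Comp[OF F f \<eta>(1)[OF b]] \<eta>(2)[OF b] by simp
    finally show ?thesis using F_inj[OF l r] by simp
  qed
  show ?thesis
  proof (rule that[OF G, of \<epsilon> \<epsilon>' \<eta> \<eta>'])
    show "inverse_pair D (ob_map F (ob_map G d)) d (\<epsilon> d) (\<epsilon>' d)" if "d \<in> Ob D" for d
      using \<epsilon>[OF that] that by (simp add: G_def)
    show "\<epsilon> b \<cdot>\<^bsub>D\<^esub> mor_map F (mor_map G f) = f \<cdot>\<^bsub>D\<^esub> \<epsilon> a" if "f \<in> hom D a b" for f a b
      using \<epsilon>_nat[OF that] hom_Mor[OF that] by (simp add: G_def)
    show "inverse_pair C a (ob_map G (ob_map F a)) (\<eta> a) (\<eta>' a)" if "a \<in> Ob C" for a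
      using \<eta>'(1)[OF that] y[OF that] by (simp add: G_def y_def)
    show "\<eta> b \<cdot>\<^bsub>C\<^esub> f = mor_map G (mor_map F f) \<cdot>\<^bsub>C\<^esub> \<eta> a" if "f \<in> hom C a b" for f a b
      using \<eta>_nat[OF that] hom_Mor[OF functor_hom[OF F that]] by (simp add: G_def)
    show "mor_map F (\<eta> a) = \<epsilon>' (ob_map F a)" if "a \<in> Ob C" for a
      using \<eta>(2)[OF that] by (simp add: y_def)
    show "mor_map F (\<eta>' a) = \<epsilon> (ob_map F a)" if "a \<in> Ob C" for a
      using \<eta>'(2)[OF that] by (simp add: y_def)
  qed
qed

lemma weak_equivalence_imp_equivalent:
  assumes C: "category C" and D: "category D" and W: "weak_equivalence C D F"
  shows "equivalent C D"
proof (rule weak_equivalence_inverse[OF C D W])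
  interpret C: category C by fact
  interpret D: category D by fact
  have F: "is_functor C D F"
    using W by (simp add: weak_equivalence_def)
  fix G \<epsilon> \<epsilon>' \<eta> \<eta>'
  assume G: "is_functor D C G"
    and \<epsilon>: "\<And>d. d \<in> Ob D \<Longrightarrow> inverse_pair D (ob_map F (ob_map G d)) d (\<epsilon> d) (\<epsilon>' d)"
    and \<epsilon>_nat: "\<And>f a b. f \<in> hom D a b \<Longrightarrow> \<epsilon> b \<cdot>\<^bsub>D\<^esub> mor_map F (mor_map G f) = f \<cdot>\<^bsub>D\<^esub> \<epsilon> a"
    and \<eta>: "\<And>a. a \<in> Ob C \<Longrightarrow> inverse_pair C a (ob_map G (ob_map F a)) (\<eta> a) (\<eta>' a)"
    and \<eta>_nat: "\<And>f a b. f \<in> hom C a b \<Longrightarrow> \<eta> b \<cdot>\<^bsub>C\<^esub> f = mor_map G (mor_map F f) \<cdot>\<^bsub>C\<^esub> \<eta> a"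
    and "\<And>a. a \<in> Ob C \<Longrightarrow> mor_map F (\<eta> a) = \<epsilon>' (ob_map F a)"
    and "\<And>a. a \<in> Ob C \<Longrightarrow> mor_map F (\<eta>' a) = \<epsilon> (ob_map F a)"
  have "nat_isomorphic D D (comp_funct D F G) (id_funct D)"
    unfolding nat_isomorphic_def nat_trans_def
  proof (intro exI conjI ballI)
    show "restrict \<epsilon> (Ob D) \<in> (\<Pi>\<^sub>E a\<in>Ob D. hom D (ob_map (comp_funct D F G) a) (ob_map (id_funct D) a))"
      using inverse_pairD(1)[OF \<epsilon>] by (auto simp: comp_funct_def id_funct_def)
    show "restrict \<epsilon> (Ob D) (Cod D f) \<cdot>\<^bsub>D\<^esub> mor_map (comp_funct D F G) f =
        mor_map (id_funct D) f \<cdot>\<^bsub>D\<^esub> restrict \<epsilon> (Ob D) (Dom D f)" if "f \<in> Mor D" for f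
      using \<epsilon>_nat[OF Mor_hom[OF that]] that D.Dom_in D.Cod_in
      by (simp add: comp_funct_def id_funct_def)
    show "is_iso D (restrict \<epsilon> (Ob D) a)" if "a \<in> Ob D" for a
      using inverse_pair_is_iso[OF \<epsilon>[OF that]] that by simp
  qed
  moreover have "nat_isomorphic C C (id_funct C) (comp_funct C G F)"
    unfolding nat_isomorphic_def nat_trans_def
  proof (intro exI conjI ballI)
    show "restrict \<eta> (Ob C) \<in> (\<Pi>\<^sub>E a\<in>Ob C. hom C (ob_map (id_funct C) a) (ob_map (comp_funct C G F) a))"
      using inverse_pairD(1)[OF \<eta>] by (auto simp: comp_funct_def id_funct_def)
    show "restrict \<eta> (Ob C) (Cod C f) \<cdot>\<^bsub>C\<^esub> mor_map (id_funct C) f =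
        mor_map (comp_funct C G F) f \<cdot>\<^bsub>C\<^esub> restrict \<eta> (Ob C) (Dom C f)" if "f \<in> Mor C" for f
      using \<eta>_nat[OF Mor_hom[OF that]] that C.Dom_in C.Cod_in
      by (simp add: comp_funct_def id_funct_def)
    show "is_iso C (restrict \<eta> (Ob C) a)" if "a \<in> Ob C" for a
      using inverse_pair_is_iso[OF \<eta>[OF that]] that by simp
  qed
  ultimately show ?thesis
    unfolding equivalent_def using F G by blast
qed

section \<open>Relational structures over a category\<close>

text \<open>\<open>R u x y\<close> stands for \<open>E(u)(x) < y\<close>. The axiom
  \<open>lift\<close> is what remains of the functor \<open>S\<close> on the core:
  \<open>S(g)(x)\<close> is the only \<open>y\<close> related to \<open>x\<close> in both directions
  along \<open>g\<close> and its inverse, so no action of the isomorphisms has to be part of the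
  data.\<close>

locale relational = category X
  for X :: "('o, 'm) cat" +
  fixes E :: "'o \<Rightarrow> 'e set" and R :: "'m \<Rightarrow> 'e \<Rightarrow> 'e \<Rightarrow> bool"
  assumes refl: "\<lbrakk>a \<in> Ob X; x \<in> E a\<rbrakk> \<Longrightarrow> R (Id X a) x x"
    and trans: "\<lbrakk>u \<in> hom X a b; v \<in> hom X b c; x \<in> E a; y \<in> E b; z \<in> E c; R u x y; R v y z\<rbrakk>
      \<Longrightarrow> R (v \<cdot>\<^bsub>X\<^esub> u) x z"
    and antisym: "\<lbrakk>a \<in> Ob X; x \<in> E a; y \<in> E a; R (Id X a) x y; R (Id X a) y x\<rbrakk> \<Longrightarrow> x = y"
    and lift: "\<lbrakk>inverse_pair X a b g h; x \<in> E a\<rbrakk> \<Longrightarrow> \<exists>y\<in>E b. R g x y \<and> R h y x"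
begin

text \<open>Two lifts lie below each other over the identity, through the element that they
  lift.\<close>

lemma lift_unique:
  assumes "inverse_pair X a b g h" "x \<in> E a" "y \<in> E b" "z \<in> E b"
    and "R g x y" "R h y x" "R g x z" "R h z x"
  shows "y = z"
proof (rule antisym)
  show "b \<in> Ob X" using inverse_pairD(1)[OF assms(1)] hom_Ob by blast
  show "R (Id X b) y z" "R (Id X b) z y"
    using trans[OF inverse_pairD(2,1)[OF assms(1)], of y x z]
      trans[OF inverse_pairD(2,1)[OF assms(1)], of z x y] inverse_pairD(4)[OF assms(1)] assms(2-8)
    by simp_all
qed fact+

end

definition rel_map :: "('o, 'm) cat \<Rightarrow> ('o \<Rightarrow> 'e set) \<Rightarrow> ('m \<Rightarrow> 'e \<Rightarrow> 'e \<Rightarrow> bool) \<Rightarrow>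
    ('o \<Rightarrow> 'k set) \<Rightarrow> ('m \<Rightarrow> 'k \<Rightarrow> 'k \<Rightarrow> bool) \<Rightarrow> ('o \<Rightarrow> 'e \<Rightarrow> 'k) \<Rightarrow> bool" where
  "rel_map X E R E' R' h \<longleftrightarrow> (\<forall>a\<in>Ob X. \<forall>x\<in>E a. h a x \<in> E' a) \<and>
    (\<forall>a b. \<forall>u\<in>hom X a b. \<forall>x\<in>E a. \<forall>y\<in>E b. R u x y \<longrightarrow> R' u (h a x) (h b y))"

definition rel_iso :: "('o, 'm) cat \<Rightarrow> ('o \<Rightarrow> 'e set) \<Rightarrow> ('m \<Rightarrow> 'e \<Rightarrow> 'e \<Rightarrow> bool) \<Rightarrow>
    ('o \<Rightarrow> 'k set) \<Rightarrow> ('m \<Rightarrow> 'k \<Rightarrow> 'k \<Rightarrow> bool) \<Rightarrow> ('o \<Rightarrow> 'e \<Rightarrow> 'k) \<Rightarrow> bool" where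
  "rel_iso X E R E' R' h \<longleftrightarrow> (\<forall>a\<in>Ob X. bij_betw (h a) (E a) (E' a)) \<and>
    (\<forall>a b. \<forall>u\<in>hom X a b. \<forall>x\<in>E a. \<forall>y\<in>E b. R' u (h a x) (h b y) \<longleftrightarrow> R u x y)"

lemma rel_isoI_maps:
  assumes "category X"
    and "rel_map X E R E' R' h" "rel_map X E' R' E R k"
    and "\<And>a x. \<lbrakk>a \<in> Ob X; x \<in> E a\<rbrakk> \<Longrightarrow> k a (h a x) = x"
    and "\<And>a x. \<lbrakk>a \<in> Ob X; x \<in> E' a\<rbrakk> \<Longrightarrow> h a (k a x) = x"
  shows "rel_iso X E R E' R' h"
  unfolding rel_iso_def
proof (intro conjI ballI allI)
  interpret category X by fact
  show "bij_betw (h a) (E a) (E' a)" if "a \<in> Ob X" for a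
  proof (rule bij_betw_byWitness[where f' = "k a"])
    show "h a ` E a \<subseteq> E' a" "k a ` E' a \<subseteq> E a"
      using assms(2,3) that unfolding rel_map_def by blast+
  qed (use that assms(4,5) in auto)
  fix a b u x y assume *: "u \<in> hom X a b" "x \<in> E a" "y \<in> E b"
  note ab = hom_Ob[OF *(1)]
  have "R u (k a (h a x)) (k b (h b y))" if "R' u (h a x) (h b y)"
    using assms(2,3) * that ab unfolding rel_map_def by blast
  then show "R' u (h a x) (h b y) \<longleftrightarrow> R u x y"
    using assms(2) assms(4)[OF ab(1) *(2)] assms(4)[OF ab(2) *(3)] * unfolding rel_map_def by metis
qed

lemma rel_iso_comp:
  assumes "category X" "rel_iso X E R E' R' h" "rel_iso X E' R' E'' R'' k"
  shows "rel_iso X E R E'' R'' (\<lambda>a. k a \<circ> h a)"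
  unfolding rel_iso_def
proof (intro conjI ballI allI)
  interpret category X by fact
  show "bij_betw (k a \<circ> h a) (E a) (E'' a)" if "a \<in> Ob X" for a
    using assms that unfolding rel_iso_def by (blast intro: bij_betw_trans)
  fix a b u x y assume *: "u \<in> hom X a b" "x \<in> E a" "y \<in> E b"
  then have "h a x \<in> E' a" "h b y \<in> E' b"
    using assms(2) hom_Ob[OF *(1)] unfolding rel_iso_def by (auto dest: bij_betwE)
  then show "R'' u ((k a \<circ> h a) x) ((k b \<circ> h b) y) \<longleftrightarrow> R u x y"
    using assms * unfolding rel_iso_def by simp
qed

lemma rel_iso_inverse:
  assumes "category X" "rel_iso X E R E' R' h"
  shows "rel_iso X E' R' E R (\<lambda>a. inv_into (E a) (h a))"
  unfolding rel_iso_def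
proof (intro conjI ballI allI)
  interpret category X by fact
  show "bij_betw (inv_into (E a) (h a)) (E' a) (E a)" if "a \<in> Ob X" for a
    using assms that unfolding rel_iso_def by (blast intro: bij_betw_inv_into)
  fix a b u x y assume *: "u \<in> hom X a b" "x \<in> E' a" "y \<in> E' b"
  have "bij_betw (h a) (E a) (E' a)" "bij_betw (h b) (E b) (E' b)"
    using assms(2) hom_Ob[OF *(1)] unfolding rel_iso_def by auto
  then have "inv_into (E a) (h a) x \<in> E a" "h a (inv_into (E a) (h a) x) = x"
    "inv_into (E b) (h b) y \<in> E b" "h b (inv_into (E b) (h b) y) = y"
    using * by (simp_all add: bij_betw_def inv_into_into f_inv_into_f)
  then show "R u (inv_into (E a) (h a) x) (inv_into (E b) (h b) y) \<longleftrightarrow> R' u x y"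
    using assms(2) *(1) unfolding rel_iso_def by metis
qed

lemma rel_iso_imp_rel_map:
  assumes "category X" "rel_iso X E R E' R' h"
  shows "rel_map X E R E' R' h"
  using assms(2) bij_betwE unfolding rel_iso_def rel_map_def by fast

lemma rel_map_comp:
  assumes "category X" "rel_map X E R E' R' h" "rel_map X E' R' E'' R'' k"
  shows "rel_map X E R E'' R'' (\<lambda>a x. k a (h a x))"
  unfolding rel_map_def
proof (intro conjI ballI allI impI)
  interpret category X by fact
  show "k a (h a x) \<in> E'' a" if "a \<in> Ob X" "x \<in> E a" for a x
    using assms(2,3) that unfolding rel_map_def by blast
  show "R'' u (k a (h a x)) (k b (h b y))"
    if u: "u \<in> hom X a b" and "x \<in> E a" "y \<in> E b" "R u x y" for a b u x y
  proof -
    have "h a x \<in> E' a" "h b y \<in> E' b" "R' u (h a x) (h b y)"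
      using assms(2) that hom_Ob[OF u] unfolding rel_map_def by blast+
    then show ?thesis
      using assms(3) u unfolding rel_map_def by blast
  qed
qed

lemma relational_pullback:
  assumes "category X" "is_functor X Y F" "relational Y E R"
  shows "relational X (\<lambda>a. E (ob_map F a)) (\<lambda>u. R (mor_map F u))"
proof -
  interpret X: category X by fact
  interpret Y: relational Y E R by fact
  note F = assms(2)
  show ?thesis
  proof
    show "R (mor_map F (Id X a)) x x" if "a \<in> Ob X" "x \<in> E (ob_map F a)" for a x
      using that functor_Id[OF F] functor_Ob[OF F] Y.refl by simp
    show "R (mor_map F (v \<cdot>\<^bsub>X\<^esub> u)) x z"
      if "u \<in> hom X a b" "v \<in> hom X b c" "x \<in> E (ob_map F a)" "y \<in> E (ob_map F b)"
        "z \<in> E (ob_map F c)" "R (mor_map F u) x y" "R (mor_map F v) y z" for u v a b c x y z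
      using Y.trans[OF functor_hom[OF F that(1)] functor_hom[OF F that(2)] that(3-7)]
        functor_Comp[OF F that(1,2)] by simp
    show "x = y" if "a \<in> Ob X" "x \<in> E (ob_map F a)" "y \<in> E (ob_map F a)"
      "R (mor_map F (Id X a)) x y" "R (mor_map F (Id X a)) y x" for a x y
      using that Y.antisym[OF functor_Ob[OF F that(1)]] functor_Id[OF F that(1)] by simp
    show "\<exists>y\<in>E (ob_map F b). R (mor_map F g) x y \<and> R (mor_map F h) y x"
      if "inverse_pair X a b g h" "x \<in> E (ob_map F a)" for a b g h x
      using Y.lift[OF functor_inverse_pair[OF assms(1) F that(1)] that(2)] .
  qed
qed

text \<open>\<open>K\<close> and \<open>L\<close> play the object and morphism maps of an
  endofunctor, and \<open>\<eta>\<close> a natural isomorphism from the identity to it. Lifting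
  along the components of \<open>\<eta>\<close> gives the bijections; naturality turns
  \<open>u\<close>, conjugated by these components, into \<open>L u\<close>.\<close>

lemma rel_iso_natural:
  assumes "relational X E R" "relational X (\<lambda>a. E (K a)) (\<lambda>u. R (L u))"
    and \<eta>: "\<And>a. a \<in> Ob X \<Longrightarrow> inverse_pair X a (K a) (\<eta> a) (\<eta>' a)"
    and L: "\<And>f a b. f \<in> hom X a b \<Longrightarrow> L f \<in> hom X (K a) (K b)"
    and nat: "\<And>f a b. f \<in> hom X a b \<Longrightarrow> \<eta> b \<cdot>\<^bsub>X\<^esub> f = L f \<cdot>\<^bsub>X\<^esub> \<eta> a"
  shows "\<exists>h. rel_iso X E R (\<lambda>a. E (K a)) (\<lambda>u. R (L u)) h"
proof -
  interpret E: relational X E R by fact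
  have "\<forall>a x. \<exists>y. a \<in> Ob X \<and> x \<in> E a \<longrightarrow> y \<in> E (K a) \<and> R (\<eta> a) x y \<and> R (\<eta>' a) y x"
    using E.lift[OF \<eta>] by blast
  then obtain h where h: "h a x \<in> E (K a)" "R (\<eta> a) x (h a x)" "R (\<eta>' a) (h a x) x"
    if "a \<in> Ob X" "x \<in> E a" for a x by metis
  have "\<forall>a x. \<exists>y. a \<in> Ob X \<and> x \<in> E (K a) \<longrightarrow> y \<in> E a \<and> R (\<eta>' a) x y \<and> R (\<eta> a) y x"
    using E.lift[OF inverse_pair_sym[OF \<eta>]] by blast
  then obtain k where k: "k a x \<in> E a" "R (\<eta>' a) x (k a x)" "R (\<eta> a) (k a x) x"
    if "a \<in> Ob X" "x \<in> E (K a)" for a x by metis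
  note \<eta>D = inverse_pairD[OF \<eta>]
  have "rel_map X E R (\<lambda>a. E (K a)) (\<lambda>u. R (L u)) h"
    unfolding rel_map_def
  proof (intro conjI ballI allI impI)
    fix a b u x y assume u: "u \<in> hom X a b" and x: "x \<in> E a" and y: "y \<in> E b" and xy: "R u x y"
    note a = E.hom_Ob(1)[OF u] and b = E.hom_Ob(2)[OF u]
    have 1: "u \<cdot>\<^bsub>X\<^esub> \<eta>' a \<in> hom X (K a) b" "R (u \<cdot>\<^bsub>X\<^esub> \<eta>' a) (h a x) y"
      using E.Comp_in[OF \<eta>D(2)[OF a] u] E.trans[OF \<eta>D(2)[OF a] u _ _ _ _ xy] h[OF a x] x y by auto
    have 2: "R (\<eta> b \<cdot>\<^bsub>X\<^esub> (u \<cdot>\<^bsub>X\<^esub> \<eta>' a)) (h a x) (h b y)"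
      using E.trans[OF 1(1) \<eta>D(1)[OF b] _ _ _ 1(2)] h[OF a x] h[OF b y] y by auto
    have "\<eta> b \<cdot>\<^bsub>X\<^esub> (u \<cdot>\<^bsub>X\<^esub> \<eta>' a) = L u"
      using E.assoc[OF \<eta>D(2)[OF a] u \<eta>D(1)[OF b]] nat[OF u]
        E.cancel_inverse_right[OF \<eta>[OF a] L[OF u]] by simp
    with 2 show "R (L u) (h a x) (h b y)" by simp
  qed (use h in auto)
  moreover have "rel_map X (\<lambda>a. E (K a)) (\<lambda>u. R (L u)) E R k"
    unfolding rel_map_def
  proof (intro conjI ballI allI impI)
    fix a b u x y assume u: "u \<in> hom X a b" and x: "x \<in> E (K a)" and y: "y \<in> E (K b)"
      and xy: "R (L u) x y"
    note a = E.hom_Ob(1)[OF u] and b = E.hom_Ob(2)[OF u]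
    have 1: "L u \<cdot>\<^bsub>X\<^esub> \<eta> a \<in> hom X a (K b)" "R (L u \<cdot>\<^bsub>X\<^esub> \<eta> a) (k a x) y"
      using E.Comp_in[OF \<eta>D(1)[OF a] L[OF u]] E.trans[OF \<eta>D(1)[OF a] L[OF u] _ _ _ _ xy]
        k[OF a x] x y by auto
    have 2: "R (\<eta>' b \<cdot>\<^bsub>X\<^esub> (L u \<cdot>\<^bsub>X\<^esub> \<eta> a)) (k a x) (k b y)"
      using E.trans[OF 1(1) \<eta>D(2)[OF b] _ _ _ 1(2)] k[OF a x] k[OF b y] y by auto
    have "\<eta>' b \<cdot>\<^bsub>X\<^esub> (L u \<cdot>\<^bsub>X\<^esub> \<eta> a) = u"
      using nat[OF u] E.cancel_inverse_left[OF \<eta>[OF b] u] by simp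
    with 2 show "R u (k a x) (k b y)" by simp
  qed (use k in auto)
  moreover have "k a (h a x) = x" if a: "a \<in> Ob X" and x: "x \<in> E a" for a x
    using E.lift_unique[OF inverse_pair_sym[OF \<eta>[OF a]], of "h a x" "k a (h a x)" x]
      h[OF a x] k[OF a h(1)[OF a x]] x by blast
  moreover have "h a (k a x) = x" if a: "a \<in> Ob X" and x: "x \<in> E (K a)" for a x
    using E.lift_unique[OF \<eta>[OF a], of "k a x" "h a (k a x)" x]
      k[OF a x] h[OF a k(1)[OF a x]] x by blast
  ultimately show ?thesis
    using rel_isoI_maps[OF E.category_axioms] by blast
qed

section \<open>Presentations\<close>

text \<open>All that is used of a category of species: up to equivalence it is the category of small
  relational structures over \<open>X\<close>. The objects stay abstract and only carry structures,
  so that the category and the base can be changed independently, by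
  \<open>precompose_weak_equivalence\<close> and by \<open>change_base\<close>.\<close>

locale presentation = C: category C + X: category X
  for C :: "('c, 'f) cat" and X :: "('o, 'm) cat" +
  fixes U :: "'v \<Rightarrow> 'v set"
    and el :: "'c \<Rightarrow> 'o \<Rightarrow> 'v set"
    and ap :: "'f \<Rightarrow> 'o \<Rightarrow> 'v \<Rightarrow> 'v"
    and rel :: "'c \<Rightarrow> 'm \<Rightarrow> 'v \<Rightarrow> 'v \<Rightarrow> bool"
  assumes relational: "c \<in> Ob C \<Longrightarrow> relational X (el c) (rel c)"
    and small_el: "\<lbrakk>c \<in> Ob C; a \<in> Ob X\<rbrakk> \<Longrightarrow> small U (el c a)"
    and ap_map: "f \<in> hom C c d \<Longrightarrow> rel_map X (el c) (rel c) (el d) (rel d) (ap f)"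
    and ap_Id: "\<lbrakk>c \<in> Ob C; a \<in> Ob X; x \<in> el c a\<rbrakk> \<Longrightarrow> ap (Id C c) a x = x"
    and ap_Comp: "\<lbrakk>f \<in> hom C c d; g \<in> hom C d e; a \<in> Ob X; x \<in> el c a\<rbrakk> \<Longrightarrow>
      ap (g \<cdot>\<^bsub>C\<^esub> f) a x = ap g a (ap f a x)"
    and faithful: "\<lbrakk>f \<in> hom C c d; g \<in> hom C c d;
      \<And>a x. \<lbrakk>a \<in> Ob X; x \<in> el c a\<rbrakk> \<Longrightarrow> ap f a x = ap g a x\<rbrakk> \<Longrightarrow> f = g"
    and full: "\<lbrakk>c \<in> Ob C; d \<in> Ob C; rel_map X (el c) (rel c) (el d) (rel d) h\<rbrakk> \<Longrightarrow>
      \<exists>f\<in>hom C c d. \<forall>a\<in>Ob X. \<forall>x\<in>el c a. ap f a x = h a x"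
    and realize: "\<And>(E :: 'o \<Rightarrow> 'v set) R. \<lbrakk>relational X E R; \<And>a. a \<in> Ob X \<Longrightarrow> small U (E a)\<rbrakk> \<Longrightarrow>
      \<exists>c\<in>Ob C. \<exists>h. rel_iso X E R (el c) (rel c) h"
begin

lemma ap_in: "\<lbrakk>f \<in> hom C c d; a \<in> Ob X; x \<in> el c a\<rbrakk> \<Longrightarrow> ap f a x \<in> el d a"
  using ap_map unfolding rel_map_def by blast

lemma ap_rel: "\<lbrakk>f \<in> hom C c d; u \<in> hom X a b; x \<in> el c a; y \<in> el c b; rel c u x y\<rbrakk> \<Longrightarrow>
    rel d u (ap f a x) (ap f b y)"
  using ap_map unfolding rel_map_def by blast

lemma inverse_pair_rel_iso:
  assumes "inverse_pair C c d f g"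
  shows "rel_iso X (el c) (rel c) (el d) (rel d) (ap f)"
proof (rule rel_isoI_maps[OF X.category_axioms])
  note fg = inverse_pairD[OF assms]
  show "rel_map X (el c) (rel c) (el d) (rel d) (ap f)" "rel_map X (el d) (rel d) (el c) (rel c) (ap g)"
    using ap_map fg by auto
  show "ap g a (ap f a x) = x" if "a \<in> Ob X" "x \<in> el c a" for a x
    using ap_Comp[OF fg(1,2) that] ap_Id[OF _ that] fg(3) C.hom_Ob[OF fg(1)] by simp
  show "ap f a (ap g a x) = x" if "a \<in> Ob X" "x \<in> el d a" for a x
    using ap_Comp[OF fg(2,1) that] ap_Id[OF _ that] fg(4) C.hom_Ob[OF fg(1)] by simp
qed

text \<open>This turns an equivalence between two categories of species into a second presentation
  of the first category, over the base of the other one.\<close>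

lemma precompose_weak_equivalence:
  assumes B: "category B" and W: "weak_equivalence B C \<Phi>"
  shows "presentation B X U (\<lambda>c. el (ob_map \<Phi> c)) (\<lambda>f. ap (mor_map \<Phi> f)) (\<lambda>c. rel (ob_map \<Phi> c))"
proof -
  interpret B: category B by fact
  have \<Phi>: "is_functor B C \<Phi>"
    using W by (simp add: weak_equivalence_def)
  have bij: "bij_betw (mor_map \<Phi>) (hom B a b) (hom C (ob_map \<Phi> a) (ob_map \<Phi> b))"
    if "a \<in> Ob B" "b \<in> Ob B" for a b
    using W that by (auto simp: weak_equivalence_def)
  note Ob = functor_Ob[OF \<Phi>] and hom = functor_hom[OF \<Phi>]
  show ?thesis
  proof (intro presentation.intro presentation_axioms.intro B.category_axioms X.category_axioms)
    fix c assume c: "c \<in> Ob B"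
    show "relational X (el (ob_map \<Phi> c)) (rel (ob_map \<Phi> c))"
      using relational[OF Ob[OF c]] .
    show "small U (el (ob_map \<Phi> c) a)" if "a \<in> Ob X" for a
      using small_el[OF Ob[OF c] that] .
    show "ap (mor_map \<Phi> (Id B c)) a x = x" if "a \<in> Ob X" "x \<in> el (ob_map \<Phi> c) a" for a x
      using ap_Id[OF Ob[OF c] that] functor_Id[OF \<Phi> c] by simp
  next
    fix c d f assume f: "f \<in> hom B c d"
    show "rel_map X (el (ob_map \<Phi> c)) (rel (ob_map \<Phi> c)) (el (ob_map \<Phi> d)) (rel (ob_map \<Phi> d))
        (ap (mor_map \<Phi> f))"
      using ap_map[OF hom[OF f]] .
    show "ap (mor_map \<Phi> (g \<cdot>\<^bsub>B\<^esub> f)) a x = ap (mor_map \<Phi> g) a (ap (mor_map \<Phi> f) a x)"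
      if "g \<in> hom B d e" "a \<in> Ob X" "x \<in> el (ob_map \<Phi> c) a" for g e a x
      using ap_Comp[OF hom[OF f] hom[OF that(1)] that(2,3)] functor_Comp[OF \<Phi> f that(1)] by simp
    fix g assume g: "g \<in> hom B c d"
      and *: "\<And>a x. a \<in> Ob X \<Longrightarrow> x \<in> el (ob_map \<Phi> c) a \<Longrightarrow> ap (mor_map \<Phi> f) a x = ap (mor_map \<Phi> g) a x"
    have "mor_map \<Phi> f = mor_map \<Phi> g"
      using faithful[OF hom[OF f] hom[OF g] *] by blast
    then show "f = g"
      using bij[OF B.hom_Ob[OF f]] f g by (auto simp: bij_betw_def inj_on_def)
  next
    fix c d h assume cd: "c \<in> Ob B" "d \<in> Ob B" and h: "rel_map X (el (ob_map \<Phi> c)) (rel (ob_map \<Phi> c))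
        (el (ob_map \<Phi> d)) (rel (ob_map \<Phi> d)) h"
    obtain f where f: "f \<in> hom C (ob_map \<Phi> c) (ob_map \<Phi> d)"
      "\<forall>a\<in>Ob X. \<forall>x\<in>el (ob_map \<Phi> c) a. ap f a x = h a x"
      using full[OF Ob[OF cd(1)] Ob[OF cd(2)] h] by blast
    obtain f0 where "f0 \<in> hom B c d" "mor_map \<Phi> f0 = f"
      using bij_betw_imp_surj_on[OF bij[OF cd]] f(1) by (metis imageE)
    then show "\<exists>f\<in>hom B c d. \<forall>a\<in>Ob X. \<forall>x\<in>el (ob_map \<Phi> c) a. ap (mor_map \<Phi> f) a x = h a x"
      using f(2) by blast
  next
    fix E :: "'o \<Rightarrow> 'v set" and R
    assume ER: "relational X E R" "\<And>a. a \<in> Ob X \<Longrightarrow> small U (E a)"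
    obtain d h where d: "d \<in> Ob C" and h: "rel_iso X E R (el d) (rel d) h"
      using realize[OF ER] by blast
    obtain c f g where c: "c \<in> Ob B" and fg: "inverse_pair C (ob_map \<Phi> c) d f g"
      using W d unfolding weak_equivalence_def by blast
    show "\<exists>c\<in>Ob B. \<exists>h. rel_iso X E R (el (ob_map \<Phi> c)) (rel (ob_map \<Phi> c)) h"
      using rel_iso_comp[OF X.category_axioms h inverse_pair_rel_iso[OF inverse_pair_sym[OF fg]]] c
      by blast
  qed
qed

text \<open>Restriction along \<open>F\<close> loses nothing: every element over an object
  \<open>b\<close> of \<open>X\<close> is the transport along \<open>\<epsilon> b\<close> of an
  element over \<open>F (G b)\<close>.\<close>

lemma change_base:
  assumes Y: "category Y" and W: "weak_equivalence Y X F"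
  shows "presentation C Y U (\<lambda>c a. el c (ob_map F a)) (\<lambda>f a. ap f (ob_map F a))
    (\<lambda>c u. rel c (mor_map F u))"
proof (rule weak_equivalence_inverse[OF Y X.category_axioms W])
  interpret Y: category Y by fact
  have F: "is_functor Y X F"
    using W by (simp add: weak_equivalence_def)
  note FOb = functor_Ob[OF F] and Fhom = functor_hom[OF F]
  fix G \<epsilon> \<epsilon>' \<eta> \<eta>'
  assume G: "is_functor X Y G"
    and \<epsilon>: "\<And>d. d \<in> Ob X \<Longrightarrow> inverse_pair X (ob_map F (ob_map G d)) d (\<epsilon> d) (\<epsilon>' d)"
    and \<epsilon>_nat: "\<And>f a b. f \<in> hom X a b \<Longrightarrow> \<epsilon> b \<cdot>\<^bsub>X\<^esub> mor_map F (mor_map G f) = f \<cdot>\<^bsub>X\<^esub> \<epsilon> a"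
    and \<eta>: "\<And>a. a \<in> Ob Y \<Longrightarrow> inverse_pair Y a (ob_map G (ob_map F a)) (\<eta> a) (\<eta>' a)"
    and \<eta>_nat: "\<And>f a b. f \<in> hom Y a b \<Longrightarrow> \<eta> b \<cdot>\<^bsub>Y\<^esub> f = mor_map G (mor_map F f) \<cdot>\<^bsub>Y\<^esub> \<eta> a"
    and F\<eta>: "\<And>a. a \<in> Ob Y \<Longrightarrow> mor_map F (\<eta> a) = \<epsilon>' (ob_map F a)"
      "\<And>a. a \<in> Ob Y \<Longrightarrow> mor_map F (\<eta>' a) = \<epsilon> (ob_map F a)"
  note \<epsilon>D = inverse_pairD[OF \<epsilon>] and \<eta>D = inverse_pairD[OF \<eta>]
  note GOb = functor_Ob[OF G] and Ghom = functor_hom[OF G]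
  have pull: "\<exists>x0\<in>el c (ob_map F (ob_map G b)). rel c (\<epsilon>' b) x x0 \<and> rel c (\<epsilon> b) x0 x"
    if "c \<in> Ob C" "b \<in> Ob X" "x \<in> el c b" for c b x
    using relational.lift[OF relational[OF that(1)] inverse_pair_sym[OF \<epsilon>[OF that(2)]] that(3)] .
  show ?thesis
  proof (intro presentation.intro presentation_axioms.intro C.category_axioms Y)
    fix c assume c: "c \<in> Ob C"
    show "relational Y (\<lambda>a. el c (ob_map F a)) (\<lambda>u. rel c (mor_map F u))"
      using relational_pullback[OF Y F relational[OF c]] .
    show "small U (el c (ob_map F a))" if "a \<in> Ob Y" for a
      using small_el[OF c FOb[OF that]] .
    show "ap (Id C c) (ob_map F a) x = x" if "a \<in> Ob Y" "x \<in> el c (ob_map F a)" for a x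
      using ap_Id[OF c FOb[OF that(1)] that(2)] .
  next
    fix c d f assume f: "f \<in> hom C c d"
    show "rel_map Y (\<lambda>a. el c (ob_map F a)) (\<lambda>u. rel c (mor_map F u)) (\<lambda>a. el d (ob_map F a))
        (\<lambda>u. rel d (mor_map F u)) (\<lambda>a. ap f (ob_map F a))"
      using ap_in[OF f] ap_rel[OF f] FOb Fhom unfolding rel_map_def by blast
    show "ap (g \<cdot>\<^bsub>C\<^esub> f) (ob_map F a) x = ap g (ob_map F a) (ap f (ob_map F a) x)"
      if "g \<in> hom C d e" "a \<in> Ob Y" "x \<in> el c (ob_map F a)" for g e a x
      using ap_Comp[OF f that(1) FOb[OF that(2)] that(3)] .
    fix g assume g: "g \<in> hom C c d" and
      *: "\<And>a x. a \<in> Ob Y \<Longrightarrow> x \<in> el c (ob_map F a) \<Longrightarrow> ap f (ob_map F a) x = ap g (ob_map F a) x"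
    note c = C.hom_Ob(1)[OF f] and d = C.hom_Ob(2)[OF f]
    show "f = g"
    proof (rule faithful[OF f g])
      fix b x assume b: "b \<in> Ob X" and x: "x \<in> el c b"
      obtain x0 where x0: "x0 \<in> el c (ob_map F (ob_map G b))" "rel c (\<epsilon>' b) x x0" "rel c (\<epsilon> b) x0 x"
        using pull[OF c b x] by blast
      have eq: "ap f (ob_map F (ob_map G b)) x0 = ap g (ob_map F (ob_map G b)) x0"
        using *[OF GOb[OF b] x0(1)] .
      show "ap f b x = ap g b x"
      proof (rule relational.lift_unique[OF relational[OF d] \<epsilon>[OF b]])
        show "ap f (ob_map F (ob_map G b)) x0 \<in> el d (ob_map F (ob_map G b))"
          "ap f b x \<in> el d b" "ap g b x \<in> el d b"
          using ap_in[OF f] ap_in[OF g] b x x0(1) FOb GOb by auto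
        show "rel d (\<epsilon> b) (ap f (ob_map F (ob_map G b)) x0) (ap f b x)"
          "rel d (\<epsilon>' b) (ap f b x) (ap f (ob_map F (ob_map G b)) x0)"
          using ap_rel[OF f] \<epsilon>D(1,2)[OF b] x x0 by auto
        show "rel d (\<epsilon> b) (ap f (ob_map F (ob_map G b)) x0) (ap g b x)"
          "rel d (\<epsilon>' b) (ap g b x) (ap f (ob_map F (ob_map G b)) x0)"
          unfolding eq using ap_rel[OF g] \<epsilon>D(1,2)[OF b] x x0 by auto
      qed
    qed
  next
    fix c d h assume c: "c \<in> Ob C" and d: "d \<in> Ob C" and h: "rel_map Y (\<lambda>a. el c (ob_map F a))
      (\<lambda>u. rel c (mor_map F u)) (\<lambda>a. el d (ob_map F a)) (\<lambda>u. rel d (mor_map F u)) h"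
    have h_in: "h a x \<in> el d (ob_map F a)" if "a \<in> Ob Y" "x \<in> el c (ob_map F a)" for a x
      using h that unfolding rel_map_def by blast
    have h_rel: "rel d (mor_map F u) (h a x) (h b y)" if "u \<in> hom Y a b"
      "x \<in> el c (ob_map F a)" "y \<in> el c (ob_map F b)" "rel c (mor_map F u) x y" for u a b x y
      using h that unfolding rel_map_def by blast
    let ?FG = "\<lambda>b. ob_map F (ob_map G b)"
    \<comment> \<open>The extension of \<open>h\<close> to all of \<open>X\<close> is forced:
      \<open>k\<close> carries an element to \<open>F (G b)\<close>, where \<open>h\<close> is
      defined, and \<open>l\<close> carries the result back to \<open>b\<close>.\<close>
    obtain k where k: "k b x \<in> el c (?FG b)" "rel c (\<epsilon>' b) x (k b x)" "rel c (\<epsilon> b) (k b x) x"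
      if "b \<in> Ob X" "x \<in> el c b" for b x
      using pull[OF c] by metis
    have hk: "h (ob_map G b) (k b x) \<in> el d (?FG b)" if "b \<in> Ob X" "x \<in> el c b" for b x
      using h_in[OF GOb k(1)] that by blast
    have "\<exists>y\<in>el d b. rel d (\<epsilon> b) (h (ob_map G b) (k b x)) y \<and> rel d (\<epsilon>' b) y (h (ob_map G b) (k b x))"
      if "b \<in> Ob X" "x \<in> el c b" for b x
      using relational.lift[OF relational[OF d] \<epsilon>[OF that(1)] hk[OF that]] .
    then obtain l where l: "l b x \<in> el d b" "rel d (\<epsilon> b) (h (ob_map G b) (k b x)) (l b x)"
        "rel d (\<epsilon>' b) (l b x) (h (ob_map G b) (k b x))" if "b \<in> Ob X" "x \<in> el c b" for b x
      by metis
    have "rel_map X (el c) (rel c) (el d) (rel d) l"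
      unfolding rel_map_def
    proof (intro conjI ballI allI impI)
      show "l b x \<in> el d b" if "b \<in> Ob X" "x \<in> el c b" for b x using l that by blast
      fix a b u x y assume u: "u \<in> hom X a b" and x: "x \<in> el c a" and y: "y \<in> el c b"
        and xy: "rel c u x y"
      note a = X.hom_Ob(1)[OF u] and b = X.hom_Ob(2)[OF u]
      note FGu = Fhom[OF Ghom[OF u]]
      have 1: "u \<cdot>\<^bsub>X\<^esub> \<epsilon> a \<in> hom X (?FG a) b" "rel c (u \<cdot>\<^bsub>X\<^esub> \<epsilon> a) (k a x) y"
        using X.Comp_in[OF \<epsilon>D(1)[OF a] u] xy k[OF a x] x y
          relational.trans[OF relational[OF c] \<epsilon>D(1)[OF a] u, of "k a x" x y] by auto
      have 2: "rel c (\<epsilon>' b \<cdot>\<^bsub>X\<^esub> (u \<cdot>\<^bsub>X\<^esub> \<epsilon> a)) (k a x) (k b y)"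
        using relational.trans[OF relational[OF c] 1(1) \<epsilon>D(2)[OF b], of "k a x" y "k b y"]
          1(2) k[OF a x] k[OF b y] y by auto
      have "\<epsilon>' b \<cdot>\<^bsub>X\<^esub> (u \<cdot>\<^bsub>X\<^esub> \<epsilon> a) = mor_map F (mor_map G u)"
        using \<epsilon>_nat[OF u] X.cancel_inverse_left[OF \<epsilon>[OF b] FGu] by simp
      then have 3: "rel d (mor_map F (mor_map G u)) (h (ob_map G a) (k a x)) (h (ob_map G b) (k b y))"
        using h_rel[OF Ghom[OF u] k(1)[OF a x] k(1)[OF b y]] 2 by simp
      have 4: "mor_map F (mor_map G u) \<cdot>\<^bsub>X\<^esub> \<epsilon>' a \<in> hom X a (?FG b)"
        "rel d (mor_map F (mor_map G u) \<cdot>\<^bsub>X\<^esub> \<epsilon>' a) (l a x) (h (ob_map G b) (k b y))"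
        using X.Comp_in[OF \<epsilon>D(2)[OF a] FGu] 3 l[OF a x] hk[OF a x] hk[OF b y]
          relational.trans[OF relational[OF d] \<epsilon>D(2)[OF a] FGu] by auto
      have 5: "rel d (\<epsilon> b \<cdot>\<^bsub>X\<^esub> (mor_map F (mor_map G u) \<cdot>\<^bsub>X\<^esub> \<epsilon>' a)) (l a x) (l b y)"
        using relational.trans[OF relational[OF d] 4(1) \<epsilon>D(1)[OF b] _ _ _ 4(2)]
          l[OF a x] l[OF b y] hk[OF b y] by auto
      have "\<epsilon> b \<cdot>\<^bsub>X\<^esub> (mor_map F (mor_map G u) \<cdot>\<^bsub>X\<^esub> \<epsilon>' a) = u"
        using X.assoc[OF \<epsilon>D(2)[OF a] FGu \<epsilon>D(1)[OF b]] \<epsilon>_nat[OF u]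
          X.cancel_inverse_right[OF \<epsilon>[OF a] u] by simp
      with 5 show "rel d u (l a x) (l b y)" by simp
    qed
    then obtain f where f: "f \<in> hom C c d" "\<And>b x. b \<in> Ob X \<Longrightarrow> x \<in> el c b \<Longrightarrow> ap f b x = l b x"
      using full[OF c d] by blast
    \<comment> \<open>Both sides are lifts of the same element along \<open>\<epsilon>\<close> at
      \<open>F a\<close>. For \<open>h a x\<close> this holds because \<open>h\<close> preserves the
      relations along \<open>\<eta> a\<close> and its inverse, whose images under \<open>F\<close>
      are the inverse of \<open>\<epsilon>\<close> and \<open>\<epsilon>\<close> itself.\<close>
    have "l (ob_map F a) x = h a x" if a: "a \<in> Ob Y" and x: "x \<in> el c (ob_map F a)" for a x
    proof (rule relational.lift_unique[OF relational[OF d] \<epsilon>[OF FOb[OF a]]])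
      let ?b = "ob_map F a"
      note b = FOb[OF a]
      show "h (ob_map G ?b) (k ?b x) \<in> el d (?FG ?b)" "l ?b x \<in> el d ?b" "h a x \<in> el d ?b"
        using hk[OF b x] l(1)[OF b x] h_in[OF a x] .
      show "rel d (\<epsilon> ?b) (h (ob_map G ?b) (k ?b x)) (l ?b x)"
        "rel d (\<epsilon>' ?b) (l ?b x) (h (ob_map G ?b) (k ?b x))"
        using l[OF b x] by auto
      show "rel d (\<epsilon> ?b) (h (ob_map G ?b) (k ?b x)) (h a x)"
        "rel d (\<epsilon>' ?b) (h a x) (h (ob_map G ?b) (k ?b x))"
        using h_rel[OF \<eta>D(2)[OF a] k(1)[OF b x] x] h_rel[OF \<eta>D(1)[OF a] x k(1)[OF b x]]
          F\<eta>[OF a] k[OF b x] by auto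
    qed
    then show "\<exists>f\<in>hom C c d. \<forall>a\<in>Ob Y. \<forall>x\<in>el c (ob_map F a). ap f (ob_map F a) x = h a x"
      using f FOb by (intro bexI[OF _ f(1)] ballI) simp
  next
    fix E :: "_ \<Rightarrow> 'v set" and R
    assume ER: "relational Y E R" and small: "\<And>a. a \<in> Ob Y \<Longrightarrow> small U (E a)"
    \<comment> \<open>The structure is realized after restriction along \<open>G\<close>.
      Restricting back along \<open>F\<close> gives its restriction along \<open>G F\<close>, which
      \<open>\<eta>\<close> identifies with the structure itself.\<close>
    have EG: "relational X (\<lambda>a. E (ob_map G a)) (\<lambda>u. R (mor_map G u))"
      using relational_pullback[OF X.category_axioms G ER] .
    obtain c h where c: "c \<in> Ob C"
      and h: "rel_iso X (\<lambda>a. E (ob_map G a)) (\<lambda>u. R (mor_map G u)) (el c) (rel c) h"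
      using realize[OF EG] small GOb by blast
    have 1: "rel_iso Y (\<lambda>a. E (ob_map G (ob_map F a))) (\<lambda>u. R (mor_map G (mor_map F u)))
      (\<lambda>a. el c (ob_map F a)) (\<lambda>u. rel c (mor_map F u)) (\<lambda>a. h (ob_map F a))"
      using h FOb Fhom unfolding rel_iso_def by blast
    obtain k where "rel_iso Y E R (\<lambda>a. E (ob_map G (ob_map F a))) (\<lambda>u. R (mor_map G (mor_map F u))) k"
      using rel_iso_natural[OF ER relational_pullback[OF Y F EG] \<eta> Ghom[OF Fhom] \<eta>_nat] by blast
    then show "\<exists>c\<in>Ob C. \<exists>h. rel_iso Y E R (\<lambda>a. el c (ob_map F a)) (\<lambda>u. rel c (mor_map F u)) h"
      using rel_iso_comp[OF Y _ 1] c by blast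
  qed
qed

end

text \<open>Each object of \<open>C\<close> is sent to an object of \<open>D\<close> realizing its
  structure. A morphism on either side is the same as a map of structures, so conjugation with the
  chosen isomorphisms \<open>\<beta>\<close> is functorial and bijective on morphisms.\<close>

lemma presentation_unique:
  assumes "presentation C X U el ap rel" "presentation D X U el' ap' rel'"
  shows "equivalent C D"
proof -
  interpret P: presentation C X U el ap rel by fact
  interpret Q: presentation D X U el' ap' rel' by fact
  note cat = P.X.category_axioms
  have "\<forall>c\<in>Ob C. \<exists>d. d \<in> Ob D \<and> (\<exists>h. rel_iso X (el c) (rel c) (el' d) (rel' d) h)"
    using Q.realize[OF P.relational P.small_el] by blast
  then obtain \<phi> \<beta> where \<phi>: "\<And>c. c \<in> Ob C \<Longrightarrow> \<phi> c \<in> Ob D"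
    and \<beta>: "\<And>c. c \<in> Ob C \<Longrightarrow> rel_iso X (el c) (rel c) (el' (\<phi> c)) (rel' (\<phi> c)) (\<beta> c)"
    by metis
  define \<gamma> where "\<gamma> c a = inv_into (el c a) (\<beta> c a)" for c a
  have \<gamma>: "rel_iso X (el' (\<phi> c)) (rel' (\<phi> c)) (el c) (rel c) (\<gamma> c)" if "c \<in> Ob C" for c
    using rel_iso_inverse[OF cat \<beta>[OF that]] unfolding \<gamma>_def .
  have bij: "bij_betw (\<beta> c a) (el c a) (el' (\<phi> c) a)" if "c \<in> Ob C" "a \<in> Ob X" for c a
    using \<beta> that unfolding rel_iso_def by blast
  have \<gamma>\<beta>: "\<gamma> c a (\<beta> c a x) = x" if "c \<in> Ob C" "a \<in> Ob X" "x \<in> el c a" for c a x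
    using bij[OF that(1,2)] that(3) by (simp add: \<gamma>_def bij_betw_def)
  have \<beta>\<gamma>: "\<beta> c a (\<gamma> c a x) = x" if "c \<in> Ob C" "a \<in> Ob X" "x \<in> el' (\<phi> c) a" for c a x
    using bij[OF that(1,2)] that(3) by (simp add: \<gamma>_def bij_betw_def f_inv_into_f)
  have \<beta>_in: "\<beta> c a x \<in> el' (\<phi> c) a" if "c \<in> Ob C" "a \<in> Ob X" "x \<in> el c a" for c a x
    using bij that bij_betwE by blast
  have \<gamma>_in: "\<gamma> c a x \<in> el c a" if "c \<in> Ob C" "a \<in> Ob X" "x \<in> el' (\<phi> c) a" for c a x
    using bij_betwE[OF bij_betw_inv_into[OF bij[OF that(1,2)]]] that(3) by (simp add: \<gamma>_def)
  have "\<exists>g. g \<in> hom D (\<phi> (Dom C f)) (\<phi> (Cod C f)) \<and> (\<forall>a\<in>Ob X. \<forall>x\<in>el' (\<phi> (Dom C f)) a.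
      ap' g a x = \<beta> (Cod C f) a (ap f a (\<gamma> (Dom C f) a x)))" if "f \<in> Mor C" for f
  proof -
    have "rel_map X (el' (\<phi> (Dom C f))) (rel' (\<phi> (Dom C f))) (el' (\<phi> (Cod C f))) (rel' (\<phi> (Cod C f)))
        (\<lambda>a x. \<beta> (Cod C f) a (ap f a (\<gamma> (Dom C f) a x)))"
      by (rule rel_map_comp[OF cat rel_map_comp[OF cat rel_iso_imp_rel_map[OF cat \<gamma>]
            P.ap_map[OF Mor_hom]] rel_iso_imp_rel_map[OF cat \<beta>]])
        (use that P.C.Dom_in P.C.Cod_in in auto)
    from Q.full[OF \<phi> \<phi> this] show ?thesis
      using that P.C.Dom_in P.C.Cod_in by blast
  qed
  then obtain \<mu> where \<mu>0: "\<And>f. f \<in> Mor C \<Longrightarrow> \<mu> f \<in> hom D (\<phi> (Dom C f)) (\<phi> (Cod C f)) \<and>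
      (\<forall>a\<in>Ob X. \<forall>x\<in>el' (\<phi> (Dom C f)) a. ap' (\<mu> f) a x = \<beta> (Cod C f) a (ap f a (\<gamma> (Dom C f) a x)))"
    by metis
  have \<mu>_in: "\<mu> f \<in> hom D (\<phi> c) (\<phi> d)"
    and \<mu>: "\<And>a x. \<lbrakk>a \<in> Ob X; x \<in> el' (\<phi> c) a\<rbrakk> \<Longrightarrow> ap' (\<mu> f) a x = \<beta> d a (ap f a (\<gamma> c a x))"
    if "f \<in> hom C c d" for f c d
    using \<mu>0[of f] that by (auto simp: hom_def)
  define F where "F = \<lparr>ob_map = restrict \<phi> (Ob C), mor_map = restrict \<mu> (Mor C)\<rparr>"
  have \<mu>_Id: "\<mu> (Id C c) = Id D (\<phi> c)" if c: "c \<in> Ob C" for c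
    by (rule Q.faithful[OF \<mu>_in[OF P.C.Id_in[OF c]] Q.C.Id_in[OF \<phi>[OF c]]])
      (simp add: \<mu>[OF P.C.Id_in[OF c]] P.ap_Id[OF c] Q.ap_Id[OF \<phi>[OF c]] \<gamma>_in c \<beta>\<gamma>)
  have \<mu>_Comp: "\<mu> (g \<cdot>\<^bsub>C\<^esub> f) = \<mu> g \<cdot>\<^bsub>D\<^esub> \<mu> f" if f: "f \<in> hom C c d" and g: "g \<in> hom C d e" for f g c d e
  proof (rule Q.faithful[OF \<mu>_in[OF P.C.Comp_in[OF f g]] Q.C.Comp_in[OF \<mu>_in[OF f] \<mu>_in[OF g]]])
    note ob = P.C.hom_Ob[OF f] P.C.hom_Ob[OF g]
    fix a x assume "a \<in> Ob X" "x \<in> el' (\<phi> c) a"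
    then show "ap' (\<mu> (g \<cdot>\<^bsub>C\<^esub> f)) a x = ap' (\<mu> g \<cdot>\<^bsub>D\<^esub> \<mu> f) a x"
      using ob by (simp add: \<mu>[OF P.C.Comp_in[OF f g]] Q.ap_Comp[OF \<mu>_in[OF f] \<mu>_in[OF g]] \<mu>[OF f] \<mu>[OF g]
          P.ap_Comp[OF f g] \<gamma>_in \<gamma>\<beta> \<beta>_in P.ap_in[OF f])
  qed
  have F: "is_functor C D F"
    unfolding F_def using is_functorI[OF P.C.category_axioms \<phi> \<mu>_in \<mu>_Id \<mu>_Comp] .
  have "weak_equivalence C D F"
    unfolding weak_equivalence_def
  proof (intro conjI ballI F)
    fix c d assume c: "c \<in> Ob C" and d: "d \<in> Ob C"
    have "f = g" if f: "f \<in> hom C c d" and g: "g \<in> hom C c d" and eq: "\<mu> f = \<mu> g" for f g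
    proof (rule P.faithful[OF f g])
      fix a x assume a: "a \<in> Ob X" and x: "x \<in> el c a"
      have "\<beta> d a (ap f a x) = \<beta> d a (ap g a x)"
        using \<mu>[OF f a \<beta>_in[OF c a x]] \<mu>[OF g a \<beta>_in[OF c a x]] eq \<gamma>\<beta>[OF c a x] by simp
      then show "ap f a x = ap g a x"
        using \<gamma>\<beta>[OF d a] P.ap_in[OF f a x] P.ap_in[OF g a x] by metis
    qed
    moreover have "\<exists>f\<in>hom C c d. \<mu> f = g" if g: "g \<in> hom D (\<phi> c) (\<phi> d)" for g
    proof -
      have "rel_map X (el c) (rel c) (el d) (rel d) (\<lambda>a x. \<gamma> d a (ap' g a (\<beta> c a x)))"
        by (rule rel_map_comp[OF cat rel_map_comp[OF cat rel_iso_imp_rel_map[OF cat \<beta>[OF c]]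
            Q.ap_map[OF g]] rel_iso_imp_rel_map[OF cat \<gamma>[OF d]]])
      from P.full[OF c d this] obtain f where f: "f \<in> hom C c d"
        "\<And>a x. a \<in> Ob X \<Longrightarrow> x \<in> el c a \<Longrightarrow> ap f a x = \<gamma> d a (ap' g a (\<beta> c a x))" by blast
      have "\<mu> f = g"
      proof (rule Q.faithful[OF \<mu>_in[OF f(1)] g])
        fix a x assume a: "a \<in> Ob X" and x: "x \<in> el' (\<phi> c) a"
        show "ap' (\<mu> f) a x = ap' g a x"
          using \<mu>[OF f(1) a x] f(2)[OF a \<gamma>_in[OF c a x]] \<beta>\<gamma>[OF c a x] \<beta>\<gamma>[OF d a Q.ap_in[OF g a x]] by simp
      qed
      then show ?thesis using f(1) by blast
    qed
    ultimately show "bij_betw (mor_map F) (hom C c d) (hom D (ob_map F c) (ob_map F d))"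
      using c d \<mu>_in unfolding bij_betw_def inj_on_def F_def
      by (auto simp: hom_Mor image_iff) (metis hom_Mor)+
  next
    fix d assume d: "d \<in> Ob D"
    obtain c h where c: "c \<in> Ob C" and h: "rel_iso X (el' d) (rel' d) (el c) (rel c) h"
      using P.realize[OF Q.relational[OF d] Q.small_el[OF d]] by blast
    let ?h = "\<lambda>a. \<beta> c a \<circ> h a"
    have h': "rel_iso X (el' d) (rel' d) (el' (\<phi> c)) (rel' (\<phi> c)) ?h"
      using rel_iso_comp[OF cat h \<beta>[OF c]] .
    let ?k = "\<lambda>a. inv_into (el' d a) (?h a)"
    obtain f where f: "f \<in> hom D d (\<phi> c)" "\<And>a x. a \<in> Ob X \<Longrightarrow> x \<in> el' d a \<Longrightarrow> ap' f a x = ?h a x"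
      using Q.full[OF d \<phi>[OF c] rel_iso_imp_rel_map[OF cat h']] by blast
    obtain g where g: "g \<in> hom D (\<phi> c) d" "\<And>a x. a \<in> Ob X \<Longrightarrow> x \<in> el' (\<phi> c) a \<Longrightarrow> ap' g a x = ?k a x"
      using Q.full[OF \<phi>[OF c] d rel_iso_imp_rel_map[OF cat rel_iso_inverse[OF cat h']]] by blast
    have bij: "bij_betw (?h a) (el' d a) (el' (\<phi> c) a)" if "a \<in> Ob X" for a
      using h' that unfolding rel_iso_def by blast
    have "g \<cdot>\<^bsub>D\<^esub> f = Id D d"
    proof (rule Q.faithful[OF Q.C.Comp_in[OF f(1) g(1)] Q.C.Id_in[OF d]])
      fix a x assume a: "a \<in> Ob X" and x: "x \<in> el' d a"
      show "ap' (g \<cdot>\<^bsub>D\<^esub> f) a x = ap' (Id D d) a x"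
        using Q.ap_Comp[OF f(1) g(1) a x] f(2)[OF a x] g(2)[OF a Q.ap_in[OF f(1) a x]]
          Q.ap_Id[OF d a x] bij_betw_inv_into_left[OF bij[OF a] x] by simp
    qed
    moreover have "f \<cdot>\<^bsub>D\<^esub> g = Id D (\<phi> c)"
    proof (rule Q.faithful[OF Q.C.Comp_in[OF g(1) f(1)] Q.C.Id_in[OF \<phi>[OF c]]])
      fix a x assume a: "a \<in> Ob X" and x: "x \<in> el' (\<phi> c) a"
      show "ap' (f \<cdot>\<^bsub>D\<^esub> g) a x = ap' (Id D (\<phi> c)) a x"
        using Q.ap_Comp[OF g(1) f(1) a x] g(2)[OF a x] f(2)[OF a Q.ap_in[OF g(1) a x]]
          Q.ap_Id[OF \<phi>[OF c] a x] bij_betw_inv_into_right[OF bij[OF a] x] by simp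
    qed
    ultimately have "inverse_pair D (ob_map F c) d g f"
      using f(1) g(1) c by (simp add: inverse_pair_def F_def)
    then show "\<exists>c\<in>Ob C. \<exists>f g. inverse_pair D (ob_map F c) d f g"
      using c by blast
  qed
  then show ?thesis
    using weak_equivalence_imp_equivalent P.C.category_axioms Q.C.category_axioms by blast
qed

section \<open>Duality\<close>

lemma hom_op_cat [simp]: "hom (op_cat X) a b = hom X b a"
  by (auto simp: hom_def op_cat_def)

lemma Ob_op_cat [simp]: "Ob (op_cat X) = Ob X"
  and Mor_op_cat [simp]: "Mor (op_cat X) = Mor X"
  and Id_op_cat [simp]: "Id (op_cat X) = Id X"
  and Comp_op_cat [simp]: "g \<cdot>\<^bsub>op_cat X\<^esub> f = f \<cdot>\<^bsub>X\<^esub> g"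
  by (simp_all add: op_cat_def)

lemma inverse_pair_op_cat [simp]: "inverse_pair (op_cat X) a b f g \<longleftrightarrow> inverse_pair X a b g f"
  by (auto simp: inverse_pair_def)

lemma category_op_cat:
  assumes "category X"
  shows "category (op_cat X)"
proof -
  interpret category X by fact
  show ?thesis
  proof
    show "Dom (op_cat X) f \<in> Ob (op_cat X)" "Cod (op_cat X) f \<in> Ob (op_cat X)"
      if "f \<in> Mor (op_cat X)" for f
      using that Dom_in Cod_in by (auto simp: op_cat_def)
  qed (auto simp: Id_in Comp_Id Id_Comp assoc intro: Comp_in)
qed

lemma op_cat_op_cat [simp]: "op_cat (op_cat X) = X"
  by (simp add: op_cat_def)

lemma relational_op_cat:
  assumes "relational X E R"
  shows "relational (op_cat X) E (\<lambda>u x y. R u y x)"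
proof -
  interpret relational X E R by fact
  interpret op: category "op_cat X" using category_op_cat category_axioms .
  show ?thesis
  proof
    show "R (Id (op_cat X) a) x x" if "a \<in> Ob (op_cat X)" "x \<in> E a" for a x
      using refl that by simp
    show "R (v \<cdot>\<^bsub>op_cat X\<^esub> u) z x" if "u \<in> hom (op_cat X) a b" "v \<in> hom (op_cat X) b c"
      "x \<in> E a" "y \<in> E b" "z \<in> E c" "R u y x" "R v z y" for u v a b c x y z
      using trans[of v c b u a z y x] that by simp
    show "x = y" if "a \<in> Ob (op_cat X)" "x \<in> E a" "y \<in> E a"
      "R (Id (op_cat X) a) y x" "R (Id (op_cat X) a) x y" for a x y
      using antisym[of a x y] that by simp
    show "\<exists>y\<in>E b. R g y x \<and> R h x y" if "inverse_pair (op_cat X) a b g h" "x \<in> E a" for a b g h x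
      using lift[of a b h g x] that by auto
  qed
qed

lemma rel_map_op_cat:
  "rel_map (op_cat X) E (\<lambda>u x y. R u y x) E' (\<lambda>u x y. R' u y x) h \<longleftrightarrow> rel_map X E R E' R' h"
  unfolding rel_map_def by auto

lemma rel_iso_op_cat:
  "rel_iso (op_cat X) E (\<lambda>u x y. R u y x) E' (\<lambda>u x y. R' u y x) h \<longleftrightarrow> rel_iso X E R E' R' h"
  unfolding rel_iso_def by auto

text \<open>The axioms of a relational structure are self-dual, and a map preserves relations iff it
  preserves their converses. Hence the same category, elements and maps serve for the opposite
  base.\<close>

lemma presentation_op_cat:
  fixes U :: "'v \<Rightarrow> 'v set"
  assumes "presentation C X U el ap rel"
  shows "presentation C (op_cat X) U el ap (\<lambda>c u x y. rel c u y x)"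
proof -
  interpret presentation C X U el ap rel by fact
  interpret op: category "op_cat X" using category_op_cat X.category_axioms .
  show ?thesis
  proof (intro presentation.intro presentation_axioms.intro C.category_axioms op.category_axioms)
    fix E :: "_ \<Rightarrow> 'v set" and R
    assume ER: "relational (op_cat X) E R" "\<And>a. a \<in> Ob (op_cat X) \<Longrightarrow> small U (E a)"
    obtain c h where "c \<in> Ob C" "rel_iso X E (\<lambda>u x y. R u y x) (el c) (rel c) h"
      using realize[of E "\<lambda>u x y. R u y x"] relational_op_cat[OF ER(1)] ER(2) by auto
    then show "\<exists>c\<in>Ob C. \<exists>h. rel_iso (op_cat X) E R (el c) (\<lambda>u x y. rel c u y x) h"
      using rel_iso_op_cat[of X E "\<lambda>u x y. R u y x" "el c" "rel c" h] by auto
  next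
    show "relational (op_cat X) (el c) (\<lambda>u x y. rel c u y x)" if "c \<in> Ob C" for c
      using relational_op_cat[OF relational[OF that]] .
    show "f = g" if "f \<in> hom C c d" "g \<in> hom C c d"
      "\<And>a x. a \<in> Ob (op_cat X) \<Longrightarrow> x \<in> el c a \<Longrightarrow> ap f a x = ap g a x" for f g c d
      using faithful[OF that(1,2)] that(3) by simp
    show "\<exists>f\<in>hom C c d. \<forall>a\<in>Ob (op_cat X). \<forall>x\<in>el c a. ap f a x = h a x"
      if "c \<in> Ob C" "d \<in> Ob C" "rel_map (op_cat X) (el c) (\<lambda>u x y. rel c u y x) (el d) (\<lambda>u x y. rel d u y x) h"
      for c d h
      using full[OF that(1,2) rel_map_op_cat[THEN iffD1, OF that(3)]] by simp
    show "rel_map (op_cat X) (el c) (\<lambda>u x y. rel c u y x) (el d) (\<lambda>u x y. rel d u y x) (ap f)"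
      if "f \<in> hom C c d" for f c d
      using rel_map_op_cat[THEN iffD2, OF ap_map[OF that]] .
    show "small U (el c a)" if "c \<in> Ob C" "a \<in> Ob (op_cat X)" for c a
      using small_el that by simp
    show "ap (Id C c) a x = x" if "c \<in> Ob C" "a \<in> Ob (op_cat X)" "x \<in> el c a" for c a x
      using ap_Id that by simp
    show "ap (g \<cdot>\<^bsub>C\<^esub> f) a x = ap g a (ap f a x)"
      if "f \<in> hom C c d" "g \<in> hom C d e" "a \<in> Ob (op_cat X)" "x \<in> el c a" for f g c d e a x
      using ap_Comp[OF that(1,2)] that(3,4) by simp
  qed
qed

section \<open>Small sets\<close>

context universe
begin

lemma small_U [simp]: "small U (U x)"
  unfolding small_def using eqpoll_refl by blast

text \<open>Choosing one preimage for each point makes the image equinumerous with a subset of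
  \<open>U x\<close>, and \<open>pow\<close> makes every such subset the set of members of some
  element.\<close>

lemma small_image:
  assumes "small U A"
  shows "small U (f ` A)"
proof -
  obtain x g where g: "bij_betw g (U x) A"
    using assms eqpoll_sym unfolding small_def eqpoll_def by blast
  obtain S where S: "S \<subseteq> U x" "inj_on (f \<circ> g) S" "f ` A = (f \<circ> g) ` S"
    using subset_image_inj[of "f ` A" "f \<circ> g" "U x"] bij_betw_imp_surj_on[OF g]
    by (metis image_comp subset_refl)
  obtain y where "U y = S"
    using S(1) pow[of x] by (metis PowI imageE)
  then show ?thesis
    unfolding small_def eqpoll_def using S(2,3) bij_betw_inv_into by (metis bij_betw_def)
qed

lemma small_subset:
  assumes "small U A" "B \<subseteq> A"
  shows "small U B"
proof (cases "B = {}")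
  case True
  \<comment> \<open>The retraction of the other case needs a point of \<open>B\<close>. The empty
    set has a code because it belongs to every power set.\<close>
  obtain z where "U z = {}"
    using pow[of undefined] by (metis Pow_bottom imageE)
  then show ?thesis
    using small_image[OF small_U, of "\<lambda>_. undefined" z] True by simp
next
  case False
  then obtain b where "b \<in> B" by blast
  then have "(\<lambda>x. if x \<in> B then x else b) ` A = B"
    using assms(2) by auto
  then show ?thesis
    using small_image[OF assms(1)] by metis
qed

text \<open>The set is the union, indexed by \<open>U x\<close>, of the singletons of its points,
  and \<open>pair\<close> codes each singleton.\<close>

lemma small_code:
  fixes A :: "'v set"
  assumes "small U A"
  shows "\<exists>z. U z = A"
proof -
  obtain x g where g: "bij_betw g (U x) A"
    using assms eqpoll_sym unfolding small_def eqpoll_def by blast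
  have "\<exists>z. U z = {g i}" for i
    using pair[of "g i" "g i"] by simp
  then obtain f where "\<And>i. U (f i) = {g i}" by metis
  then have "(\<Union>i\<in>U x. U (f i)) = A"
    using bij_betw_imp_surj_on[OF g] by auto
  then show ?thesis
    using union by metis
qed

text \<open>Kuratowski pairs; extensionality makes the code of a doubleton depend injectively on the
  doubleton.\<close>

lemma ex_pairing: "\<exists>p :: 'v \<times> 'v \<Rightarrow> 'v. inj p"
proof -
  obtain d where d: "U (d x y) = {x, y}" for x y
    using pair by metis
  have "inj (\<lambda>(x, y). d (d x x) (d x y))"
  proof (rule injI, clarify)
    fix x y x' y'
    assume "d (d x x) (d x y) = d (d x' x') (d x' y')"
    then have "{d x x, d x y} = {d x' x', d x' y'}"
      using d by metis
    moreover have "d x y = d z w \<longleftrightarrow> {x, y} = {z, w}" for x y z w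
      using d injD[OF extensional] by metis
    ultimately show "x = x' \<and> y = y'"
      by (auto simp: doubleton_eq_iff)
  qed
  then show ?thesis by blast
qed

text \<open>The axiom \<open>union\<close> applies only to families of codes indexed by the members
  of an element. The sets \<open>A i\<close> are therefore replaced by copies inside
  \<open>'v\<close>, tagged by \<open>p (j, v)\<close> so that index and member can be recovered,
  and their union is mapped onto the given one.\<close>

lemma small_UN:
  assumes "small U I" "\<And>i. i \<in> I \<Longrightarrow> small U (A i)"
  shows "small U (\<Union>i\<in>I. A i)"
proof -
  obtain p :: "'v \<times> 'v \<Rightarrow> 'v" where p: "inj p"
    using ex_pairing by blast
  obtain x g where g: "bij_betw g (U x) I"
    using assms(1) eqpoll_sym unfolding small_def eqpoll_def by blast
  have "\<forall>i. \<exists>y h. i \<in> I \<longrightarrow> h ` U y = A i"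
    using assms(2) eqpoll_sym unfolding small_def eqpoll_def by (metis bij_betw_imp_surj_on)
  then obtain y h where yh: "\<And>i. i \<in> I \<Longrightarrow> h i ` U (y i) = A i" by metis
  have "\<exists>z. U z = (\<lambda>v. p (j, v)) ` U (y (g j))" for j
    using small_code small_image small_U by blast
  then obtain z where z: "\<And>j. U (z j) = (\<lambda>v. p (j, v)) ` U (y (g j))" by metis
  let ?B = "\<Union>j\<in>U x. U (z j)"
  have "small U ?B"
    using union[where x = x and f = z] small_U by metis
  moreover have "(\<lambda>w. h (g (fst (inv p w))) (snd (inv p w))) ` ?B = (\<Union>i\<in>I. A i)"
    unfolding image_UN z image_image inv_f_f[OF p] fst_conv snd_conv
    using yh bij_betw_imp_surj_on[OF g] by auto
  ultimately show ?thesis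
    using small_image by metis
qed

lemma small_Times:
  assumes "small U A" "small U B"
  shows "small U (A \<times> B)"
proof -
  have "A \<times> B = (\<Union>a\<in>A. Pair a ` B)" by auto
  then show ?thesis
    using small_UN[OF assms(1) small_image[OF assms(2)], of "\<lambda>a. Pair a"] by simp
qed

lemma small_Pow:
  assumes "small U A"
  shows "small U (Pow A)"
proof -
  obtain x g where g: "bij_betw g (U x) A"
    using assms eqpoll_sym unfolding small_def eqpoll_def by blast
  obtain z where "U ` U z = Pow (U x)"
    using pow by blast
  then have "Pow A = (\<lambda>S. g ` S) ` U ` U z"
    using image_Pow_surj[OF bij_betw_imp_surj_on[OF g]] by simp
  then show ?thesis
    using small_image small_U by metis
qed

text \<open>Cantor: if every element belonged to \<open>x\<close>, the axiom \<open>pow\<close>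
  would make \<open>U\<close> a surjection of \<open>'v\<close> onto its power set.\<close>

lemma ex_not_in: "\<exists>t. t \<notin> U x"
proof (rule ccontr)
  assume "\<nexists>t. t \<notin> U x"
  then have "U x = UNIV" by blast
  then have "surj U"
    using pow[of x] by (metis Pow_UNIV UNIV_I image_iff surj_def)
  then show False
    using Cantors_theorem[of UNIV] by auto
qed

text \<open>Two distinct elements are found by diagonalization: \<open>t\<close> is outside
  \<open>x\<close>, so \<open>x\<close> differs from the code \<open>w\<close> of the singleton of
  \<open>t\<close>.\<close>

lemma small_bool: "small U (UNIV :: bool set)"
proof -
  obtain x t z where t: "t \<notin> U (x :: 'v)" and z: "U z = {x, t}"
    using ex_not_in pair by metis
  obtain w where w: "U w = {t}"
    using pair[of t t] by auto
  obtain y where y: "U y = {x, w}"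
    using pair by blast
  have "x \<noteq> w"
    using t w by auto
  then have "(\<lambda>v. v = x) ` U y = UNIV"
    using y by auto
  then show ?thesis
    using small_image[OF small_U] by metis
qed

lemma small_inj:
  assumes "small U A"
  shows "\<exists>f :: _ \<Rightarrow> 'v. inj_on f A"
  using assms unfolding small_def eqpoll_def bij_betw_def by blast

end

section \<open>Free objects\<close>

lemma relational_transport:
  assumes "relational X E R" and h: "rel_iso X E R E' R' h"
  shows "relational X E' R'"
proof -
  interpret relational X E R by fact
  define k where "k a = inv_into (E a) (h a)" for a
  have bij: "bij_betw (h a) (E a) (E' a)" if "a \<in> Ob X" for a
    using h that unfolding rel_iso_def by blast
  have k_in: "k a x \<in> E a" and hk: "h a (k a x) = x" if "a \<in> Ob X" "x \<in> E' a" for a x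
    using bij[OF that(1)] that(2)
    by (simp_all add: k_def bij_betw_def inv_into_into f_inv_into_f)
  have k: "R u (k a x) (k b y) \<longleftrightarrow> R' u x y" if "u \<in> hom X a b" "x \<in> E' a" "y \<in> E' b" for u a b x y
    using rel_iso_inverse[OF category_axioms h] that unfolding rel_iso_def k_def by blast
  show ?thesis
  proof
    show "R' (Id X a) x x" if "a \<in> Ob X" "x \<in> E' a" for a x
      using k[OF Id_in that(2,2)] refl k_in that by simp
    show "R' (v \<cdot>\<^bsub>X\<^esub> u) x z" if u: "u \<in> hom X a b" and v: "v \<in> hom X b c"
      and x: "x \<in> E' a" and y: "y \<in> E' b" and z: "z \<in> E' c" and "R' u x y" "R' v y z"
    for u v a b c x y z
      using trans[OF u v, of "k a x" "k b y" "k c z"] k[OF Comp_in[OF u v] x z] k[OF u x y] k[OF v y z]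
        that k_in hom_Ob[OF u] hom_Ob[OF v] by simp
    show "x = y" if a: "a \<in> Ob X" and x: "x \<in> E' a" and y: "y \<in> E' a"
      and "R' (Id X a) x y" "R' (Id X a) y x" for a x y
      using antisym[OF a k_in[OF a x] k_in[OF a y]] k[OF Id_in[OF a] x y] k[OF Id_in[OF a] y x]
        that(4,5) hk[OF a x] hk[OF a y] by metis
    show "\<exists>y\<in>E' b. R' f x y \<and> R' g y x" if fg: "inverse_pair X a b f g" and x: "x \<in> E' a" for a b f g x
    proof -
      note f = inverse_pairD[OF fg]
      note ab = hom_Ob[OF f(1)]
      obtain y where y: "y \<in> E b" "R f (k a x) y" "R g y (k a x)"
        using lift[OF fg k_in[OF ab(1) x]] by blast
      have hy: "h b y \<in> E' b" using bij[OF ab(2)] y(1) bij_betwE by blast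
      have "k b (h b y) = y"
        using bij[OF ab(2)] y(1) by (simp add: k_def bij_betw_def)
      then have "R' f x (h b y)" "R' g (h b y) x"
        using k[OF f(1) x hy] k[OF f(2) hy x] y by simp_all
      then show ?thesis using hy by blast
    qed
  qed
qed

text \<open>In a category of structures this fails exactly for the empty structure. Like
  \<open>point\<close>, it mentions only \<open>C\<close>, so it means the same for two
  presentations of \<open>C\<close> over different bases.\<close>

definition noninitial :: "('o, 'm) cat \<Rightarrow> 'o \<Rightarrow> bool" where
  "noninitial C c \<longleftrightarrow> (\<exists>d. \<exists>f\<in>hom C c d. \<exists>g\<in>hom C c d. f \<noteq> g)"

definition point :: "('o, 'm) cat \<Rightarrow> 'o \<Rightarrow> bool" where
  "point C p \<longleftrightarrow> noninitial C p \<and>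
    (\<forall>c. noninitial C c \<longrightarrow> (\<forall>f\<in>hom C c p. \<exists>s\<in>hom C p c. f \<cdot>\<^bsub>C\<^esub> s = Id C p))"

locale small_presentation = presentation C X U el ap rel + universe U
  for C :: "('c, 'f) cat" and X :: "('o, 'm) cat" and U :: "'v \<Rightarrow> 'v set" and el ap rel +
  assumes small_Mor: "small U (Mor X)"
begin

text \<open>A single injection of the common bound \<open>T\<close> into \<open>'v\<close> serves
  all objects of \<open>X\<close>, which keeps the transported relation independent of the
  objects.\<close>

lemma realize_any:
  fixes E :: "'o \<Rightarrow> 'e set"
  assumes ER: "relational X E R" and T: "small U T" "\<And>a. a \<in> Ob X \<Longrightarrow> E a \<subseteq> T"
  obtains c h where "c \<in> Ob C" "rel_iso X E R (el c) (rel c) h"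
proof -
  obtain f :: "'e \<Rightarrow> 'v" where f: "inj_on f T"
    using small_inj[OF T(1)] by blast
  define R' where "R' u x y \<longleftrightarrow> R u (inv_into T f x) (inv_into T f y)" for u x y
  have iso: "rel_iso X E R (\<lambda>a. f ` E a) R' (\<lambda>a. f)"
    unfolding rel_iso_def
  proof (intro conjI ballI allI)
    show "bij_betw f (E a) (f ` E a)" if "a \<in> Ob X" for a
      using inj_on_subset[OF f T(2)[OF that]] by (simp add: bij_betw_def)
    show "R' u (f x) (f y) \<longleftrightarrow> R u x y" if "u \<in> hom X a b" "x \<in> E a" "y \<in> E b" for a b u x y
    proof -
      have "x \<in> T" "y \<in> T" using that T(2) X.hom_Ob[OF that(1)] by blast+
      then show ?thesis by (simp add: R'_def f)
    qed
  qed
  have "small U (f ` E a)" if "a \<in> Ob X" for a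
    using small_image[OF small_subset[OF T(1) T(2)[OF that]]] .
  then obtain c h where "c \<in> Ob C" "rel_iso X (\<lambda>a. f ` E a) R' (el c) (rel c) h"
    using realize[OF relational_transport[OF ER iso]] by blast
  then show ?thesis
    using that rel_iso_comp[OF X.category_axioms iso] by blast
qed

text \<open>\<open>y\<close> is the transport of \<open>x\<close> along some isomorphism. A
  generator over \<open>a\<close> inevitably has transports along all isomorphisms out of
  \<open>a\<close>, so an element can be said to be a generator only up to this relation.\<close>

definition copy :: "'c \<Rightarrow> 'o \<Rightarrow> 'v \<Rightarrow> 'o \<Rightarrow> 'v \<Rightarrow> bool" where
  "copy c a x b y \<longleftrightarrow> (\<exists>g h. inverse_pair X a b g h \<and> rel c g x y \<and> rel c h y x)"

lemma copy_refl: "\<lbrakk>c \<in> Ob C; a \<in> Ob X; x \<in> el c a\<rbrakk> \<Longrightarrow> copy c a x a x"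
  unfolding copy_def using X.inverse_pair_Id relational.refl[OF relational] by blast

lemma copy_ap:
  assumes "copy c a x b y" "f \<in> hom C c d" "x \<in> el c a" "y \<in> el c b"
  shows "copy d a (ap f a x) b (ap f b y)"
  using assms ap_rel[OF assms(2)] inverse_pairD unfolding copy_def by metis

text \<open>A relational structure on at most two generators; \<open>M i j\<close> lists the morphisms along which
  generator \<open>i\<close> lies below generator \<open>j\<close>.\<close>

lemma free_object:
  fixes I :: "bool set" and ob :: "bool \<Rightarrow> 'o" and M :: "bool \<Rightarrow> bool \<Rightarrow> 'm set"
  assumes ob: "\<And>i. i \<in> I \<Longrightarrow> ob i \<in> Ob X"
    and M_hom: "\<And>i j m. \<lbrakk>i \<in> I; j \<in> I; m \<in> M i j\<rbrakk> \<Longrightarrow> m \<in> hom X (ob i) (ob j)"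
    and M_Id: "\<And>i. i \<in> I \<Longrightarrow> M i i = {Id X (ob i)}"
    and M_acyclic: "\<And>i j. \<lbrakk>i \<in> I; j \<in> I; i \<noteq> j\<rbrakk> \<Longrightarrow> M i j = {} \<or> M j i = {}"
  obtains c e where "c \<in> Ob C" "\<And>i. i \<in> I \<Longrightarrow> e i \<in> el c (ob i)"
    "\<And>b z. \<lbrakk>b \<in> Ob X; z \<in> el c b\<rbrakk> \<Longrightarrow> \<exists>i\<in>I. copy c (ob i) (e i) b z"
    "\<And>i j m. \<lbrakk>i \<in> I; j \<in> I; m \<in> M i j\<rbrakk> \<Longrightarrow> rel c m (e i) (e j)"
    "\<And>d x. \<lbrakk>d \<in> Ob C; \<And>i. i \<in> I \<Longrightarrow> x i \<in> el d (ob i);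
        \<And>i j m. \<lbrakk>i \<in> I; j \<in> I; m \<in> M i j\<rbrakk> \<Longrightarrow> rel d m (x i) (x j)\<rbrakk>
      \<Longrightarrow> \<exists>f\<in>hom C c d. \<forall>i\<in>I. ap f (ob i) (e i) = x i"
proof -
  \<comment> \<open>\<open>(i, g)\<close> stands for the transport of generator \<open>i\<close>
    along the isomorphism \<open>g\<close>. In \<open>R\<close>, the transport along
    \<open>g\<close> is below the one along \<open>h\<close> when \<open>u\<close>, conjugated by
    these isomorphisms, is a listed morphism; this is written without inverses.\<close>
  define E where "E a = {(i, g). i \<in> I \<and> (\<exists>h. inverse_pair X (ob i) a g h)}" for a
  define R where "R u x y \<longleftrightarrow> (\<exists>m\<in>M (fst x) (fst y). u \<cdot>\<^bsub>X\<^esub> snd x = snd y \<cdot>\<^bsub>X\<^esub> m)" for u x y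
  have E_D: "i \<in> I" "g \<in> hom X (ob i) a" "\<exists>h. inverse_pair X (ob i) a g h" if "(i, g) \<in> E a" for i g a
    using that inverse_pairD(1) by (auto simp: E_def)
  \<comment> \<open>With only two indices, a composable pair either contains a listed loop, which is
    an identity, or goes back and forth between the two generators, which \<open>M_acyclic\<close>
    excludes.\<close>
  have M_Comp: "n \<cdot>\<^bsub>X\<^esub> m \<in> M i k" if I: "i \<in> I" "j \<in> I" "k \<in> I" and m: "m \<in> M i j" and n: "n \<in> M j k"
    for i j k m n
  proof (cases "i = j")
    case True
    then show ?thesis using M_Id[OF I(1)] M_hom[OF I(2,3) n] X.Comp_Id m n by simp
  next
    case ij: False
    show ?thesis
    proof (cases "j = k")
      case True
      then show ?thesis using M_Id[OF I(2)] M_hom[OF I(1,2) m] X.Id_Comp m n by simp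
    next
      case False
      with ij have "i = k" by auto
      then show ?thesis using M_acyclic[OF I(1,2) ij] m n by auto
    qed
  qed
  have ER: "relational X E R"
  proof
    fix a x assume "a \<in> Ob X" and x: "x \<in> E a"
    obtain i g where [simp]: "x = (i, g)" by (cases x)
    show "R (Id X a) x x"
      using M_Id E_D[of i g a] x X.Id_Comp X.Comp_Id by (simp add: R_def)
  next
    fix u v a b c x y z
    assume u: "u \<in> hom X a b" and v: "v \<in> hom X b c" and x: "x \<in> E a" and y: "y \<in> E b"
      and z: "z \<in> E c" and xy: "R u x y" and yz: "R v y z"
    obtain i g j h k l where [simp]: "x = (i, g)" "y = (j, h)" "z = (k, l)" by (cases x, cases y, cases z)
    obtain m n where m: "m \<in> M i j" "u \<cdot>\<^bsub>X\<^esub> g = h \<cdot>\<^bsub>X\<^esub> m" and n: "n \<in> M j k" "v \<cdot>\<^bsub>X\<^esub> h = l \<cdot>\<^bsub>X\<^esub> n"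
      using xy yz by (auto simp: R_def)
    note ijk = E_D(1)[of i g a] E_D(1)[of j h b] E_D(1)[of k l c]
    note g = E_D(2)[of i g a] and h = E_D(2)[of j h b] and l = E_D(2)[of k l c]
    note x' = x[simplified] and y' = y[simplified] and z' = z[simplified]
    note mh = M_hom[OF ijk(1)[OF x'] ijk(2)[OF y'] m(1)] and nh = M_hom[OF ijk(2)[OF y'] ijk(3)[OF z'] n(1)]
    have "(v \<cdot>\<^bsub>X\<^esub> u) \<cdot>\<^bsub>X\<^esub> g = v \<cdot>\<^bsub>X\<^esub> (h \<cdot>\<^bsub>X\<^esub> m)"
      using X.assoc[OF g[OF x'] u v] m(2) by simp
    also have "\<dots> = (l \<cdot>\<^bsub>X\<^esub> n) \<cdot>\<^bsub>X\<^esub> m"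
      using X.assoc[OF mh h[OF y'] v] n(2) by simp
    also have "\<dots> = l \<cdot>\<^bsub>X\<^esub> (n \<cdot>\<^bsub>X\<^esub> m)"
      using X.assoc[OF mh nh l[OF z']] by simp
    finally show "R (v \<cdot>\<^bsub>X\<^esub> u) x z"
      using M_Comp[OF ijk(1)[OF x'] ijk(2)[OF y'] ijk(3)[OF z'] m(1) n(1)] by (auto simp: R_def)
  next
    fix a x y assume "a \<in> Ob X" and x: "x \<in> E a" and y: "y \<in> E a" and xy: "R (Id X a) x y" "R (Id X a) y x"
    obtain i g j h where [simp]: "x = (i, g)" "y = (j, h)" by (cases x, cases y)
    note gh = E_D[of i g a] E_D[of j h a]
    have "i = j"
    proof (rule ccontr)
      assume "i \<noteq> j"
      then show False
        using M_acyclic[of i j] xy gh(1,4) x y by (fastforce simp: R_def)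
    qed
    moreover have "g = h"
      using xy(1) \<open>i = j\<close> M_Id gh x y X.Id_Comp X.Comp_Id by (auto simp: R_def)
    ultimately show "x = y" by simp
  next
    fix a b g h x assume gh: "inverse_pair X a b g h" and x: "x \<in> E a"
    obtain i k where [simp]: "x = (i, k)" by (cases x)
    note ik = E_D[of i k a, OF x[simplified]]
    have "(i, g \<cdot>\<^bsub>X\<^esub> k) \<in> E b"
      using ik X.inverse_pair_Comp gh unfolding E_def by blast
    moreover have "R g x (i, g \<cdot>\<^bsub>X\<^esub> k)" "R h (i, g \<cdot>\<^bsub>X\<^esub> k) x"
      using M_Id[OF ik(1)] X.Comp_Id[OF X.Comp_in[OF ik(2) inverse_pairD(1)[OF gh]]] X.Comp_Id[OF ik(2)]
        X.cancel_inverse_left[OF gh ik(2)] by (simp_all add: R_def)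
    ultimately show "\<exists>y\<in>E b. R g x y \<and> R h y x" by blast
  qed
  have "E a \<subseteq> UNIV \<times> Mor X" if "a \<in> Ob X" for a
    using inverse_pairD(1) hom_Mor unfolding E_def by fast
  then obtain c \<beta> where c: "c \<in> Ob C" and \<beta>: "rel_iso X E R (el c) (rel c) \<beta>"
    using realize_any[OF ER small_Times[OF small_bool small_Mor]] by metis
  have bij: "bij_betw (\<beta> a) (E a) (el c a)" if "a \<in> Ob X" for a
    using \<beta> that unfolding rel_iso_def by blast
  have rel_\<beta>: "rel c u (\<beta> a x) (\<beta> b y) \<longleftrightarrow> R u x y" if "u \<in> hom X a b" "x \<in> E a" "y \<in> E b" for u a b x y
    using \<beta> that unfolding rel_iso_def by blast
  have gen: "(i, Id X (ob i)) \<in> E (ob i)" if "i \<in> I" for i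
    using that X.inverse_pair_Id[OF ob[OF that]] by (auto simp: E_def)
  define e where "e i = \<beta> (ob i) (i, Id X (ob i))" for i
  show ?thesis
  proof (rule that[OF c, of e])
    show "e i \<in> el c (ob i)" if "i \<in> I" for i
      using bij_betwE[OF bij[OF ob[OF that]]] gen[OF that] by (simp add: e_def)
  next
    fix b z assume b: "b \<in> Ob X" and z: "z \<in> el c b"
    obtain i g where ig: "(i, g) \<in> E b" "z = \<beta> b (i, g)"
      using bij_betw_imp_surj_on[OF bij[OF b]] z by (metis imageE surj_pair)
    obtain h where gh: "inverse_pair X (ob i) b g h"
      using E_D(3)[OF ig(1)] by blast
    note i = E_D(1)[OF ig(1)] and g = inverse_pairD[OF gh]
    have "R g (i, Id X (ob i)) (i, g)" "R h (i, g) (i, Id X (ob i))"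
      using M_Id[OF i] X.Comp_Id[OF g(1)] X.Id_Comp[OF X.Id_in[OF ob[OF i]]] g(3) by (simp_all add: R_def)
    then have "copy c (ob i) (e i) b z"
      unfolding copy_def e_def ig(2)
      using gh rel_\<beta>[OF g(1) gen[OF i] ig(1)] rel_\<beta>[OF g(2) ig(1) gen[OF i]] by blast
    then show "\<exists>i\<in>I. copy c (ob i) (e i) b z" using i by blast
  next
    fix i j m assume ij: "i \<in> I" "j \<in> I" and m: "m \<in> M i j"
    note mh = M_hom[OF ij m]
    have "R m (i, Id X (ob i)) (j, Id X (ob j))"
      using X.Comp_Id[OF mh] X.Id_Comp[OF mh] m unfolding R_def by (metis fst_conv snd_conv)
    then show "rel c m (e i) (e j)"
      using rel_\<beta>[OF mh gen[OF ij(1)] gen[OF ij(2)]] by (simp add: e_def)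
  next
    fix d x assume d: "d \<in> Ob C" and x: "\<And>i. i \<in> I \<Longrightarrow> x i \<in> el d (ob i)"
      and Mx: "\<And>i j m. \<lbrakk>i \<in> I; j \<in> I; m \<in> M i j\<rbrakk> \<Longrightarrow> rel d m (x i) (x j)"
    interpret d: relational X "el d" "rel d" using relational[OF d] .
    \<comment> \<open>The map determined by the values \<open>x i\<close> sends
      \<open>(i, g)\<close> to the lift of \<open>x i\<close> along \<open>g\<close>. Since the
      inverse of \<open>g\<close> is unique, quantifying over all inverses leaves only the lift to
      be chosen.\<close>
    define P where "P a z y \<longleftrightarrow> y \<in> el d a \<and> (\<forall>h. inverse_pair X (ob (fst z)) a (snd z) h \<longrightarrow>
        rel d (snd z) (x (fst z)) y \<and> rel d h y (x (fst z)))" for a z y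
    have P_ex: "\<exists>y. P a z y" if z: "z \<in> E a" for a z
    proof -
      obtain i g where [simp]: "z = (i, g)" by (cases z)
      obtain h where h: "inverse_pair X (ob i) a g h" using E_D(3)[of i g a] z by auto
      obtain y where "y \<in> el d a" "rel d g (x i) y" "rel d h y (x i)"
        using d.lift[OF h x] E_D(1)[of i g a] z by auto
      then show ?thesis using X.inverse_pair_unique[OF h] unfolding P_def by auto
    qed
    define k where "k a z = (SOME y. P a z y)" for a z
    have "P a z (k a z)" if "z \<in> E a" for a z
      unfolding k_def by (rule someI_ex[OF P_ex[OF that]])
    note k = this[unfolded P_def]
    have "rel_map X E R (el d) (rel d) k"
      unfolding rel_map_def
    proof (intro conjI ballI allI impI)
      show "k a z \<in> el d a" if "z \<in> E a" for a z using k[OF that] by blast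
      fix a b u z w assume u: "u \<in> hom X a b" and z: "z \<in> E a" and w: "w \<in> E b" and zw: "R u z w"
      obtain i g j h where [simp]: "z = (i, g)" "w = (j, h)" by (cases z, cases w)
      obtain m where m: "m \<in> M i j" "u \<cdot>\<^bsub>X\<^esub> g = h \<cdot>\<^bsub>X\<^esub> m" using zw by (auto simp: R_def)
      have i: "i \<in> I" and j: "j \<in> I" using E_D(1) z w by auto
      obtain g' where g: "inverse_pair X (ob i) a g g'" using E_D(3)[of i g a] z by auto
      obtain h' where h: "inverse_pair X (ob j) b h h'" using E_D(3)[of j h b] w by auto
      note gD = inverse_pairD[OF g] and hD = inverse_pairD[OF h] and mh = M_hom[OF i j m(1)]
      have kz: "k a z \<in> el d a" "rel d g' (k a z) (x i)" using k[OF z] g by auto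
      have kw: "k b w \<in> el d b" "rel d h (x j) (k b w)" using k[OF w] h by auto
      have "rel d (m \<cdot>\<^bsub>X\<^esub> g') (k a z) (x j)"
        using d.trans[OF gD(2) mh kz(1) x[OF i] x[OF j] kz(2) Mx[OF i j m(1)]] .
      then have "rel d (h \<cdot>\<^bsub>X\<^esub> (m \<cdot>\<^bsub>X\<^esub> g')) (k a z) (k b w)"
        using d.trans[OF X.Comp_in[OF gD(2) mh] hD(1) kz(1) x[OF j] kw(1) _ kw(2)] by blast
      moreover have "h \<cdot>\<^bsub>X\<^esub> (m \<cdot>\<^bsub>X\<^esub> g') = u"
        using X.assoc[OF gD(2) mh hD(1)] m(2) X.cancel_inverse_right[OF g u] by simp
      ultimately show "rel d u (k a z) (k b w)" by simp
    qed
    from full[OF c d rel_map_comp[OF X.category_axioms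
        rel_iso_imp_rel_map[OF X.category_axioms rel_iso_inverse[OF X.category_axioms \<beta>]] this]]
    obtain f where f: "f \<in> hom C c d"
      "\<And>a z. a \<in> Ob X \<Longrightarrow> z \<in> el c a \<Longrightarrow> ap f a z = k a (inv_into (E a) (\<beta> a) z)" by blast
    have "ap f (ob i) (e i) = x i" if i: "i \<in> I" for i
    proof -
      note a = ob[OF i]
      have "e i \<in> el c (ob i)" using bij_betwE[OF bij[OF a]] gen[OF i] by (simp add: e_def)
      then have "ap f (ob i) (e i) = k (ob i) (i, Id X (ob i))"
        using f(2)[OF a] bij_betw_inv_into_left[OF bij[OF a] gen[OF i]] by (simp add: e_def)
      moreover have "k (ob i) (i, Id X (ob i)) = x i"
        using d.antisym[OF a _ x[OF i]] k[OF gen[OF i]] X.inverse_pair_Id[OF a] by auto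
      ultimately show ?thesis by simp
    qed
    then show "\<exists>f\<in>hom C c d. \<forall>i\<in>I. ap f (ob i) (e i) = x i" using f(1) by blast
  qed
qed

text \<open>\<open>p\<close> is freely generated by \<open>\<gamma>\<close> over \<open>a\<close>.
  Uniqueness of the induced morphism is not demanded but follows in \<open>univ_eqI\<close> from the
  last clause, because morphisms commute with transports.\<close>

definition univ :: "'c \<Rightarrow> 'o \<Rightarrow> 'v \<Rightarrow> bool" where
  "univ p a \<gamma> \<longleftrightarrow> p \<in> Ob C \<and> a \<in> Ob X \<and> \<gamma> \<in> el p a \<and>
    (\<forall>c\<in>Ob C. \<forall>x\<in>el c a. \<exists>f\<in>hom C p c. ap f a \<gamma> = x) \<and>
    (\<forall>b\<in>Ob X. \<forall>y\<in>el p b. copy p a \<gamma> b y)"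

lemma univD:
  assumes "univ p a \<gamma>"
  shows "p \<in> Ob C" "a \<in> Ob X" "\<gamma> \<in> el p a"
    and "\<And>c x. \<lbrakk>c \<in> Ob C; x \<in> el c a\<rbrakk> \<Longrightarrow> \<exists>f\<in>hom C p c. ap f a \<gamma> = x"
    and "\<And>b y. \<lbrakk>b \<in> Ob X; y \<in> el p b\<rbrakk> \<Longrightarrow> copy p a \<gamma> b y"
  using assms unfolding univ_def by blast+

lemma univ_eqI:
  assumes p: "univ p a \<gamma>" and f: "f \<in> hom C p c" and g: "g \<in> hom C p c"
    and eq: "ap f a \<gamma> = ap g a \<gamma>"
  shows "f = g"
proof (rule faithful[OF f g])
  fix b y assume b: "b \<in> Ob X" and y: "y \<in> el p b"
  obtain k l where kl: "inverse_pair X a b k l" "rel p k \<gamma> y" "rel p l y \<gamma>"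
    using univD(5)[OF p b y] unfolding copy_def by blast
  note kD = inverse_pairD[OF kl(1)] and \<gamma> = univD(3)[OF p] and a = univD(2)[OF p]
  show "ap f b y = ap g b y"
  proof (rule relational.lift_unique[OF relational kl(1)])
    show "c \<in> Ob C" using C.hom_Ob[OF f] by blast
    show "ap f a \<gamma> \<in> el c a" "ap f b y \<in> el c b" "ap g b y \<in> el c b"
      using ap_in[OF f a \<gamma>] ap_in[OF f b y] ap_in[OF g b y] .
    show "rel c k (ap f a \<gamma>) (ap f b y)" "rel c l (ap f b y) (ap f a \<gamma>)"
      using ap_rel[OF f kD(1) \<gamma> y kl(2)] ap_rel[OF f kD(2) y \<gamma> kl(3)] .
    show "rel c k (ap f a \<gamma>) (ap g b y)" "rel c l (ap g b y) (ap f a \<gamma>)"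
      unfolding eq using ap_rel[OF g kD(1) \<gamma> y kl(2)] ap_rel[OF g kD(2) y \<gamma> kl(3)] .
  qed
qed

lemma ex_univ:
  assumes a: "a \<in> Ob X"
  obtains p \<gamma> where "univ p a \<gamma>"
proof (rule free_object[of "{True}" "\<lambda>_. a" "\<lambda>_ _. {Id X a}"])
  fix c e
  assume "c \<in> Ob C" "\<And>i. i \<in> {True} \<Longrightarrow> e i \<in> el c a"
    "\<And>b z. \<lbrakk>b \<in> Ob X; z \<in> el c b\<rbrakk> \<Longrightarrow> \<exists>i\<in>{True}. copy c a (e i) b z"
    and *: "\<And>d x. \<lbrakk>d \<in> Ob C; \<And>i. i \<in> {True} \<Longrightarrow> x i \<in> el d a;
        \<And>i j m. \<lbrakk>i \<in> {True}; j \<in> {True}; m \<in> {Id X a}\<rbrakk> \<Longrightarrow> rel d m (x i) (x j)\<rbrakk>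
      \<Longrightarrow> \<exists>f\<in>hom C c d. \<forall>i\<in>{True}. ap f a (e i) = x i"
  moreover have "\<exists>f\<in>hom C c d. ap f a (e True) = x" if "d \<in> Ob C" "x \<in> el d a" for d x
    using *[of d "\<lambda>_. x"] that relational.refl[OF relational[OF that(1)] a that(2)] by simp
  ultimately have "univ c a (e True)"
    unfolding univ_def using a by simp
  then show ?thesis using that by blast
qed (use a X.Id_in in auto)

text \<open>The structure freely generated by one relation along \<open>u\<close>, with generator
  \<open>True\<close> as its lower end. The generators are indexed by truth values and not by
  objects, so the two ends stay distinct even when \<open>u\<close> is an endomorphism.\<close>

lemma ex_arrow:
  assumes u: "u \<in> hom X a b"
  obtains t x y where "t \<in> Ob C" "x \<in> el t a" "y \<in> el t b" "rel t u x y"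
    "\<And>e z. \<lbrakk>e \<in> Ob X; z \<in> el t e\<rbrakk> \<Longrightarrow> copy t a x e z \<or> copy t b y e z"
    "\<And>d x' y'. \<lbrakk>d \<in> Ob C; x' \<in> el d a; y' \<in> el d b; rel d u x' y'\<rbrakk> \<Longrightarrow>
      \<exists>f\<in>hom C t d. ap f a x = x' \<and> ap f b y = y'"
proof -
  note ab = X.hom_Ob[OF u]
  let ?ob = "\<lambda>i. if i then a else b"
  let ?M = "\<lambda>i j. if i = j then {Id X (?ob i)} else if i then {u} else {}"
  show ?thesis
  proof (rule free_object[of UNIV ?ob ?M])
    show "m \<in> hom X (?ob i) (?ob j)" if "m \<in> ?M i j" for i j m
      using that u X.Id_in[OF ab(1)] X.Id_in[OF ab(2)] by (cases i; cases j) auto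
    fix c e
    assume c: "c \<in> Ob C" and e: "\<And>i. i \<in> UNIV \<Longrightarrow> e i \<in> el c (?ob i)"
      and cov: "\<And>b' z. \<lbrakk>b' \<in> Ob X; z \<in> el c b'\<rbrakk> \<Longrightarrow> \<exists>i\<in>UNIV. copy c (?ob i) (e i) b' z"
      and rel: "\<And>i j m. \<lbrakk>i \<in> UNIV; j \<in> UNIV; m \<in> ?M i j\<rbrakk> \<Longrightarrow> rel c m (e i) (e j)"
      and free: "\<And>d x. \<lbrakk>d \<in> Ob C; \<And>i. i \<in> UNIV \<Longrightarrow> x i \<in> el d (?ob i);
          \<And>i j m. \<lbrakk>i \<in> UNIV; j \<in> UNIV; m \<in> ?M i j\<rbrakk> \<Longrightarrow> rel d m (x i) (x j)\<rbrakk>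
        \<Longrightarrow> \<exists>f\<in>hom C c d. \<forall>i\<in>UNIV. ap f (?ob i) (e i) = x i"
    show ?thesis
    proof (rule that[OF c, of "e True" "e False"])
      show "e True \<in> el c a" "e False \<in> el c b" using e[of True] e[of False] by simp_all
      show "rel c u (e True) (e False)" using rel[of True False u] by simp
      show "copy c a (e True) e' z \<or> copy c b (e False) e' z" if "e' \<in> Ob X" "z \<in> el c e'" for e' z
        using cov[OF that] by (metis (full_types))
      show "\<exists>f\<in>hom C c d. ap f a (e True) = x' \<and> ap f b (e False) = y'"
        if d: "d \<in> Ob C" and x': "x' \<in> el d a" and y': "y' \<in> el d b" and "rel d u x' y'" for d x' y'
      proof -
        have "\<exists>f\<in>hom C c d. \<forall>i\<in>UNIV. ap f (?ob i) (e i) = (if i then x' else y')"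
        proof (rule free[OF d])
          show "(if i then x' else y') \<in> el d (?ob i)" for i using x' y' by simp
          show "rel d m (if i then x' else y') (if j then x' else y')" if "m \<in> ?M i j" for i j m
            using that \<open>rel d u x' y'\<close> relational.refl[OF relational[OF d] ab(1) x']
              relational.refl[OF relational[OF d] ab(2) y'] by (cases i; cases j) auto
        qed
        then obtain f where f: "f \<in> hom C c d" "\<And>i. ap f (?ob i) (e i) = (if i then x' else y')"
          by blast
        then show ?thesis using f(2)[of True] f(2)[of False] by auto
      qed
    qed
  qed (use ab in auto)
qed

text \<open>The constant structure on the chain \<open>False < True\<close>. Its relations do not
  depend on the morphism, so it detects only the direction of a relation.\<close>

lemma ex_two:
  obtains c \<zeta> where "c \<in> Ob C" "\<And>a s. a \<in> Ob X \<Longrightarrow> \<zeta> a s \<in> el c a"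
    "\<And>u a b s t. u \<in> hom X a b \<Longrightarrow> rel c u (\<zeta> a s) (\<zeta> b t) \<longleftrightarrow> (s \<longrightarrow> t)"
proof -
  have "relational X (\<lambda>a. UNIV) (\<lambda>u s t. s \<longrightarrow> t)"
    by unfold_locales auto
  then obtain c h where "c \<in> Ob C" and h: "rel_iso X (\<lambda>a. UNIV) (\<lambda>u s t. s \<longrightarrow> t) (el c) (rel c) h"
    using realize_any[OF _ small_bool] by (metis subset_UNIV)
  moreover have "h a s \<in> el c a" if "a \<in> Ob X" for a s
    using h that bij_betwE unfolding rel_iso_def by (metis UNIV_I)
  moreover have "rel c u (h a s) (h b t) \<longleftrightarrow> (s \<longrightarrow> t)" if "u \<in> hom X a b" for u a b s t
    using h that unfolding rel_iso_def by blast
  ultimately show ?thesis using that by blast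
qed

text \<open>The representable functor \<open>hom X a\<close> with discrete orders. The identity of
  \<open>a\<close> is related along \<open>u\<close> to \<open>u\<close> alone, so this structure
  tells parallel morphisms out of \<open>a\<close> apart.\<close>

lemma ex_coslice:
  assumes a: "a \<in> Ob X"
  obtains c \<eta> where "c \<in> Ob C" "\<And>b g. g \<in> hom X a b \<Longrightarrow> \<eta> b g \<in> el c b"
    "\<And>u b d g h. \<lbrakk>u \<in> hom X b d; g \<in> hom X a b; h \<in> hom X a d\<rbrakk> \<Longrightarrow>
      rel c u (\<eta> b g) (\<eta> d h) \<longleftrightarrow> u \<cdot>\<^bsub>X\<^esub> g = h"
proof -
  let ?R = "\<lambda>u g h. u \<cdot>\<^bsub>X\<^esub> g = h"
  have "relational X (hom X a) ?R"
  proof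
    show "Id X b \<cdot>\<^bsub>X\<^esub> g = g" if "g \<in> hom X a b" for b g using X.Id_Comp[OF that] .
    show "(v \<cdot>\<^bsub>X\<^esub> u) \<cdot>\<^bsub>X\<^esub> g = k" if "u \<in> hom X b c" "v \<in> hom X c d" "g \<in> hom X a b"
      "u \<cdot>\<^bsub>X\<^esub> g = h" "v \<cdot>\<^bsub>X\<^esub> h = k" for u v b c d g h k
      using X.assoc[OF that(3,1,2)] that(4,5) by simp
    show "g = h" if "g \<in> hom X a b" "Id X b \<cdot>\<^bsub>X\<^esub> g = h" for b g h
      using X.Id_Comp[OF that(1)] that(2) by simp
    show "\<exists>y\<in>hom X a c. g \<cdot>\<^bsub>X\<^esub> x = y \<and> h \<cdot>\<^bsub>X\<^esub> y = x"
      if "inverse_pair X b c g h" "x \<in> hom X a b" for b c g h x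
      using X.Comp_in[OF that(2) inverse_pairD(1)[OF that(1)]] X.cancel_inverse_left[OF that] by blast
  qed
  moreover have "hom X a b \<subseteq> Mor X" for b by (auto simp: hom_def)
  ultimately obtain c h where "c \<in> Ob C" and h: "rel_iso X (hom X a) ?R (el c) (rel c) h"
    using realize_any[OF _ small_Mor] by metis
  moreover have "h b g \<in> el c b" if "g \<in> hom X a b" for b g
    using h that X.hom_Ob[OF that] bij_betwE unfolding rel_iso_def by blast
  moreover have "rel c u (h b g) (h d k) \<longleftrightarrow> u \<cdot>\<^bsub>X\<^esub> g = k"
    if "u \<in> hom X b d" "g \<in> hom X a b" "k \<in> hom X a d" for u b d g k
    using h that unfolding rel_iso_def by blast
  ultimately show ?thesis using that by blast
qed

section \<open>Points\<close>

lemma const_two: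
  assumes d: "d \<in> Ob C" and c: "c \<in> Ob C" and \<zeta>: "\<And>a s. a \<in> Ob X \<Longrightarrow> \<zeta> a s \<in> el c a"
    "\<And>u a b s t. u \<in> hom X a b \<Longrightarrow> rel c u (\<zeta> a s) (\<zeta> b t) \<longleftrightarrow> (s \<longrightarrow> t)"
  shows "\<exists>f\<in>hom C d c. \<forall>a\<in>Ob X. \<forall>x\<in>el d a. ap f a x = \<zeta> a s"
proof -
  have "rel_map X (el d) (rel d) (el c) (rel c) (\<lambda>a x. \<zeta> a s)"
    unfolding rel_map_def using \<zeta> by blast
  then show ?thesis using full[OF d c] by blast
qed

text \<open>Faithfulness leaves at most one morphism from an empty structure to any object; on an
  element, the constant maps \<open>True\<close> and \<open>False\<close> into the chain
  differ.\<close>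

lemma noninitial_iff:
  assumes d: "d \<in> Ob C"
  shows "noninitial C d \<longleftrightarrow> (\<exists>a\<in>Ob X. el d a \<noteq> {})"
proof
  assume "noninitial C d"
  then obtain c f g where "f \<in> hom C d c" "g \<in> hom C d c" "f \<noteq> g"
    unfolding noninitial_def by blast
  then show "\<exists>a\<in>Ob X. el d a \<noteq> {}" using faithful by blast
next
  assume "\<exists>a\<in>Ob X. el d a \<noteq> {}"
  then obtain a x where a: "a \<in> Ob X" and x: "x \<in> el d a" by blast
  obtain c \<zeta> where c: "c \<in> Ob C" and \<zeta>: "\<And>a s. a \<in> Ob X \<Longrightarrow> \<zeta> a s \<in> el c a"
    "\<And>u a b s t. u \<in> hom X a b \<Longrightarrow> rel c u (\<zeta> a s) (\<zeta> b t) \<longleftrightarrow> (s \<longrightarrow> t)"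
    using ex_two by blast
  obtain f g where f: "f \<in> hom C d c" "ap f a x = \<zeta> a True" and g: "g \<in> hom C d c" "ap g a x = \<zeta> a False"
    using const_two[OF d c \<zeta>, of True] const_two[OF d c \<zeta>, of False] a x by blast
  have "\<zeta> a True \<noteq> \<zeta> a False"
    using \<zeta>(2)[OF X.Id_in[OF a], of True False] \<zeta>(2)[OF X.Id_in[OF a], of True True] by metis
  then show "noninitial C d" unfolding noninitial_def using f g by metis
qed

text \<open>The image in \<open>p\<close> of any element of \<open>c\<close> is a transport of the
  generator. Transported back to \<open>a\<close>, the element of \<open>c\<close> lies over the
  generator itself, and the morphism sending the generator to it is a section.\<close>

lemma univ_imp_point:
  assumes p: "univ p a \<gamma>"
  shows "point C p"
  unfolding point_def
proof (intro conjI allI impI ballI)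
  note pO = univD(1)[OF p] and a = univD(2)[OF p] and \<gamma> = univD(3)[OF p]
  show "noninitial C p" using noninitial_iff[OF pO] a \<gamma> by blast
  fix c f assume c: "noninitial C c" and f: "f \<in> hom C c p"
  note cO = C.hom_Ob(1)[OF f]
  obtain b y where b: "b \<in> Ob X" and y: "y \<in> el c b" using c noninitial_iff[OF cO] by blast
  obtain g h where gh: "inverse_pair X a b g h" "rel p g \<gamma> (ap f b y)" "rel p h (ap f b y) \<gamma>"
    using univD(5)[OF p b ap_in[OF f b y]] unfolding copy_def by blast
  note hg = inverse_pair_sym[OF gh(1)] and gD = inverse_pairD[OF gh(1)]
  obtain z where z: "z \<in> el c a" "rel c h y z" "rel c g z y"
    using relational.lift[OF relational[OF cO] hg y] by blast
  have fz: "ap f a z = \<gamma>"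
    using relational.lift_unique[OF relational[OF pO] hg ap_in[OF f b y] ap_in[OF f a z(1)] \<gamma>]
      ap_rel[OF f gD(2) y z(1,2)] ap_rel[OF f gD(1) z(1) y z(3)] gh(2,3) by blast
  obtain s where s: "s \<in> hom C p c" "ap s a \<gamma> = z" using univD(4)[OF p cO z(1)] by blast
  have "f \<cdot>\<^bsub>C\<^esub> s = Id C p"
    using univ_eqI[OF p C.Comp_in[OF s(1) f] C.Id_in[OF pO]] ap_Comp[OF s(1) f a \<gamma>] ap_Id[OF pO a \<gamma>] s(2) fz
    by simp
  then show "\<exists>s\<in>hom C p c. f \<cdot>\<^bsub>C\<^esub> s = Id C p" using s(1) by blast
qed

text \<open>\<open>p\<close> is compared with the free structure \<open>q\<close> on an object
  \<open>a\<close> that carries an element of \<open>p\<close>. A morphism \<open>f\<close> from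
  \<open>q\<close> to \<open>p\<close> has a section \<open>s\<close> because \<open>p\<close> is a
  point, and \<open>s\<close> has a right inverse because \<open>q\<close> is one. So
  \<open>s\<close> is inverse to \<open>f\<close>, and \<open>p\<close> inherits freeness from
  \<open>q\<close>.\<close>

lemma point_imp_univ:
  assumes p: "point C p"
  obtains a \<gamma> where "univ p a \<gamma>"
proof -
  have split: "\<exists>s\<in>hom C p c. f \<cdot>\<^bsub>C\<^esub> s = Id C p" if "noninitial C c" "f \<in> hom C c p" for c f
    using p that unfolding point_def by blast
  have np: "noninitial C p" using p unfolding point_def by blast
  then have pO: "p \<in> Ob C" unfolding noninitial_def using C.hom_Ob by blast
  obtain a x where a: "a \<in> Ob X" and x: "x \<in> el p a" using np noninitial_iff[OF pO] by blast
  obtain q \<gamma> where q: "univ q a \<gamma>" using ex_univ[OF a] by blast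
  note qO = univD(1)[OF q] and \<gamma> = univD(3)[OF q]
  have q': "point C q" using univ_imp_point[OF q] .
  obtain f where f: "f \<in> hom C q p" "ap f a \<gamma> = x" using univD(4)[OF q pO x] by blast
  obtain s where s: "s \<in> hom C p q" "f \<cdot>\<^bsub>C\<^esub> s = Id C p"
    using split[OF _ f(1)] q' unfolding point_def by blast
  obtain r where r: "r \<in> hom C q p" "s \<cdot>\<^bsub>C\<^esub> r = Id C q"
    using q' np s(1) unfolding point_def by blast
  have "f = r"
    using C.assoc[OF r(1) s(1) f(1)] s(2) r(2) C.Comp_Id[OF f(1)] C.Id_Comp[OF r(1)] by simp
  then have sx: "ap s a x = \<gamma>"
    using ap_Comp[OF f(1) s(1) a \<gamma>] f(2) r(2) ap_Id[OF qO a \<gamma>] by simp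
  have "univ p a x"
    unfolding univ_def
  proof (intro conjI ballI pO a x)
    fix c y assume c: "c \<in> Ob C" and y: "y \<in> el c a"
    obtain m where m: "m \<in> hom C q c" "ap m a \<gamma> = y" using univD(4)[OF q c y] by blast
    show "\<exists>f\<in>hom C p c. ap f a x = y"
      using C.Comp_in[OF s(1) m(1)] ap_Comp[OF s(1) m(1) a x] sx m(2) by auto
  next
    fix b y assume b: "b \<in> Ob X" and y: "y \<in> el p b"
    have "copy p a (ap f a \<gamma>) b (ap f b (ap s b y))"
      using copy_ap[OF univD(5)[OF q b ap_in[OF s(1) b y]] f(1) \<gamma> ap_in[OF s(1) b y]] .
    then show "copy p a x b y"
      using f(2) ap_Comp[OF s(1) f(1) b y] s(2) ap_Id[OF pO b y] by simp
  qed
  then show ?thesis using that by blast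
qed

text \<open>This turns transport, a notion depending on the base, into a factorization in
  \<open>C\<close>, which \<open>cover\<close> reads over the other base. The generator of
  \<open>r\<close> is sent to the lift of \<open>\<gamma>\<close> along the same
  isomorphism.\<close>

lemma factor_through_copy:
  assumes r: "univ r e \<rho>" and i: "i \<in> hom C p t" and k: "k \<in> hom C r t"
    and a: "a \<in> Ob X" and \<gamma>: "\<gamma> \<in> el p a" and copy: "copy t a (ap i a \<gamma>) e (ap k e \<rho>)"
  shows "\<exists>m\<in>hom C r p. k = i \<cdot>\<^bsub>C\<^esub> m"
proof -
  note pO = C.hom_Ob(1)[OF i] and tO = C.hom_Ob(2)[OF i]
  note e = univD(2)[OF r] and \<rho> = univD(3)[OF r]
  obtain g h where gh: "inverse_pair X a e g h" "rel t g (ap i a \<gamma>) (ap k e \<rho>)" "rel t h (ap k e \<rho>) (ap i a \<gamma>)"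
    using copy unfolding copy_def by blast
  note gD = inverse_pairD[OF gh(1)]
  obtain y where y: "y \<in> el p e" "rel p g \<gamma> y" "rel p h y \<gamma>"
    using relational.lift[OF relational[OF pO] gh(1) \<gamma>] by blast
  obtain m where m: "m \<in> hom C r p" "ap m e \<rho> = y" using univD(4)[OF r pO y(1)] by blast
  have "ap i e y = ap k e \<rho>"
    using relational.lift_unique[OF relational[OF tO] gh(1) ap_in[OF i a \<gamma>] ap_in[OF i e y(1)] ap_in[OF k e \<rho>]]
      ap_rel[OF i gD(1) \<gamma> y(1,2)] ap_rel[OF i gD(2) y(1) \<gamma> y(3)] gh(2,3) by blast
  then have "k = i \<cdot>\<^bsub>C\<^esub> m"
    using univ_eqI[OF r k C.Comp_in[OF m(1) i]] ap_Comp[OF m(1) i e \<rho>] m(2) by simp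
  then show ?thesis using m(1) by blast
qed

text \<open>The transports of \<open>x\<close> and those of \<open>y\<close> make up all of
  \<open>t\<close>, and no relation joins the two families. So \<open>t\<close> is the sum of two
  parts, on which maps can be prescribed independently.\<close>

lemma glue:
  assumes t: "t \<in> Ob C" and a: "a \<in> Ob X" and b: "b \<in> Ob X" and x: "x \<in> el t a" and y: "y \<in> el t b"
    and cov: "\<And>e z. \<lbrakk>e \<in> Ob X; z \<in> el t e\<rbrakk> \<Longrightarrow> copy t a x e z \<or> copy t b y e z"
    and xy: "\<And>w. w \<in> hom X a b \<Longrightarrow> \<not> rel t w x y" and yx: "\<And>w. w \<in> hom X b a \<Longrightarrow> \<not> rel t w y x"
    and f: "f \<in> hom C t d" and g: "g \<in> hom C t d"
  shows "\<exists>h\<in>hom C t d. ap h a x = ap f a x \<and> ap h b y = ap g b y"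
proof -
  interpret t: relational X "el t" "rel t" using relational[OF t] .
  define k where "k e z = (if copy t a x e z then ap f e z else ap g e z)" for e z
  \<comment> \<open>Conjugating by the two isomorphisms would turn a relation between transports
    into one between the original elements. The ends are kept general so that both directions are
    covered.\<close>
  have no_link: "\<not> rel t u z w" if u: "u \<in> hom X e e'" and z: "z \<in> el t e" and w: "w \<in> el t e'"
    and c: "copy t a' x' e z" "copy t b' y' e' w" and x': "x' \<in> el t a'" and y': "y' \<in> el t b'"
    and no: "\<And>v. v \<in> hom X a' b' \<Longrightarrow> \<not> rel t v x' y'" for u e e' z w a' b' x' y'
  proof
    assume zw: "rel t u z w"
    obtain g1 h1 g2 h2 where 1: "inverse_pair X a' e g1 h1" "rel t g1 x' z"
      and 2: "inverse_pair X b' e' g2 h2" "rel t h2 w y'"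
      using c unfolding copy_def by blast
    note 1 = inverse_pairD(1)[OF 1(1)] 1(2) and 2 = inverse_pairD(2)[OF 2(1)] 2(2)
    have "rel t (h2 \<cdot>\<^bsub>X\<^esub> (u \<cdot>\<^bsub>X\<^esub> g1)) x' y'"
      using t.trans[OF X.Comp_in[OF 1(1) u] 2(1) x' w y' t.trans[OF 1(1) u x' z w 1(2) zw] 2(2)] .
    then show False using no[OF X.Comp_in[OF X.Comp_in[OF 1(1) u] 2(1)]] by blast
  qed
  have "rel_map X (el t) (rel t) (el d) (rel d) k"
    unfolding rel_map_def
  proof (intro conjI ballI allI impI)
    show "k e z \<in> el d e" if "e \<in> Ob X" "z \<in> el t e" for e z
      using ap_in[OF f that] ap_in[OF g that] by (simp add: k_def)
    fix e e' u z w assume u: "u \<in> hom X e e'" and z: "z \<in> el t e" and w: "w \<in> el t e'" and zw: "rel t u z w"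
    note e = X.hom_Ob[OF u]
    show "rel d u (k e z) (k e' w)"
    proof (cases "copy t a x e z"; cases "copy t a x e' w")
      assume "copy t a x e z" "copy t a x e' w"
      then show ?thesis using ap_rel[OF f u z w zw] by (simp add: k_def)
    next
      assume 1: "copy t a x e z" and 2: "\<not> copy t a x e' w"
      have "copy t b y e' w" using cov[OF e(2) w] 2 by blast
      then show ?thesis using no_link[OF u z w 1 _ x y xy] zw by blast
    next
      assume 1: "\<not> copy t a x e z" and 2: "copy t a x e' w"
      have "copy t b y e z" using cov[OF e(1) z] 1 by blast
      then show ?thesis using no_link[OF u z w _ 2 y x yx] zw by blast
    next
      assume "\<not> copy t a x e z" "\<not> copy t a x e' w"
      then show ?thesis using ap_rel[OF g u z w zw] by (simp add: k_def)
    qed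
  qed
  from full[OF t C.hom_Ob(2)[OF f] this] obtain h where h: "h \<in> hom C t d"
    "\<And>e z. e \<in> Ob X \<Longrightarrow> z \<in> el t e \<Longrightarrow> ap h e z = k e z" by blast
  have "\<not> copy t a x b y"
    using xy by (auto simp: copy_def inverse_pair_def)
  then have "ap h a x = ap f a x" "ap h b y = ap g b y"
    using h(2)[OF a x] h(2)[OF b y] copy_refl[OF t a x] by (simp_all add: k_def)
  then show ?thesis using h(1) by blast
qed

end

section \<open>Two presentations of the same category\<close>

text \<open>The sign records whether a relation over the other base is read forwards or backwards;
  it carries the ambiguity between a category and its opposite until the signs of different
  morphisms can be compared.\<close>

definition srel :: "('c \<Rightarrow> 'm \<Rightarrow> 'v \<Rightarrow> 'v \<Rightarrow> bool) \<Rightarrow> bool \<Rightarrow> 'c \<Rightarrow> 'm \<Rightarrow> 'v \<Rightarrow> 'v \<Rightarrow> bool" where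
  "srel rel s c w x y \<longleftrightarrow> (if s then rel c w x y else rel c w y x)"

definition shom :: "('o, 'm) cat \<Rightarrow> bool \<Rightarrow> 'o \<Rightarrow> 'o \<Rightarrow> 'm set" where
  "shom X s a b = (if s then hom X a b else hom X b a)"

lemma srel_simps [simp]: "srel rel True c w x y = rel c w x y" "srel rel False c w x y = rel c w y x"
  and shom_simps [simp]: "shom X True a b = hom X a b" "shom X False a b = hom X b a"
  by (simp_all add: srel_def shom_def)

context small_presentation
begin

lemma srel_ap:
  assumes "f \<in> hom C c d" "u \<in> shom X s a b" "x \<in> el c a" "y \<in> el c b" "srel rel s c u x y"
  shows "srel rel s d u (ap f a x) (ap f b y)"
  using ap_rel[OF assms(1)] assms(2-5) by (cases s) auto

lemma univ_obtain:
  assumes "univ p a \<gamma>" "c \<in> Ob C" "x \<in> el c a"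
  obtains f where "f \<in> hom C p c" "ap f a \<gamma> = x"
  using univD(4)[OF assms] by blast

lemma univ_in: "\<lbrakk>univ p a \<gamma>; f \<in> hom C p c\<rbrakk> \<Longrightarrow> ap f a \<gamma> \<in> el c a"
  using ap_in univD by blast

text \<open>In the chain, \<open>False\<close> is related to \<open>True\<close> along
  \<open>u\<close>, which a reversed \<open>v\<close> could not reproduce. In the representable
  structure of \<open>a\<close>, the identity is related to \<open>u\<close> along \<open>u\<close>,
  hence along \<open>v\<close>, and this says \<open>v = u\<close>.\<close>

lemma srel_determines:
  assumes u: "u \<in> hom X a b" and v: "v \<in> shom X s a b"
    and sub: "\<And>c x y. \<lbrakk>c \<in> Ob C; x \<in> el c a; y \<in> el c b; rel c u x y\<rbrakk> \<Longrightarrow> srel rel s c v x y"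
  shows "s \<and> v = u"
proof -
  note ab = X.hom_Ob[OF u]
  have s: s
  proof (rule ccontr)
    assume "\<not> s"
    obtain c \<zeta> where c: "c \<in> Ob C" and \<zeta>: "\<And>a s. a \<in> Ob X \<Longrightarrow> \<zeta> a s \<in> el c a"
      "\<And>u a b s t. u \<in> hom X a b \<Longrightarrow> rel c u (\<zeta> a s) (\<zeta> b t) \<longleftrightarrow> (s \<longrightarrow> t)"
      using ex_two by blast
    have "srel rel s c v (\<zeta> a False) (\<zeta> b True)"
      using sub[OF c \<zeta>(1)[OF ab(1)] \<zeta>(1)[OF ab(2)]] \<zeta>(2)[OF u] by blast
    then show False using \<open>\<not> s\<close> v \<zeta>(2)[of v b a] by simp
  qed
  obtain c \<eta> where c: "c \<in> Ob C" and \<eta>: "\<And>b g. g \<in> hom X a b \<Longrightarrow> \<eta> b g \<in> el c b"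
    "\<And>u b d g h. \<lbrakk>u \<in> hom X b d; g \<in> hom X a b; h \<in> hom X a d\<rbrakk> \<Longrightarrow>
      rel c u (\<eta> b g) (\<eta> d h) \<longleftrightarrow> u \<cdot>\<^bsub>X\<^esub> g = h"
    using ex_coslice[OF ab(1)] by blast
  note id = X.Id_in[OF ab(1)]
  have v': "v \<in> hom X a b" using v s by simp
  have "srel rel s c v (\<eta> a (Id X a)) (\<eta> b u)"
    using sub[OF c \<eta>(1)[OF id] \<eta>(1)[OF u]] \<eta>(2)[OF u id u] X.Comp_Id[OF u] by blast
  then show ?thesis
    using s \<eta>(2)[OF v' id u] X.Comp_Id[OF v'] by simp
qed

end

text \<open>The situation of condition (b): through the given equivalence, each object of one
  category of species also carries a structure over the other base. Its symmetry is exploited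
  through \<open>swap\<close>.\<close>

locale two_presentations =
  P: small_presentation C X U el ap rel + P': small_presentation C X' U el' ap' rel'
  for C :: "('c, 'f) cat" and X :: "('o, 'm) cat" and X' :: "('p, 'n) cat" and U :: "'v \<Rightarrow> 'v set"
    and el ap rel el' ap' rel'
begin

lemma swap: "two_presentations C X' X U el' ap' rel' el ap rel"
  by unfold_locales

text \<open>That the transports of two generators fill \<open>t\<close> amounts to a factorization:
  every morphism into \<open>t\<close> out of a point factors through \<open>i\<close> or
  \<open>j\<close>. Points do not depend on the base, so the covering passes from \<open>X\<close>
  to \<open>X'\<close>.\<close>

lemma cover:
  assumes p: "P.univ p a \<gamma>" and p': "P'.univ p a' \<gamma>'" and q: "P.univ q b \<delta>" and q': "P'.univ q b' \<delta>'"
    and i: "i \<in> hom C p t" and j: "j \<in> hom C q t"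
    and cov: "\<And>e z. \<lbrakk>e \<in> Ob X; z \<in> el t e\<rbrakk> \<Longrightarrow>
      P.copy t a (ap i a \<gamma>) e z \<or> P.copy t b (ap j b \<delta>) e z"
    and e': "e' \<in> Ob X'" and z': "z' \<in> el' t e'"
  shows "P'.copy t a' (ap' i a' \<gamma>') e' z' \<or> P'.copy t b' (ap' j b' \<delta>') e' z'"
proof -
  have t: "t \<in> Ob C" using P.C.hom_Ob[OF i] by blast
  obtain r \<sigma> where r': "P'.univ r e' \<sigma>" using P'.ex_univ[OF e'] by blast
  obtain e \<rho> where r: "P.univ r e \<rho>" using P.point_imp_univ[OF P'.univ_imp_point[OF r']] by blast
  obtain k where k: "k \<in> hom C r t" "ap' k e' \<sigma> = z'" using P'.univ_obtain[OF r' t z'] by blast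
  have *: "P'.copy t c' (ap' l c' \<gamma>1') e' z'"
    if o: "P.univ o1 c \<gamma>1" and o': "P'.univ o1 c' \<gamma>1'" and l: "l \<in> hom C o1 t"
      and copy: "P.copy t c (ap l c \<gamma>1) e (ap k e \<rho>)" for o1 c \<gamma>1 c' \<gamma>1' l
  proof -
    obtain m where m: "m \<in> hom C r o1" "k = l \<cdot>\<^bsub>C\<^esub> m"
      using P.factor_through_copy[OF r l k(1) P.univD(2,3)[OF o] copy] by blast
    note m\<sigma> = P'.univ_in[OF r' m(1)]
    have "P'.copy t c' (ap' l c' \<gamma>1') e' (ap' l e' (ap' m e' \<sigma>))"
      using P'.copy_ap[OF P'.univD(5)[OF o' e' m\<sigma>] l P'.univD(3)[OF o'] m\<sigma>] .
    then show ?thesis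
      using P'.ap_Comp[OF m(1) l e' P'.univD(3)[OF r']] k(2) m(2) by simp
  qed
  show ?thesis
    using cov[OF P.univD(2)[OF r] P.univ_in[OF r k(1)]] *[OF p p' i] *[OF q q' j] by blast
qed

text \<open>If the two ends of the free arrow on \<open>u\<close> were unrelated over \<open>X'\<close>, any two morphisms out of it
  could be glued, in particular the constants \<open>1\<close> and \<open>0\<close> into the constant structure \<open>0 < 1\<close>.\<close>

lemma cross:
  assumes p: "P.univ p a \<gamma>" and p': "P'.univ p a' \<gamma>'" and q: "P.univ q b \<delta>" and q': "P'.univ q b' \<delta>'"
    and u: "u \<in> hom X a b"
  shows "\<exists>s. \<exists>w\<in>shom X' s a' b'. \<forall>c. \<forall>i\<in>hom C p c. \<forall>j\<in>hom C q c.
    rel c u (ap i a \<gamma>) (ap j b \<delta>) \<longrightarrow> srel rel' s c w (ap' i a' \<gamma>') (ap' j b' \<delta>')"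
proof -
  note ab = P.X.hom_Ob[OF u]
  obtain t x y where t: "t \<in> Ob C" and x: "x \<in> el t a" and y: "y \<in> el t b" and xy: "rel t u x y"
    and cov: "\<And>e z. \<lbrakk>e \<in> Ob X; z \<in> el t e\<rbrakk> \<Longrightarrow> P.copy t a x e z \<or> P.copy t b y e z"
    and free: "\<And>d x' y'. \<lbrakk>d \<in> Ob C; x' \<in> el d a; y' \<in> el d b; rel d u x' y'\<rbrakk> \<Longrightarrow>
      \<exists>f\<in>hom C t d. ap f a x = x' \<and> ap f b y = y'"
    using P.ex_arrow[OF u] by blast
  obtain i0 where i0: "i0 \<in> hom C p t" "ap i0 a \<gamma> = x" using P.univ_obtain[OF p t x] by blast
  obtain j0 where j0: "j0 \<in> hom C q t" "ap j0 b \<delta> = y" using P.univ_obtain[OF q t y] by blast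
  note \<gamma> = P.univD(3)[OF p] and \<delta> = P.univD(3)[OF q] and \<gamma>' = P'.univD(3)[OF p'] and \<delta>' = P'.univD(3)[OF q']
    and a' = P'.univD(2)[OF p'] and b' = P'.univD(2)[OF q']
  let ?x = "ap' i0 a' \<gamma>'" and ?y = "ap' j0 b' \<delta>'"
  have x': "?x \<in> el' t a'" and y': "?y \<in> el' t b'"
    using P'.univ_in[OF p' i0(1)] P'.univ_in[OF q' j0(1)] .
  have cov': "P'.copy t a' ?x e z \<or> P'.copy t b' ?y e z" if "e \<in> Ob X'" "z \<in> el' t e" for e z
    using cover[OF p p' q q' i0(1) j0(1) _ that] cov i0(2) j0(2) by blast
  have "\<exists>s. \<exists>w\<in>shom X' s a' b'. srel rel' s t w ?x ?y"
  proof (rule ccontr)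
    assume no: "\<nexists>s. \<exists>w\<in>shom X' s a' b'. srel rel' s t w ?x ?y"
    have no1: "\<not> rel' t w ?x ?y" if "w \<in> hom X' a' b'" for w
      using no that shom_simps(1) srel_simps(1) by metis
    have no2: "\<not> rel' t w ?y ?x" if "w \<in> hom X' b' a'" for w
      using no that shom_simps(2) srel_simps(2) by metis
    obtain d \<zeta> where d: "d \<in> Ob C" and \<zeta>: "\<And>a s. a \<in> Ob X \<Longrightarrow> \<zeta> a s \<in> el d a"
      "\<And>u a b s t. u \<in> hom X a b \<Longrightarrow> rel d u (\<zeta> a s) (\<zeta> b t) \<longleftrightarrow> (s \<longrightarrow> t)"
      using P.ex_two by blast
    obtain f g where f: "f \<in> hom C t d" "ap f a x = \<zeta> a True" and g: "g \<in> hom C t d" "ap g b y = \<zeta> b False"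
      using P.const_two[OF t d \<zeta>, of True] P.const_two[OF t d \<zeta>, of False] ab x y by blast
    obtain h where h: "h \<in> hom C t d" "ap' h a' ?x = ap' f a' ?x" "ap' h b' ?y = ap' g b' ?y"
      using P'.glue[OF t a' b' x' y' cov' no1 no2 f(1) g(1)] by blast
    \<comment> \<open>Agreement on a generator over \<open>X'\<close> is agreement of morphisms out
      of \<open>p\<close>, and therefore gives agreement on the generator over
      \<open>X\<close>.\<close>
    have "h \<cdot>\<^bsub>C\<^esub> i0 = f \<cdot>\<^bsub>C\<^esub> i0"
      using P'.univ_eqI[OF p' P.C.Comp_in[OF i0(1) h(1)] P.C.Comp_in[OF i0(1) f(1)]]
        P'.ap_Comp[OF i0(1) h(1) a' \<gamma>'] P'.ap_Comp[OF i0(1) f(1) a' \<gamma>'] h(2) by simp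
    then have hx: "ap h a x = \<zeta> a True"
      using P.ap_Comp[OF i0(1) h(1) ab(1) \<gamma>] P.ap_Comp[OF i0(1) f(1) ab(1) \<gamma>] i0(2) f(2) by simp
    have "h \<cdot>\<^bsub>C\<^esub> j0 = g \<cdot>\<^bsub>C\<^esub> j0"
      using P'.univ_eqI[OF q' P.C.Comp_in[OF j0(1) h(1)] P.C.Comp_in[OF j0(1) g(1)]]
        P'.ap_Comp[OF j0(1) h(1) b' \<delta>'] P'.ap_Comp[OF j0(1) g(1) b' \<delta>'] h(3) by simp
    then have hy: "ap h b y = \<zeta> b False"
      using P.ap_Comp[OF j0(1) h(1) ab(2) \<delta>] P.ap_Comp[OF j0(1) g(1) ab(2) \<delta>] j0(2) g(2) by simp
    show False
      using P.ap_rel[OF h(1) u x y xy] \<zeta>(2)[OF u, of True False] hx hy by simp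
  qed
  then obtain s w where w: "w \<in> shom X' s a' b'" "srel rel' s t w ?x ?y" by blast
  \<comment> \<open>The relation found in the generic structure \<open>t\<close> is carried to every
    \<open>c\<close> by the morphism out of \<open>t\<close> that classifies the given relation
    along \<open>u\<close>.\<close>
  show ?thesis
  proof (rule exI, rule bexI[OF _ w(1)], intro allI ballI impI)
    fix c i j assume i: "i \<in> hom C p c" and j: "j \<in> hom C q c" and r: "rel c u (ap i a \<gamma>) (ap j b \<delta>)"
    have c: "c \<in> Ob C" using P.C.hom_Ob[OF i] by blast
    obtain f where f: "f \<in> hom C t c" "ap f a x = ap i a \<gamma>" "ap f b y = ap j b \<delta>"
      using free[OF c P.univ_in[OF p i] P.univ_in[OF q j] r] by blast
    have "f \<cdot>\<^bsub>C\<^esub> i0 = i"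
      using P.univ_eqI[OF p P.C.Comp_in[OF i0(1) f(1)] i] P.ap_Comp[OF i0(1) f(1) ab(1) \<gamma>] i0(2) f(2) by simp
    moreover have "f \<cdot>\<^bsub>C\<^esub> j0 = j"
      using P.univ_eqI[OF q P.C.Comp_in[OF j0(1) f(1)] j] P.ap_Comp[OF j0(1) f(1) ab(2) \<delta>] j0(2) f(3) by simp
    ultimately show "srel rel' s c w (ap' i a' \<gamma>') (ap' j b' \<delta>')"
      using P'.srel_ap[OF f(1) w(1) x' y' w(2)] P'.ap_Comp[OF i0(1) f(1) a' \<gamma>'] P'.ap_Comp[OF j0(1) f(1) b' \<delta>']
      by simp
  qed
qed

text \<open>\<open>matches p a \<gamma> a' \<gamma>' q b \<delta> b' \<delta>' u s w\<close>: under the identification of elements over \<open>a\<close> and \<open>a'\<close>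
  (both are morphisms out of \<open>p\<close>), the relation of \<open>u\<close> is that of \<open>w\<close>, reversed unless \<open>s\<close>.\<close>

definition matches where
  "matches p a \<gamma> a' \<gamma>' q b \<delta> b' \<delta>' u s w \<longleftrightarrow> w \<in> shom X' s a' b' \<and>
    (\<forall>c. \<forall>i\<in>hom C p c. \<forall>j\<in>hom C q c.
      rel c u (ap i a \<gamma>) (ap j b \<delta>) \<longleftrightarrow> srel rel' s c w (ap' i a' \<gamma>') (ap' j b' \<delta>'))"

text \<open>Two applications of \<open>cross\<close> lead from \<open>u\<close> to some
  \<open>w\<close> and from \<open>w\<close> back to some \<open>v\<close>. The relation of
  \<open>u\<close> is thus contained in that of \<open>v\<close>, possibly reversed;
  \<open>srel_determines\<close> forces \<open>v = u\<close> unreversed, so both inclusions are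
  equalities.\<close>

lemma ex_matches:
  assumes p: "P.univ p a \<gamma>" and p': "P'.univ p a' \<gamma>'" and q: "P.univ q b \<delta>" and q': "P'.univ q b' \<delta>'"
    and u: "u \<in> hom X a b"
  obtains s w where "matches p a \<gamma> a' \<gamma>' q b \<delta> b' \<delta>' u s w"
proof -
  interpret sw: two_presentations C X' X U el' ap' rel' el ap rel by (rule swap)
  obtain s w where w: "w \<in> shom X' s a' b'" and sub:
    "\<And>c i j. \<lbrakk>i \<in> hom C p c; j \<in> hom C q c; rel c u (ap i a \<gamma>) (ap j b \<delta>)\<rbrakk> \<Longrightarrow>
      srel rel' s c w (ap' i a' \<gamma>') (ap' j b' \<delta>')"
    using cross[OF p p' q q' u] by meson
  have "\<exists>s2. \<exists>v\<in>shom X s2 a b. \<forall>c. \<forall>i\<in>hom C p c. \<forall>j\<in>hom C q c.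
      srel rel' s c w (ap' i a' \<gamma>') (ap' j b' \<delta>') \<longrightarrow> srel rel s2 c v (ap i a \<gamma>) (ap j b \<delta>)"
  proof (cases s)
    case True
    then have "w \<in> hom X' a' b'" using w by simp
    from sw.cross[OF p' p q' q this] show ?thesis using True by simp
  next
    case False
    \<comment> \<open>Here \<open>w\<close> runs backwards, so the two generators exchange their
      roles and the sign obtained has to be negated.\<close>
    then have "w \<in> hom X' b' a'" using w by simp
    then obtain s2 v where v: "v \<in> shom X s2 b a"
      "\<And>c i j. \<lbrakk>i \<in> hom C q c; j \<in> hom C p c; rel' c w (ap' i b' \<delta>') (ap' j a' \<gamma>')\<rbrakk> \<Longrightarrow>
        srel rel s2 c v (ap i b \<delta>) (ap j a \<gamma>)"
      using sw.cross[OF q' q p' p] by meson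
    have "v \<in> shom X (\<not> s2) a b" using v(1) by (cases s2) auto
    moreover have "srel rel (\<not> s2) c v (ap i a \<gamma>) (ap j b \<delta>)"
      if "i \<in> hom C p c" "j \<in> hom C q c" "srel rel' s c w (ap' i a' \<gamma>') (ap' j b' \<delta>')" for c i j
      using v(2)[OF that(2,1)] that(3) False by (cases s2) auto
    ultimately show ?thesis by blast
  qed
  then obtain s2 v where v: "v \<in> shom X s2 a b" and sub2: "\<And>c i j. \<lbrakk>i \<in> hom C p c; j \<in> hom C q c;
      srel rel' s c w (ap' i a' \<gamma>') (ap' j b' \<delta>')\<rbrakk> \<Longrightarrow> srel rel s2 c v (ap i a \<gamma>) (ap j b \<delta>)" by blast
  have "s2 \<and> v = u"
  proof (rule P.srel_determines[OF u v])
    fix c x y assume c: "c \<in> Ob C" and x: "x \<in> el c a" and y: "y \<in> el c b" and xy: "rel c u x y"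
    obtain i where i: "i \<in> hom C p c" "ap i a \<gamma> = x" using P.univ_obtain[OF p c x] by blast
    obtain j where j: "j \<in> hom C q c" "ap j b \<delta> = y" using P.univ_obtain[OF q c y] by blast
    show "srel rel s2 c v x y"
      using sub2[OF i(1) j(1) sub[OF i(1) j(1)]] i(2) j(2) xy by simp
  qed
  then have "matches p a \<gamma> a' \<gamma>' q b \<delta> b' \<delta>' u s w"
    unfolding matches_def using w sub sub2 by auto
  then show ?thesis using that by blast
qed

end

text \<open>For each object \<open>a\<close>, one structure is fixed that is free on
  \<open>a\<close> over \<open>X\<close> and on \<open>F a\<close> over \<open>X'\<close>; morphisms
  out of it are elements over \<open>a\<close> and over \<open>F a\<close> at once. \<open>F\<close>
  is the object part of the equivalence to be built.\<close>

locale aligned_presentations = two_presentations C X X' U el ap rel el' ap' rel'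
  for C :: "('c, 'f) cat" and X :: "('o, 'm) cat" and X' :: "('p, 'n) cat" and U :: "'v \<Rightarrow> 'v set"
    and el ap rel el' ap' rel' +
  fixes pt :: "'o \<Rightarrow> 'c" and \<gamma> :: "'o \<Rightarrow> 'v" and F :: "'o \<Rightarrow> 'p" and \<gamma>' :: "'o \<Rightarrow> 'v"
  assumes pt: "a \<in> Ob X \<Longrightarrow> P.univ (pt a) a (\<gamma> a)"
    and pt': "a \<in> Ob X \<Longrightarrow> P'.univ (pt a) (F a) (\<gamma>' a)"
begin

abbreviation ("input") mat where
  "mat a b u s w \<equiv> matches (pt a) a (\<gamma> a) (F a) (\<gamma>' a) (pt b) b (\<gamma> b) (F b) (\<gamma>' b) u s w"

lemma mat_shom: "mat a b u s w \<Longrightarrow> w \<in> shom X' s (F a) (F b)"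
  by (simp add: matches_def)

lemma matD:
  "\<lbrakk>mat a b u s w; i \<in> hom C (pt a) c; j \<in> hom C (pt b) c\<rbrakk> \<Longrightarrow>
    rel c u (ap i a (\<gamma> a)) (ap j b (\<gamma> b)) \<longleftrightarrow> srel rel' s c w (ap' i (F a) (\<gamma>' a)) (ap' j (F b) (\<gamma>' b))"
  by (simp add: matches_def)

lemma ex_mat:
  assumes "u \<in> hom X a b"
  obtains s w where "mat a b u s w"
  using ex_matches[OF pt pt' pt pt' assms] P.X.hom_Ob[OF assms] by blast

lemma F_Ob: "a \<in> Ob X \<Longrightarrow> F a \<in> Ob X'"
  using P'.univD(2)[OF pt'] .

text \<open>Elements over \<open>F a\<close> correspond, via morphisms out of \<open>pt a\<close>,
  to elements over \<open>a\<close>. There the relations become those of \<open>u\<close> and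
  \<open>v\<close>, and transitivity over \<open>X\<close> applies.\<close>

lemma mat_Comp:
  assumes u: "u \<in> hom X a b" and v: "v \<in> hom X b d"
    and m: "mat a b u s1 w1" "mat b d v s2 w2" "mat a d (v \<cdot>\<^bsub>X\<^esub> u) s3 w3"
    and c: "c \<in> Ob C" and x: "x \<in> el' c (F a)" and y: "y \<in> el' c (F b)" and z: "z \<in> el' c (F d)"
    and xy: "srel rel' s1 c w1 x y" and yz: "srel rel' s2 c w2 y z"
  shows "srel rel' s3 c w3 x z"
proof -
  note abd = P.X.hom_Ob[OF u] P.X.hom_Ob(2)[OF v]
  obtain i where i: "i \<in> hom C (pt a) c" "ap' i (F a) (\<gamma>' a) = x" using P'.univ_obtain[OF pt' c x] abd by blast
  obtain j where j: "j \<in> hom C (pt b) c" "ap' j (F b) (\<gamma>' b) = y" using P'.univ_obtain[OF pt' c y] abd by blast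
  obtain k where k: "k \<in> hom C (pt d) c" "ap' k (F d) (\<gamma>' d) = z" using P'.univ_obtain[OF pt' c z] abd by blast
  have "rel c u (ap i a (\<gamma> a)) (ap j b (\<gamma> b))" "rel c v (ap j b (\<gamma> b)) (ap k d (\<gamma> d))"
    using matD[OF m(1) i(1) j(1)] matD[OF m(2) j(1) k(1)] xy yz i(2) j(2) k(2) by simp_all
  then have "rel c (v \<cdot>\<^bsub>X\<^esub> u) (ap i a (\<gamma> a)) (ap k d (\<gamma> d))"
    using relational.trans[OF P.relational[OF c] u v] P.univ_in[OF pt] abd i(1) j(1) k(1) by blast
  then show ?thesis
    using matD[OF m(3) i(1) k(1)] i(2) k(2) by simp
qed

text \<open>The test takes place in the constant chain over \<open>X'\<close>. If one of the two
  steps joins equal truth values, the composite has the same ends as the other step and must point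
  the same way.\<close>

lemma sign_Comp:
  assumes u: "u \<in> hom X a b" and v: "v \<in> hom X b d"
    and m: "mat a b u s1 w1" "mat b d v s2 w2" "mat a d (v \<cdot>\<^bsub>X\<^esub> u) s3 w3"
  shows "s1 = s3" "s2 = s3"
proof -
  obtain c \<zeta> where c: "c \<in> Ob C" and \<zeta>: "\<And>a s. a \<in> Ob X' \<Longrightarrow> \<zeta> a s \<in> el' c a"
    "\<And>u a b s t. u \<in> hom X' a b \<Longrightarrow> rel' c u (\<zeta> a s) (\<zeta> b t) \<longleftrightarrow> (s \<longrightarrow> t)"
    using P'.ex_two by blast
  note F = F_Ob[OF P.X.hom_Ob(1)[OF u]] F_Ob[OF P.X.hom_Ob(1)[OF v]] F_Ob[OF P.X.hom_Ob(2)[OF v]]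
  have \<zeta>': "srel rel' s c w (\<zeta> a k) (\<zeta> b l) \<longleftrightarrow> (if s then k \<longrightarrow> l else l \<longrightarrow> k)"
    if "w \<in> shom X' s a b" for w s a b k l
    using \<zeta>(2) that by (cases s) simp_all
  have *: "if s3 then k \<longrightarrow> n else n \<longrightarrow> k"
    if "if s1 then k \<longrightarrow> l else l \<longrightarrow> k" "if s2 then l \<longrightarrow> n else n \<longrightarrow> l" for k l n
    using mat_Comp[OF u v m c \<zeta>(1)[OF F(1)] \<zeta>(1)[OF F(2)] \<zeta>(1)[OF F(3)], of k l n]
      that unfolding mat_shom[OF m(1), THEN \<zeta>'] mat_shom[OF m(2), THEN \<zeta>'] mat_shom[OF m(3), THEN \<zeta>'] .
  show "s1 = s3" "s2 = s3"
    using *[of True True False] *[of False True True] *[of True False False] *[of False False True]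
    by (cases s1; cases s2; cases s3; simp)+
qed

text \<open>Composition with identities shows that a morphism has the sign of the identity at each
  of its two ends. So these signs agree across every step of a zigzag, whichever way the step
  points.\<close>

lemma connected_sign:
  assumes "successively (\<lambda>c d. hom X c d \<noteq> {} \<or> hom X d c \<noteq> {}) cs" "cs \<noteq> []" "set cs \<subseteq> Ob X"
    and "mat (hd cs) (hd cs) (Id X (hd cs)) s w" "mat (last cs) (last cs) (Id X (last cs)) t w'"
  shows "s = t"
proof -
  have Id_eq: "s = t" if u: "u \<in> hom X a b" and s: "mat a a (Id X a) s w"
    and t: "mat b b (Id X b) t w'" for a b u s t w w'
  proof -
    note ab = P.X.hom_Ob[OF u]
    obtain r z where m: "mat a b u r z" using ex_mat[OF u] by blast
    have "s = r"
      using sign_Comp(1)[OF P.X.Id_in[OF ab(1)] u s m] P.X.Comp_Id[OF u] m by simp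
    moreover have "t = r"
      using sign_Comp(2)[OF u P.X.Id_in[OF ab(2)] m t] P.X.Id_Comp[OF u] m by simp
    ultimately show ?thesis by simp
  qed
  show ?thesis
    using assms
  proof (induction cs arbitrary: s w rule: induct_list012)
    case (2 x)
    then show ?case using Id_eq[OF P.X.Id_in, of x s w t w'] by simp
  next
    case (3 x y zs)
    have "y \<in> Ob X" using 3 by simp
    then obtain r z where m: "mat y y (Id X y) r z" using ex_mat[OF P.X.Id_in] by blast
    have "r = t" using 3 m by (simp only: successively.simps list.sel last.simps) simp
    moreover have "s = r"
    proof -
      have "hom X x y \<noteq> {} \<or> hom X y x \<noteq> {}" and s: "mat x x (Id X x) s w" using 3 by simp_all
      then show ?thesis using Id_eq[OF _ s m] Id_eq[OF _ m s] by blast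
    qed
    ultimately show ?case by simp
  qed simp
qed

text \<open>The assignment of the matching morphism is a functor because representable structures
  over \<open>X'\<close> separate morphisms. It is faithful because the relation of a morphism of
  \<open>X\<close> determines it, and it is full because matching also works from \<open>X'\<close>
  to \<open>X\<close>.\<close>

lemma positive_imp_equivalent:
  assumes pos: "\<And>a b u. u \<in> hom X a b \<Longrightarrow> \<exists>w. mat a b u True w"
  shows "equivalent X X'"
proof -
  interpret sw: two_presentations C X' X U el' ap' rel' el ap rel by (rule swap)
  have "\<forall>u. \<exists>w. u \<in> Mor X \<longrightarrow> mat (Dom X u) (Cod X u) u True w"
    using pos[OF Mor_hom] by blast
  then obtain \<mu> where \<mu>0: "\<And>u. u \<in> Mor X \<Longrightarrow> mat (Dom X u) (Cod X u) u True (\<mu> u)" by metis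
  have \<mu>: "mat a b u True (\<mu> u)" if "u \<in> hom X a b" for u a b
    using \<mu>0[OF hom_Mor[OF that]] hom_Dom[OF that] hom_Cod[OF that] by simp
  have \<mu>_hom: "\<mu> u \<in> hom X' (F a) (F b)" if "u \<in> hom X a b" for u a b
    using mat_shom[OF \<mu>[OF that]] by simp
  have \<mu>_Comp: "\<mu> (v \<cdot>\<^bsub>X\<^esub> u) = \<mu> v \<cdot>\<^bsub>X'\<^esub> \<mu> u" if u: "u \<in> hom X a b" and v: "v \<in> hom X b d" for u v a b d
  proof -
    note a = F_Ob[OF P.X.hom_Ob(1)[OF u]] and vu = P.X.Comp_in[OF u v]
    note id = P'.X.Id_in[OF a]
    obtain c \<eta> where c: "c \<in> Ob C" and \<eta>: "\<And>b g. g \<in> hom X' (F a) b \<Longrightarrow> \<eta> b g \<in> el' c b"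
      "\<And>u b d g h. \<lbrakk>u \<in> hom X' b d; g \<in> hom X' (F a) b; h \<in> hom X' (F a) d\<rbrakk> \<Longrightarrow>
        rel' c u (\<eta> b g) (\<eta> d h) \<longleftrightarrow> u \<cdot>\<^bsub>X'\<^esub> g = h"
      using P'.ex_coslice[OF a] by blast
    note hu = \<mu>_hom[OF u] and hv = \<mu>_hom[OF v] and hvu = \<mu>_hom[OF vu]
    note huv = P'.X.Comp_in[OF hu hv]
    \<comment> \<open>In the representable structure of \<open>F a\<close>, the identity is related
      to \<open>\<mu> u\<close> and this to the composite. By \<open>mat_Comp\<close> the identity
      is then related to the composite along the image of \<open>v \<cdot> u\<close>, but along that
      morphism it is related only to the morphism itself.\<close>
    have "rel' c (\<mu> u) (\<eta> (F a) (Id X' (F a))) (\<eta> (F b) (\<mu> u))"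
      using \<eta>(2)[OF hu id hu] P'.X.Comp_Id[OF hu] by simp
    moreover have "rel' c (\<mu> v) (\<eta> (F b) (\<mu> u)) (\<eta> (F d) (\<mu> v \<cdot>\<^bsub>X'\<^esub> \<mu> u))"
      using \<eta>(2)[OF hv hu huv] by simp
    ultimately have "rel' c (\<mu> (v \<cdot>\<^bsub>X\<^esub> u)) (\<eta> (F a) (Id X' (F a))) (\<eta> (F d) (\<mu> v \<cdot>\<^bsub>X'\<^esub> \<mu> u))"
      using mat_Comp[OF u v \<mu>[OF u] \<mu>[OF v] \<mu>[OF vu] c \<eta>(1)[OF id] \<eta>(1)[OF hu] \<eta>(1)[OF huv]] by simp
    then show ?thesis
      using \<eta>(2)[OF hvu id huv] P'.X.Comp_Id[OF hvu] by simp
  qed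
  have \<mu>_Id: "\<mu> (Id X a) = Id X' (F a)" if a: "a \<in> Ob X" for a
  proof -
    note Fa = F_Ob[OF a] and ida = P.X.Id_in[OF a]
    note id = P'.X.Id_in[OF Fa] and hid = \<mu>_hom[OF ida]
    obtain c \<eta> where c: "c \<in> Ob C" and \<eta>: "\<And>b g. g \<in> hom X' (F a) b \<Longrightarrow> \<eta> b g \<in> el' c b"
      "\<And>u b d g h. \<lbrakk>u \<in> hom X' b d; g \<in> hom X' (F a) b; h \<in> hom X' (F a) d\<rbrakk> \<Longrightarrow>
        rel' c u (\<eta> b g) (\<eta> d h) \<longleftrightarrow> u \<cdot>\<^bsub>X'\<^esub> g = h"
      using P'.ex_coslice[OF Fa] by blast
    obtain i where i: "i \<in> hom C (pt a) c" "ap' i (F a) (\<gamma>' a) = \<eta> (F a) (Id X' (F a))"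
      using P'.univ_obtain[OF pt'[OF a] c \<eta>(1)[OF id]] by blast
    have "rel' c (\<mu> (Id X a)) (\<eta> (F a) (Id X' (F a))) (\<eta> (F a) (Id X' (F a)))"
      using matD[OF \<mu>[OF ida] i(1) i(1)] relational.refl[OF P.relational[OF c] a P.univ_in[OF pt[OF a] i(1)]] i(2)
      by simp
    then show ?thesis
      using \<eta>(2)[OF hid id id] P'.X.Comp_Id[OF hid] by simp
  qed
  define G where "G = \<lparr>ob_map = restrict F (Ob X), mor_map = restrict \<mu> (Mor X)\<rparr>"
  have G: "is_functor X X' G"
    unfolding G_def using is_functorI[OF P.X.category_axioms F_Ob \<mu>_hom \<mu>_Id \<mu>_Comp] .
  have "weak_equivalence X X' G"
    unfolding weak_equivalence_def
  proof (intro conjI ballI G)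
    fix a b assume a: "a \<in> Ob X" and b: "b \<in> Ob X"
    have G_map: "mor_map G u = \<mu> u" if "u \<in> hom X a b" for u
      using hom_Mor[OF that] by (simp add: G_def)
    have obG: "ob_map G a = F a" "ob_map G b = F b" using a b by (simp_all add: G_def)
    have "u = v" if u: "u \<in> hom X a b" and v: "v \<in> hom X a b" and eq: "\<mu> u = \<mu> v" for u v
    proof -
      have v': "v \<in> shom X True a b" using v by simp
      have "True \<and> v = u"
      proof (rule P.srel_determines[OF u v'])
        fix c x y assume c: "c \<in> Ob C" and x: "x \<in> el c a" and y: "y \<in> el c b" and xy: "rel c u x y"
        obtain i where i: "i \<in> hom C (pt a) c" "ap i a (\<gamma> a) = x" using P.univ_obtain[OF pt[OF a] c x] by blast
        obtain j where j: "j \<in> hom C (pt b) c" "ap j b (\<gamma> b) = y" using P.univ_obtain[OF pt[OF b] c y] by blast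
        show "srel rel True c v x y"
          using matD[OF \<mu>[OF u] i(1) j(1)] matD[OF \<mu>[OF v] i(1) j(1)] eq xy i(2) j(2) by simp
      qed
      then show ?thesis by simp
    qed
    moreover have "\<exists>u\<in>hom X a b. \<mu> u = w" if w: "w \<in> hom X' (F a) (F b)" for w
    proof -
      \<comment> \<open>The sign of this backward match is not known beforehand. Composing it with
        the match of \<open>v\<close> shows that the relation of \<open>w\<close> is contained in
        that of \<open>\<mu> v\<close> up to the sign, and \<open>srel_determines\<close> settles
        both.\<close>
      obtain s v where sv: "sw.matches (pt a) (F a) (\<gamma>' a) a (\<gamma> a) (pt b) (F b) (\<gamma>' b) b (\<gamma> b) w s v"
        using sw.ex_matches[OF pt'[OF a] pt[OF a] pt'[OF b] pt[OF b] w] by blast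
      then have v: "v \<in> shom X s a b" unfolding sw.matches_def by blast
      have \<mu>v: "\<mu> v \<in> shom X' s (F a) (F b)" using v \<mu>_hom by (cases s) auto
      have "s \<and> \<mu> v = w"
      proof (rule P'.srel_determines[OF w \<mu>v])
        fix c x y assume c: "c \<in> Ob C" and x: "x \<in> el' c (F a)" and y: "y \<in> el' c (F b)" and xy: "rel' c w x y"
        obtain i where i: "i \<in> hom C (pt a) c" "ap' i (F a) (\<gamma>' a) = x" using P'.univ_obtain[OF pt'[OF a] c x] by blast
        obtain j where j: "j \<in> hom C (pt b) c" "ap' j (F b) (\<gamma>' b) = y" using P'.univ_obtain[OF pt'[OF b] c y] by blast
        have "srel rel s c v (ap i a (\<gamma> a)) (ap j b (\<gamma> b))"
          using sv i j xy unfolding sw.matches_def by blast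
        then show "srel rel' s c (\<mu> v) x y"
          using v matD[OF \<mu> i(1) j(1), of v] matD[OF \<mu> j(1) i(1), of v] i(2) j(2) by (cases s) auto
      qed
      then show ?thesis using v by auto
    qed
    ultimately show "bij_betw (mor_map G) (hom X a b) (hom X' (ob_map G a) (ob_map G b))"
      unfolding bij_betw_def inj_on_def obG using G_map \<mu>_hom[of _ a b] by (metis (no_types, lifting) image_eqI image_subsetI subsetI subset_antisym)
  next
    fix a' assume a': "a' \<in> Ob X'"
    \<comment> \<open>A structure free on \<open>a'\<close> is a point, hence also free on some
      \<open>a\<close>. A morphism from \<open>pt a\<close> to it yields an element over
      \<open>F a\<close>, which must be a transport of the generator over \<open>a'\<close>; this
      gives the isomorphism.\<close>
    obtain q \<delta>' where q': "P'.univ q a' \<delta>'" using P'.ex_univ[OF a'] by blast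
    obtain a \<delta> where q: "P.univ q a \<delta>" using P.point_imp_univ[OF P'.univ_imp_point[OF q']] by blast
    note a = P.univD(2)[OF q]
    obtain f where f: "f \<in> hom C (pt a) q" using P.univ_obtain[OF pt[OF a] P.univD(1,3)[OF q]] by blast
    obtain g h where "inverse_pair X' a' (F a) g h"
      using P'.univD(5)[OF q' F_Ob[OF a] P'.univ_in[OF pt'[OF a] f]] unfolding P'.copy_def by blast
    then have "inverse_pair X' (ob_map G a) a' h g"
      using inverse_pair_sym a by (simp add: G_def)
    then show "\<exists>c\<in>Ob X. \<exists>f g. inverse_pair X' (ob_map G c) a' f g" using a by blast
  qed
  then show ?thesis
    using weak_equivalence_imp_equivalent[OF P.X.category_axioms P'.X.category_axioms] by blast
qed

end

section \<open>From signs to an equivalence of the bases\<close>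

context two_presentations
begin

lemma op_presentations: "two_presentations C (op_cat X) X' U el ap (\<lambda>c u x y. rel c u y x) el' ap' rel'"
proof -
  interpret op: presentation C "op_cat X" U el ap "\<lambda>c u x y. rel c u y x"
    using presentation_op_cat[OF P.presentation_axioms] .
  show ?thesis
    by unfold_locales (simp add: P.small_Mor)
qed

text \<open>Every morphism has the sign of the identity at a base object. If that sign is negative,
  passing to the opposite of \<open>X\<close> with reversed relations makes all signs positive;
  transports and free structures are unaffected, so the same choices serve.\<close>

theorem connected_imp_equivalent:
  assumes conn: "connected_category X"
  shows "equivalent X X' \<or> equivalent (op_cat X) X'"
proof -
  have "\<forall>a. \<exists>p \<gamma> a' \<gamma>'. a \<in> Ob X \<longrightarrow> P.univ p a \<gamma> \<and> P'.univ p a' \<gamma>'"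
    using P.ex_univ P'.point_imp_univ P.univ_imp_point by metis
  then obtain pt \<gamma> F \<gamma>' where pt: "\<And>a. a \<in> Ob X \<Longrightarrow> P.univ (pt a) a (\<gamma> a) \<and> P'.univ (pt a) (F a) (\<gamma>' a)"
    by metis
  interpret A: aligned_presentations C X X' U el ap rel el' ap' rel' pt \<gamma> F \<gamma>'
    by unfold_locales (use pt in auto)
  obtain a0 where a0: "a0 \<in> Ob X" using conn unfolding connected_category_def by blast
  obtain s w0 where s: "A.mat a0 a0 (Id X a0) s w0" using A.ex_mat[OF P.X.Id_in[OF a0]] by blast
  have sign: "\<exists>w. A.mat a b u s w" if u: "u \<in> hom X a b" for a b u
  proof -
    note a = P.X.hom_Ob(1)[OF u]
    obtain t w where w: "A.mat a b u t w" using A.ex_mat[OF u] by blast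
    obtain r z where r: "A.mat a a (Id X a) r z" using A.ex_mat[OF P.X.Id_in[OF a]] by blast
    obtain cs where "cs \<noteq> []" "set cs \<subseteq> Ob X" "hd cs = a0" "last cs = a"
      "successively (\<lambda>c d. hom X c d \<noteq> {} \<or> hom X d c \<noteq> {}) cs"
      using conn a0 a unfolding connected_category_def by blast
    then have "s = r" using A.connected_sign[of cs s w0 r z] s r by simp
    moreover have "r = t"
      using A.sign_Comp(1)[OF P.X.Id_in[OF a] u r w] P.X.Comp_Id[OF u] w by simp
    ultimately show ?thesis using w by blast
  qed
  show ?thesis
  proof (cases s)
    case True
    then have "\<exists>w. A.mat a b u True w" if "u \<in> hom X a b" for a b u
      using sign[OF that] by simp
    from A.positive_imp_equivalent[OF this] show ?thesis by blast
  next
    case False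
    interpret op: two_presentations C "op_cat X" X' U el ap "\<lambda>c u x y. rel c u y x" el' ap' rel'
      by (rule op_presentations)
    have copy: "op.P.copy c a x b y \<longleftrightarrow> P.copy c a x b y" for c a x b y
      unfolding op.P.copy_def P.copy_def by auto
    have univ: "op.P.univ p a x \<longleftrightarrow> P.univ p a x" for p a x
      unfolding op.P.univ_def P.univ_def copy by simp
    interpret B: aligned_presentations C "op_cat X" X' U el ap "\<lambda>c u x y. rel c u y x" el' ap' rel' pt \<gamma> F \<gamma>'
      by unfold_locales (use pt univ in auto)
    have "\<exists>w. B.mat a b u True w" if "u \<in> hom (op_cat X) a b" for a b u
    proof -
      have "u \<in> hom X b a" using that by simp
      from sign[OF this] False have "\<exists>w. A.mat b a u False w" by simp
      then show ?thesis unfolding matches_def op.matches_def by auto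
    qed
    from B.positive_imp_equivalent[OF this] show ?thesis by blast
  qed
qed

end

section \<open>Orders as categories\<close>

lemma le_refl: "category P \<Longrightarrow> x \<in> Ob P \<Longrightarrow> le P x x"
  unfolding le_def using category.Id_in[of P x] by blast

lemma le_trans: "category P \<Longrightarrow> le P x y \<Longrightarrow> le P y z \<Longrightarrow> le P x z"
  unfolding le_def using category.Comp_in[of P _ x y _ z] by blast

lemma le_antisym:
  assumes P: "order_category P" and "le P x y" "le P y x"
  shows "x = y"
proof -
  interpret category P using P by (simp add: order_category_def)
  have thin: "f = g" if "f \<in> hom P a b" "g \<in> hom P a b" for f g a b
    using P that unfolding order_category_def hom_def by auto
  obtain f g where f: "f \<in> hom P x y" and g: "g \<in> hom P y x"
    using assms(2,3) unfolding le_def by blast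
  note x = hom_Ob(1)[OF f] and y = hom_Ob(2)[OF f]
  have "inverse_pair P x y f g"
    unfolding inverse_pair_def
    using f g thin[OF Comp_in[OF f g] Id_in[OF x]] thin[OF Comp_in[OF g f] Id_in[OF y]] by simp
  then have "f = Id P x"
    using inverse_pair_is_iso P hom_Dom[OF f] unfolding order_category_def by metis
  then show ?thesis
    using hom_Cod[OF f] hom_Cod[OF Id_in[OF x]] by simp
qed

lemma functor_le: "is_functor P Q F \<Longrightarrow> le P x y \<Longrightarrow> le Q (ob_map F x) (ob_map F y)"
  unfolding le_def using functor_hom[of P Q F _ x y] by blast

text \<open>The objects and the morphisms of a small order both have type \<open>'v\<close>, so the
  arrow from \<open>x\<close> to \<open>y\<close> is coded by \<open>p (x, y)\<close> and its ends
  are recovered by inverting \<open>p\<close>.\<close>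

definition order_cat :: "('v \<times> 'v \<Rightarrow> 'v) \<Rightarrow> 'v set \<Rightarrow> ('v \<Rightarrow> 'v \<Rightarrow> bool) \<Rightarrow> 'v ord" where
  "order_cat p D L = \<lparr>Ob = D, Mor = {p (x, y) | x y. x \<in> D \<and> y \<in> D \<and> L x y},
    Dom = (\<lambda>f. fst (inv p f)), Cod = (\<lambda>f. snd (inv p f)), Id = (\<lambda>x. p (x, x)),
    Comp = (\<lambda>g f. p (fst (inv p f), snd (inv p g)))\<rparr>"

definition mono_funct ::
  "('v \<times> 'v \<Rightarrow> 'v) \<Rightarrow> 'v set \<Rightarrow> ('v \<Rightarrow> 'v \<Rightarrow> bool) \<Rightarrow> ('v \<Rightarrow> 'v) \<Rightarrow> ('v, 'v, 'v, 'v) funct" where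
  "mono_funct p D L m = \<lparr>ob_map = restrict m D,
    mor_map = (\<lambda>f\<in>Mor (order_cat p D L). p (m (fst (inv p f)), m (snd (inv p f))))\<rparr>"

definition is_order_on :: "'v set \<Rightarrow> ('v \<Rightarrow> 'v \<Rightarrow> bool) \<Rightarrow> bool" where
  "is_order_on D L \<longleftrightarrow> (\<forall>x\<in>D. L x x) \<and> (\<forall>x\<in>D. \<forall>y\<in>D. \<forall>z\<in>D. L x y \<longrightarrow> L y z \<longrightarrow> L x z) \<and>
    (\<forall>x\<in>D. \<forall>y\<in>D. L x y \<longrightarrow> L y x \<longrightarrow> x = y)"

lemma Ob_order_cat [simp]: "Ob (order_cat p D L) = D"
  and Id_order_cat [simp]: "Id (order_cat p D L) x = p (x, x)"
  by (simp_all add: order_cat_def)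

context
  fixes p :: "'v \<times> 'v \<Rightarrow> 'v"
  assumes p: "inj p"
begin

lemma hom_order_cat: "hom (order_cat p D L) x y = (if x \<in> D \<and> y \<in> D \<and> L x y then {p (x, y)} else {})"
  using p by (auto simp: hom_def order_cat_def)

lemma Mor_order_cat: "f \<in> Mor (order_cat p D L) \<longleftrightarrow> (\<exists>x\<in>D. \<exists>y\<in>D. L x y \<and> f = p (x, y))"
  by (auto simp: order_cat_def)

lemma Dom_order_cat [simp]: "Dom (order_cat p D L) (p (x, y)) = x"
  and Cod_order_cat [simp]: "Cod (order_cat p D L) (p (x, y)) = y"
  and Comp_order_cat [simp]: "p (z, w) \<cdot>\<^bsub>order_cat p D L\<^esub> p (x, y) = p (x, w)"
  using p by (simp_all add: order_cat_def)

lemma le_order_cat: "le (order_cat p D L) x y \<longleftrightarrow> x \<in> D \<and> y \<in> D \<and> L x y"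
  by (simp add: le_def hom_order_cat)

lemma category_order_cat:
  assumes "is_order_on D L"
  shows "category (order_cat p D L)"
proof
  note L = assms[unfolded is_order_on_def]
  show "Id (order_cat p D L) a \<in> hom (order_cat p D L) a a" if "a \<in> Ob (order_cat p D L)" for a
    using that L by (simp add: hom_order_cat)
  show "g \<cdot>\<^bsub>order_cat p D L\<^esub> f \<in> hom (order_cat p D L) a c"
    if "f \<in> hom (order_cat p D L) a b" "g \<in> hom (order_cat p D L) b c" for f g a b c
  proof -
    have "a \<in> D" "b \<in> D" "c \<in> D" "L a b" "L b c" "f = p (a, b)" "g = p (b, c)"
      using that by (simp_all add: hom_order_cat split: if_splits)
    moreover from this have "L a c" using L by blast
    ultimately show ?thesis by (simp add: hom_order_cat)
  qed
qed (auto simp: Mor_order_cat hom_order_cat split: if_splits)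

lemma order_category_order_cat:
  assumes "is_order_on D L"
  shows "order_category (order_cat p D L)"
  unfolding order_category_def
proof (intro conjI ballI allI impI)
  note L = assms[unfolded is_order_on_def]
  show "category (order_cat p D L)" using category_order_cat[OF assms] .
  show "f = g" if "f \<in> Mor (order_cat p D L)" "g \<in> Mor (order_cat p D L)"
    "Dom (order_cat p D L) f = Dom (order_cat p D L) g \<and> Cod (order_cat p D L) f = Cod (order_cat p D L) g" for f g
    using that by (auto simp: Mor_order_cat)
  fix f assume "is_iso (order_cat p D L) f"
  then obtain x y g where "x \<in> D" "y \<in> D" "L x y" "f = p (x, y)" and "g \<in> hom (order_cat p D L) y x"
    by (auto simp: is_iso_def Mor_order_cat)
  moreover from this have "L y x" by (simp add: hom_order_cat split: if_splits)
  ultimately have "x = y" using L by blast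
  then show "f = Id (order_cat p D L) (Dom (order_cat p D L) f)"
    using \<open>f = p (x, y)\<close> by simp
qed

lemma is_functor_mono_funct:
  assumes "is_order_on D L" "is_order_on D' L'" "\<And>x. x \<in> D \<Longrightarrow> m x \<in> D'"
    and "\<And>x y. \<lbrakk>x \<in> D; y \<in> D; L x y\<rbrakk> \<Longrightarrow> L' (m x) (m y)"
  shows "is_functor (order_cat p D L) (order_cat p D' L') (mono_funct p D L m)"
proof -
  have L: "L x z" if "x \<in> D" "y \<in> D" "z \<in> D" "L x y" "L y z" for x y z
    using assms(1) that unfolding is_order_on_def by blast
  have refl: "L x x" if "x \<in> D" for x
    using assms(1) that unfolding is_order_on_def by blast
  have mor: "mor_map (mono_funct p D L m) (p (x, y)) = p (m x, m y)" if "x \<in> D" "y \<in> D" "L x y" for x y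
    using that p by (auto simp: mono_funct_def Mor_order_cat)
  have ob: "ob_map (mono_funct p D L m) x = m x" if "x \<in> D" for x
    using that by (simp add: mono_funct_def)
  show ?thesis
    unfolding is_functor_def
  proof (intro conjI ballI impI)
    show "ob_map (mono_funct p D L m) \<in> Ob (order_cat p D L) \<rightarrow>\<^sub>E Ob (order_cat p D' L')"
      using assms(3) by (simp add: mono_funct_def)
    show "mor_map (mono_funct p D L m) \<in> Mor (order_cat p D L) \<rightarrow>\<^sub>E Mor (order_cat p D' L')"
    proof (rule PiE_I)
      show "mor_map (mono_funct p D L m) f \<in> Mor (order_cat p D' L')" if "f \<in> Mor (order_cat p D L)" for f
        using that mor assms(3,4) unfolding Mor_order_cat by metis
    qed (simp add: mono_funct_def)
    show "mor_map (mono_funct p D L m) f \<in> hom (order_cat p D' L')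
        (ob_map (mono_funct p D L m) (Dom (order_cat p D L) f)) (ob_map (mono_funct p D L m) (Cod (order_cat p D L) f))"
      if f: "f \<in> Mor (order_cat p D L)" for f
      using f[unfolded Mor_order_cat] by (auto simp: mor ob hom_order_cat assms(3,4))
    show "mor_map (mono_funct p D L m) (Id (order_cat p D L) a) = Id (order_cat p D' L') (ob_map (mono_funct p D L m) a)"
      if "a \<in> Ob (order_cat p D L)" for a
      using that by (simp add: mor ob refl)
    show "mor_map (mono_funct p D L m) (g \<cdot>\<^bsub>order_cat p D L\<^esub> f) =
        mor_map (mono_funct p D L m) g \<cdot>\<^bsub>order_cat p D' L'\<^esub> mor_map (mono_funct p D L m) f"
      if fg: "f \<in> Mor (order_cat p D L)" "g \<in> Mor (order_cat p D L)" "Cod (order_cat p D L) f = Dom (order_cat p D L) g" for f g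
    proof -
      obtain x y z where xyz: "x \<in> D" "y \<in> D" "z \<in> D" "L x y" "L y z" "f = p (x, y)" "g = p (y, z)"
        using fg unfolding Mor_order_cat by auto
      then show ?thesis using L[OF xyz(1-5)] by (simp add: mor)
    qed
  qed
qed

lemma comp_mono_funct:
  assumes "\<And>x. x \<in> D \<Longrightarrow> m x \<in> D'" "\<And>x y. \<lbrakk>x \<in> D; y \<in> D; L x y\<rbrakk> \<Longrightarrow> L' (m x) (m y)"
  shows "comp_funct (order_cat p D L) (mono_funct p D' L' m') (mono_funct p D L m) =
    mono_funct p D L (\<lambda>x. m' (m x))"
proof -
  have Mor: "p (m x, m y) \<in> Mor (order_cat p D' L')" if "x \<in> D" "y \<in> D" "L x y" for x y
    unfolding Mor_order_cat using assms that by blast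
  have eq: "mor_map (mono_funct p D' L' m') (mor_map (mono_funct p D L m) f) =
      mor_map (mono_funct p D L (\<lambda>x. m' (m x))) f" if f: "f \<in> Mor (order_cat p D L)" for f
  proof -
    obtain x y where "x \<in> D" "y \<in> D" "L x y" "f = p (x, y)"
      using f unfolding Mor_order_cat by blast
    then show ?thesis
      using f p Mor by (simp add: mono_funct_def)
  qed
  show ?thesis
  proof (rule funct.equality)
    show "ob_map (comp_funct (order_cat p D L) (mono_funct p D' L' m') (mono_funct p D L m)) =
        ob_map (mono_funct p D L (\<lambda>x. m' (m x)))"
      using assms(1) by (auto simp: comp_funct_def mono_funct_def)
    show "mor_map (comp_funct (order_cat p D L) (mono_funct p D' L' m') (mono_funct p D L m)) =
        mor_map (mono_funct p D L (\<lambda>x. m' (m x)))" (is "?l = ?r")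
    proof
      show "?l f = ?r f" for f
      proof (cases "f \<in> Mor (order_cat p D L)")
        case True
        then show ?thesis using eq by (simp add: comp_funct_def)
      next
        case False
        then show ?thesis by (simp add: comp_funct_def mono_funct_def)
      qed
    qed
  qed simp
qed

lemma id_mono_funct: "id_funct (order_cat p D L) = mono_funct p D L (\<lambda>x. x)"
  unfolding id_funct_def mono_funct_def using p
  by (auto simp: Mor_order_cat fun_eq_iff restrict_def)

lemma mono_funct_cong:
  assumes "\<And>x. x \<in> D \<Longrightarrow> m x = m' x"
  shows "mono_funct p D L m = mono_funct p D L m'"
  unfolding mono_funct_def using assms p
  by (auto simp: Mor_order_cat fun_eq_iff restrict_def)

end

lemma (in universe) small_category_order_cat:
  assumes "inj q" "is_order_on D L" "small U D"
  shows "small_category U (order_cat q D L)"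
proof -
  have "Mor (order_cat q D L) \<subseteq> q ` (D \<times> D)"
    by (auto simp: order_cat_def)
  then show ?thesis
    unfolding small_category_def
    using category_order_cat[OF assms(1,2)] small_subset[OF small_image[OF small_Times[OF assms(3,3)]]] assms(3)
    by simp
qed

lemma category_dis: "category (dis T)"
  by unfold_locales (auto simp: dis_def hom_def)

lemma order_category_dis: "order_category (dis T)"
  unfolding order_category_def using category_dis by (auto simp: dis_def is_iso_def hom_def)

lemma small_category_dis: "small U T \<Longrightarrow> small_category U (dis T)"
  unfolding small_category_def using category_dis by (auto simp: dis_def)

section \<open>Structure species as relational structures\<close>

definition sp_el :: "('o, 'm, 'v) species \<Rightarrow> 'o \<Rightarrow> 'v set" where
  "sp_el \<Sigma> a = ob_map (setf \<Sigma>) a"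

definition sp_rel :: "('o, 'm) cat \<Rightarrow> ('o, 'm, 'v) species \<Rightarrow> 'm \<Rightarrow> 'v \<Rightarrow> 'v \<Rightarrow> bool" where
  "sp_rel X \<Sigma> u x y \<longleftrightarrow> le (ob_map (ordf \<Sigma>) (Cod X u)) (ob_map (act (mor_map (ordf \<Sigma>) u)) x) y"

definition sp_ap :: "('o, 'm, 'v) species_map \<Rightarrow> 'o \<Rightarrow> 'v \<Rightarrow> 'v" where
  "sp_ap \<phi> a = act (act \<phi> a)"

lemma core_simps [simp]: "Ob (core X) = Ob X" "Mor (core X) = {f. is_iso X f}" "Dom (core X) = Dom X"
  "Cod (core X) = Cod X" "Id (core X) = Id X" "g \<cdot>\<^bsub>core X\<^esub> f = g \<cdot>\<^bsub>X\<^esub> f"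
  by (simp_all add: core_def)

lemma set_cat_simps [simp]: "Ob (set_cat U) = {A. small U A}"
  "Mor (set_cat U) = {f. small U (src f) \<and> small U (trg f) \<and> act f \<in> src f \<rightarrow>\<^sub>E trg f}"
  "Dom (set_cat U) = src" "Cod (set_cat U) = trg"
  "Id (set_cat U) A = \<lparr>src = A, trg = A, act = (\<lambda>x\<in>A. x)\<rparr>"
  "g \<cdot>\<^bsub>set_cat U\<^esub> f = \<lparr>src = src f, trg = trg g, act = (\<lambda>x\<in>src f. act g (act f x))\<rparr>"
  by (simp_all add: set_cat_def)

lemma ord_cat_simps [simp]: "Ob (ord_cat U) = {P. order_category P \<and> small_category U P}"
  "Mor (ord_cat U) = {f. order_category (src f) \<and> small_category U (src f) \<and>
    order_category (trg f) \<and> small_category U (trg f) \<and> is_functor (src f) (trg f) (act f)}"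
  "Dom (ord_cat U) = src" "Cod (ord_cat U) = trg"
  "Id (ord_cat U) P = \<lparr>src = P, trg = P, act = id_funct P\<rparr>"
  "g \<cdot>\<^bsub>ord_cat U\<^esub> f = \<lparr>src = src f, trg = trg g, act = comp_funct (src f) (act g) (act f)\<rparr>"
  by (simp_all add: ord_cat_def)

locale species_base = universe U + X: category X
  for U :: "'v \<Rightarrow> 'v set" and X :: "('o, 'm) cat"
begin

context
  fixes \<Sigma> :: "('o, 'm, 'v) species"
  assumes \<Sigma>: "is_species U X \<Sigma>"
begin

lemma species_ordf: "is_functor X (ord_cat U) (ordf \<Sigma>)"
  and species_setf: "is_functor (core X) (set_cat U) (setf \<Sigma>)"
  and species_incl: "nat_trans (core X) (ord_cat U)
      (comp_funct (core X) (Dis U) (setf \<Sigma>)) (comp_funct (core X) (ordf \<Sigma>) (core_incl X))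
      (\<lambda>a\<in>Ob X. dis_incl (ob_map (setf \<Sigma>) a) (ob_map (ordf \<Sigma>) a))"
  using \<Sigma> unfolding is_species_def by blast+

lemma small_sp_el: "a \<in> Ob X \<Longrightarrow> small U (sp_el \<Sigma> a)"
  using functor_Ob[OF species_setf, of a] by (simp add: sp_el_def)

lemma order_ordf: "a \<in> Ob X \<Longrightarrow> order_category (ob_map (ordf \<Sigma>) a)"
  using functor_Ob[OF species_ordf, of a] by simp

lemma category_ordf: "a \<in> Ob X \<Longrightarrow> category (ob_map (ordf \<Sigma>) a)"
  using order_ordf unfolding order_category_def by blast

lemma ordf_mor:
  assumes "u \<in> hom X a b"
  shows "src (mor_map (ordf \<Sigma>) u) = ob_map (ordf \<Sigma>) a" "trg (mor_map (ordf \<Sigma>) u) = ob_map (ordf \<Sigma>) b"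
    "is_functor (ob_map (ordf \<Sigma>) a) (ob_map (ordf \<Sigma>) b) (act (mor_map (ordf \<Sigma>) u))"
  using functor_hom[OF species_ordf assms] by (auto simp: hom_def)

lemma setf_mor:
  assumes "inverse_pair X a b f g"
  shows "src (mor_map (setf \<Sigma>) f) = sp_el \<Sigma> a" "trg (mor_map (setf \<Sigma>) f) = sp_el \<Sigma> b"
    "act (mor_map (setf \<Sigma>) f) \<in> sp_el \<Sigma> a \<rightarrow>\<^sub>E sp_el \<Sigma> b"
proof -
  have "f \<in> hom (core X) a b"
    using inverse_pairD(1)[OF assms] inverse_pair_is_iso[OF assms] by (simp add: hom_def)
  from functor_hom[OF species_setf this]
  show "src (mor_map (setf \<Sigma>) f) = sp_el \<Sigma> a" "trg (mor_map (setf \<Sigma>) f) = sp_el \<Sigma> b"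
    "act (mor_map (setf \<Sigma>) f) \<in> sp_el \<Sigma> a \<rightarrow>\<^sub>E sp_el \<Sigma> b"
    by (auto simp: hom_def sp_el_def)
qed

lemma sp_el_subset:
  assumes a: "a \<in> Ob X"
  shows "sp_el \<Sigma> a \<subseteq> Ob (ob_map (ordf \<Sigma>) a)"
proof -
  have "(\<lambda>a\<in>Ob X. dis_incl (ob_map (setf \<Sigma>) a) (ob_map (ordf \<Sigma>) a)) a \<in> Mor (ord_cat U)"
    using species_incl a unfolding nat_trans_def by (auto simp: hom_def dest: PiE_mem[of _ _ _ a])
  then have "is_functor (dis (sp_el \<Sigma> a)) (ob_map (ordf \<Sigma>) a)
      (act (dis_incl (ob_map (setf \<Sigma>) a) (ob_map (ordf \<Sigma>) a)))"
    using a by (simp add: dis_incl_def sp_el_def)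
  from functor_Ob[OF this] show ?thesis
    by (auto simp: dis_def dis_incl_def sp_el_def)
qed

text \<open>Naturality of the inclusions, evaluated at an object of the discrete order.\<close>

lemma ordf_setf:
  assumes fg: "inverse_pair X a b f g" and x: "x \<in> sp_el \<Sigma> a"
  shows "ob_map (act (mor_map (ordf \<Sigma>) f)) x = act (mor_map (setf \<Sigma>) f) x"
proof -
  let ?\<tau> = "\<lambda>a\<in>Ob X. dis_incl (ob_map (setf \<Sigma>) a) (ob_map (ordf \<Sigma>) a)"
  note f = inverse_pairD(1)[OF fg] and iso = inverse_pair_is_iso[OF fg]
  note ab = X.hom_Ob[OF f] and S = setf_mor[OF fg]
  have "f \<in> Mor (core X)" using iso by simp
  then have "?\<tau> (Cod (core X) f) \<cdot>\<^bsub>ord_cat U\<^esub> mor_map (comp_funct (core X) (Dis U) (setf \<Sigma>)) f =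
      mor_map (comp_funct (core X) (ordf \<Sigma>) (core_incl X)) f \<cdot>\<^bsub>ord_cat U\<^esub> ?\<tau> (Dom (core X) f)"
    using species_incl unfolding nat_trans_def by blast
  from arg_cong[OF this, of "\<lambda>k. ob_map (act k) x"] show ?thesis
    using ab iso S hom_Dom[OF f] hom_Cod[OF f] small_sp_el x PiE_mem[OF S(3) x]
    by (simp add: comp_funct_def Dis_def core_incl_def dis_incl_def dis_def sp_el_def)
qed

text \<open>The lift is \<open>S(f)(x)\<close>, which equals \<open>E(f)(x)\<close>. The first
  relation is then reflexivity, and the second follows from
  \<open>E(g)(E(f)(x)) = x\<close>.\<close>

lemma setf_lift:
  assumes fg: "inverse_pair X a b f g" and x: "x \<in> sp_el \<Sigma> a"
  shows "act (mor_map (setf \<Sigma>) f) x \<in> sp_el \<Sigma> b" "sp_rel X \<Sigma> f x (act (mor_map (setf \<Sigma>) f) x)"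
    "sp_rel X \<Sigma> g (act (mor_map (setf \<Sigma>) f) x) x"
proof -
  note f = inverse_pairD[OF fg]
  note ab = X.hom_Ob[OF f(1)] and S = setf_mor[OF fg]
  let ?y = "act (mor_map (setf \<Sigma>) f) x"
  show y: "?y \<in> sp_el \<Sigma> b" using PiE_mem[OF S(3) x] .
  show "sp_rel X \<Sigma> f x ?y"
    using ordf_setf[OF fg x] le_refl[OF category_ordf[OF ab(2)]] sp_el_subset[OF ab(2)] y hom_Cod[OF f(1)]
    by (auto simp: sp_rel_def)
  have xO: "x \<in> Ob (ob_map (ordf \<Sigma>) a)" using sp_el_subset[OF ab(1)] x by blast
  have "mor_map (ordf \<Sigma>) g \<cdot>\<^bsub>ord_cat U\<^esub> mor_map (ordf \<Sigma>) f = mor_map (ordf \<Sigma>) (Id X a)"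
    using functor_Comp[OF species_ordf f(1,2), symmetric] unfolding f(3) .
  also have "\<dots> = Id (ord_cat U) (ob_map (ordf \<Sigma>) a)"
    using functor_Id[OF species_ordf ab(1)] .
  finally have "ob_map (act (mor_map (ordf \<Sigma>) g \<cdot>\<^bsub>ord_cat U\<^esub> mor_map (ordf \<Sigma>) f)) x =
      ob_map (act (Id (ord_cat U) (ob_map (ordf \<Sigma>) a))) x"
    by (rule arg_cong)
  then have "ob_map (comp_funct (ob_map (ordf \<Sigma>) a) (act (mor_map (ordf \<Sigma>) g)) (act (mor_map (ordf \<Sigma>) f))) x =
      ob_map (id_funct (ob_map (ordf \<Sigma>) a)) x"
    by (simp add: ordf_mor(1)[OF f(1)])
  then have "ob_map (act (mor_map (ordf \<Sigma>) g)) ?y = x"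
    using xO ordf_setf[OF fg x] by (simp add: comp_funct_def id_funct_def)
  then show "sp_rel X \<Sigma> g ?y x"
    using le_refl[OF category_ordf[OF ab(1)] xO] hom_Cod[OF f(2)] by (simp add: sp_rel_def)
qed

text \<open>Transitivity is the chain \<open>E(v)(E(u)(x)) < E(v)(y) < z\<close>, using that
  \<open>E(v)\<close> is monotone.\<close>

lemma relational_species: "relational X (sp_el \<Sigma>) (sp_rel X \<Sigma>)"
proof
  have Id: "sp_rel X \<Sigma> (Id X a) x y \<longleftrightarrow> le (ob_map (ordf \<Sigma>) a) x y" if a: "a \<in> Ob X" and x: "x \<in> sp_el \<Sigma> a" for a x y
    using functor_Id[OF species_ordf a] sp_el_subset[OF a] x hom_Cod[OF X.Id_in[OF a]]
    by (auto simp: sp_rel_def id_funct_def)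
  show "sp_rel X \<Sigma> (Id X a) x x" if "a \<in> Ob X" "x \<in> sp_el \<Sigma> a" for a x
    using Id[OF that] le_refl[OF category_ordf[OF that(1)]] sp_el_subset[OF that(1)] that(2) by blast
  show "x = y" if "a \<in> Ob X" "x \<in> sp_el \<Sigma> a" "y \<in> sp_el \<Sigma> a" "sp_rel X \<Sigma> (Id X a) x y" "sp_rel X \<Sigma> (Id X a) y x" for a x y
    using Id[OF that(1,2)] Id[OF that(1,3)] that(4,5) le_antisym[OF order_ordf[OF that(1)]] by blast
  show "\<exists>y\<in>sp_el \<Sigma> b. sp_rel X \<Sigma> g x y \<and> sp_rel X \<Sigma> h y x" if "inverse_pair X a b g h" "x \<in> sp_el \<Sigma> a" for a b g h x
    using setf_lift[OF that] by blast
  fix u v a b c x y z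
  assume u: "u \<in> hom X a b" and v: "v \<in> hom X b c" and x: "x \<in> sp_el \<Sigma> a" and y: "y \<in> sp_el \<Sigma> b"
    and z: "z \<in> sp_el \<Sigma> c" and xy: "sp_rel X \<Sigma> u x y" and yz: "sp_rel X \<Sigma> v y z"
  note abc = X.hom_Ob[OF u] X.hom_Ob[OF v]
  have "x \<in> Ob (ob_map (ordf \<Sigma>) a)" using sp_el_subset[OF abc(1)] x by blast
  then have "ob_map (act (mor_map (ordf \<Sigma>) (v \<cdot>\<^bsub>X\<^esub> u))) x =
      ob_map (act (mor_map (ordf \<Sigma>) v)) (ob_map (act (mor_map (ordf \<Sigma>) u)) x)"
    using functor_Comp[OF species_ordf u v] ordf_mor(1)[OF u] by (simp add: comp_funct_def)
  moreover have "le (ob_map (ordf \<Sigma>) c) (ob_map (act (mor_map (ordf \<Sigma>) v)) (ob_map (act (mor_map (ordf \<Sigma>) u)) x))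
      (ob_map (act (mor_map (ordf \<Sigma>) v)) y)"
    using functor_le[OF ordf_mor(3)[OF v]] xy hom_Cod[OF u] by (simp add: sp_rel_def)
  ultimately show "sp_rel X \<Sigma> (v \<cdot>\<^bsub>X\<^esub> u) x z"
    using le_trans[OF category_ordf[OF abc(4)]] yz hom_Cod[OF v] hom_Cod[OF X.Comp_in[OF u v]]
    by (auto simp: sp_rel_def)
qed

end

text \<open>Naturality on the core need not be demanded: the image of \<open>x\<close> under an isomorphism is
  determined by the relations.\<close>

lemma species_map_iff:
  "is_species_map U X \<phi> \<longleftrightarrow> is_species U X (src \<phi>) \<and> is_species U X (trg \<phi>) \<and>
    act \<phi> \<in> extensional (Ob X) \<and>
    (\<forall>a\<in>Ob X. src (act \<phi> a) = sp_el (src \<phi>) a \<and> trg (act \<phi> a) = sp_el (trg \<phi>) a \<and>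
      sp_ap \<phi> a \<in> extensional (sp_el (src \<phi>) a)) \<and>
    rel_map X (sp_el (src \<phi>)) (sp_rel X (src \<phi>)) (sp_el (trg \<phi>)) (sp_rel X (trg \<phi>)) (sp_ap \<phi>)"
  (is "?L \<longleftrightarrow> ?R")
proof
  assume L: ?L
  then have sp: "is_species U X (src \<phi>)" "is_species U X (trg \<phi>)"
    and nat: "nat_trans (core X) (set_cat U) (setf (src \<phi>)) (setf (trg \<phi>)) (act \<phi>)"
    and mono: "\<And>a b u A B. \<lbrakk>a \<in> Ob X; b \<in> Ob X; u \<in> hom X a b; A \<in> sp_el (src \<phi>) a; B \<in> sp_el (src \<phi>) b;
        le (ob_map (ordf (src \<phi>)) b) (ob_map (act (mor_map (ordf (src \<phi>)) u)) A) B\<rbrakk> \<Longrightarrow>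
        le (ob_map (ordf (trg \<phi>)) b) (ob_map (act (mor_map (ordf (trg \<phi>)) u)) (sp_ap \<phi> a A)) (sp_ap \<phi> b B)"
    unfolding is_species_map_def Let_def sp_el_def sp_ap_def by blast+
  have comp: "act \<phi> a \<in> hom (set_cat U) (sp_el (src \<phi>) a) (sp_el (trg \<phi>) a)" if "a \<in> Ob X" for a
    using nat that unfolding nat_trans_def sp_el_def by (auto dest: PiE_mem[of _ _ _ a])
  have "rel_map X (sp_el (src \<phi>)) (sp_rel X (src \<phi>)) (sp_el (trg \<phi>)) (sp_rel X (trg \<phi>)) (sp_ap \<phi>)"
    unfolding rel_map_def
  proof (intro conjI ballI allI impI)
    show "sp_ap \<phi> a x \<in> sp_el (trg \<phi>) a" if "a \<in> Ob X" "x \<in> sp_el (src \<phi>) a" for a x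
      using comp[OF that(1)] that(2) by (auto simp: hom_def sp_ap_def)
    show "sp_rel X (trg \<phi>) u (sp_ap \<phi> a x) (sp_ap \<phi> b y)" if u: "u \<in> hom X a b"
      and x: "x \<in> sp_el (src \<phi>) a" and y: "y \<in> sp_el (src \<phi>) b" and "sp_rel X (src \<phi>) u x y" for a b u x y
      using mono[OF X.hom_Ob[OF u] u x y] that(4) hom_Cod[OF u] by (simp add: sp_rel_def)
  qed
  moreover have "act \<phi> \<in> extensional (Ob X)"
    using nat unfolding nat_trans_def by (auto simp: PiE_def)
  moreover have "src (act \<phi> a) = sp_el (src \<phi>) a \<and> trg (act \<phi> a) = sp_el (trg \<phi>) a \<and>
      sp_ap \<phi> a \<in> extensional (sp_el (src \<phi>) a)" if "a \<in> Ob X" for a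
    using comp[OF that] by (auto simp: hom_def sp_ap_def PiE_def)
  ultimately show ?R
    using sp by blast
next
  assume R: ?R
  then have sp: "is_species U X (src \<phi>)" "is_species U X (trg \<phi>)" and ext: "act \<phi> \<in> extensional (Ob X)"
    and comp: "\<And>a. a \<in> Ob X \<Longrightarrow> src (act \<phi> a) = sp_el (src \<phi>) a \<and> trg (act \<phi> a) = sp_el (trg \<phi>) a \<and>
      sp_ap \<phi> a \<in> extensional (sp_el (src \<phi>) a)"
    and rel: "rel_map X (sp_el (src \<phi>)) (sp_rel X (src \<phi>)) (sp_el (trg \<phi>)) (sp_rel X (trg \<phi>)) (sp_ap \<phi>)"
    by blast+
  have ap_in: "sp_ap \<phi> a x \<in> sp_el (trg \<phi>) a" if "a \<in> Ob X" "x \<in> sp_el (src \<phi>) a" for a x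
    using rel that unfolding rel_map_def by blast
  have ap_rel: "sp_rel X (trg \<phi>) u (sp_ap \<phi> a x) (sp_ap \<phi> b y)" if "u \<in> hom X a b"
    "x \<in> sp_el (src \<phi>) a" "y \<in> sp_el (src \<phi>) b" "sp_rel X (src \<phi>) u x y" for u a b x y
    using rel that unfolding rel_map_def by blast
  have hom: "act \<phi> a \<in> hom (set_cat U) (sp_el (src \<phi>) a) (sp_el (trg \<phi>) a)" if "a \<in> Ob X" for a
    using comp[OF that] ap_in[OF that] small_sp_el[OF sp(1) that] small_sp_el[OF sp(2) that]
    by (auto simp: hom_def sp_ap_def PiE_def)
  have "nat_trans (core X) (set_cat U) (setf (src \<phi>)) (setf (trg \<phi>)) (act \<phi>)"
    unfolding nat_trans_def
  proof (intro conjI ballI)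
    show "act \<phi> \<in> (\<Pi>\<^sub>E a\<in>Ob (core X). hom (set_cat U) (ob_map (setf (src \<phi>)) a) (ob_map (setf (trg \<phi>)) a))"
      using hom ext by (auto simp: PiE_def sp_el_def)
    fix f assume "f \<in> Mor (core X)"
    then have "is_iso X f" by simp
    moreover define a b where "a = Dom X f" and "b = Cod X f"
    ultimately obtain g where fg: "inverse_pair X a b f g"
      using is_iso_iff_inverse_pair[of f X a b] by (auto simp: hom_def is_iso_def)
    note f = inverse_pairD[OF fg]
    note ab = X.hom_Ob[OF f(1)] and S = setf_mor[OF sp(1) fg] and S' = setf_mor[OF sp(2) fg]
    have "sp_ap \<phi> b (act (mor_map (setf (src \<phi>)) f) x) = act (mor_map (setf (trg \<phi>)) f) (sp_ap \<phi> a x)"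
      if x: "x \<in> sp_el (src \<phi>) a" for x
    proof (rule relational.lift_unique[OF relational_species[OF sp(2)] fg])
      note l = setf_lift[OF sp(1) fg x] and l' = setf_lift[OF sp(2) fg ap_in[OF ab(1) x]]
      show "sp_ap \<phi> a x \<in> sp_el (trg \<phi>) a" "sp_ap \<phi> b (act (mor_map (setf (src \<phi>)) f) x) \<in> sp_el (trg \<phi>) b"
        using ap_in[OF ab(1) x] ap_in[OF ab(2) l(1)] .
      show "sp_rel X (trg \<phi>) f (sp_ap \<phi> a x) (sp_ap \<phi> b (act (mor_map (setf (src \<phi>)) f) x))"
        "sp_rel X (trg \<phi>) g (sp_ap \<phi> b (act (mor_map (setf (src \<phi>)) f) x)) (sp_ap \<phi> a x)"
        using ap_rel[OF f(1) x l(1,2)] ap_rel[OF f(2) l(1) x l(3)] .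
    qed (rule setf_lift[OF sp(2) fg ap_in[OF ab(1) x]])+
    then show "act \<phi> (Cod (core X) f) \<cdot>\<^bsub>set_cat U\<^esub> mor_map (setf (src \<phi>)) f =
        mor_map (setf (trg \<phi>)) f \<cdot>\<^bsub>set_cat U\<^esub> act \<phi> (Dom (core X) f)"
      using S S' comp[OF ab(1)] comp[OF ab(2)] by (auto simp: sp_ap_def a_def b_def restrict_def)
  qed
  moreover have "\<forall>a\<in>Ob X. \<forall>b\<in>Ob X. \<forall>u\<in>hom X a b. \<forall>A\<in>ob_map (setf (src \<phi>)) a. \<forall>B\<in>ob_map (setf (src \<phi>)) b.
      le (ob_map (ordf (src \<phi>)) b) (ob_map (act (mor_map (ordf (src \<phi>)) u)) A) B \<longrightarrow>
      le (ob_map (ordf (trg \<phi>)) b) (ob_map (act (mor_map (ordf (trg \<phi>)) u)) (act (act \<phi> a) A)) (act (act \<phi> b) B)"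
    using ap_rel hom_Cod unfolding sp_rel_def sp_el_def sp_ap_def by metis
  ultimately show ?L
    unfolding is_species_map_def Let_def using sp by blast
qed

section \<open>The category of species\<close>

lemma hom_species_cat: "\<phi> \<in> hom (species_cat U X) \<Sigma> \<Sigma>' \<longleftrightarrow> is_species_map U X \<phi> \<and> src \<phi> = \<Sigma> \<and> trg \<phi> = \<Sigma>'"
  by (auto simp: hom_def species_cat_def)

lemma species_map_eqI:
  assumes \<phi>: "\<phi> \<in> hom (species_cat U X) \<Sigma> \<Sigma>'" and \<psi>: "\<psi> \<in> hom (species_cat U X) \<Sigma> \<Sigma>'"
    and eq: "\<And>a x. \<lbrakk>a \<in> Ob X; x \<in> sp_el \<Sigma> a\<rbrakk> \<Longrightarrow> sp_ap \<phi> a x = sp_ap \<psi> a x"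
  shows "\<phi> = \<psi>"
proof (rule arrow.equality)
  show "src \<phi> = src \<psi>" "trg \<phi> = trg \<psi>" using \<phi> \<psi> by (simp_all add: hom_species_cat)
  have f: "act \<phi> \<in> extensional (Ob X)" "\<And>a. a \<in> Ob X \<Longrightarrow> src (act \<phi> a) = sp_el \<Sigma> a \<and>
      trg (act \<phi> a) = sp_el \<Sigma>' a \<and> act (act \<phi> a) \<in> extensional (sp_el \<Sigma> a)"
    using \<phi> by (auto simp: hom_species_cat species_map_iff sp_ap_def)
  have g: "act \<psi> \<in> extensional (Ob X)" "\<And>a. a \<in> Ob X \<Longrightarrow> src (act \<psi> a) = sp_el \<Sigma> a \<and>
      trg (act \<psi> a) = sp_el \<Sigma>' a \<and> act (act \<psi> a) \<in> extensional (sp_el \<Sigma> a)"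
    using \<psi> by (auto simp: hom_species_cat species_map_iff sp_ap_def)
  show "act \<phi> = act \<psi>"
  proof (rule extensionalityI[OF f(1) g(1)])
    fix a assume a: "a \<in> Ob X"
    have "act (act \<phi> a) = act (act \<psi> a)"
      using extensionalityI[of "act (act \<phi> a)" "sp_el \<Sigma> a" "act (act \<psi> a)"] f(2)[OF a] g(2)[OF a] eq[OF a]
      by (simp add: sp_ap_def)
    then show "act \<phi> a = act \<psi> a"
      using f(2)[OF a] g(2)[OF a] by (intro arrow.equality) simp_all
  qed
qed simp

text \<open>The morphism is given explicitly because identities and composites of species maps are
  literally of this form; \<open>species_Id\<close> and \<open>species_Comp\<close> obtain their
  properties from it.\<close>

lemma ex_species_map:
  assumes sp: "is_species U X \<Sigma>" "is_species U X \<Sigma>'"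
    and h: "rel_map X (sp_el \<Sigma>) (sp_rel X \<Sigma>) (sp_el \<Sigma>') (sp_rel X \<Sigma>') h"
  defines "\<phi> \<equiv> \<lparr>src = \<Sigma>, trg = \<Sigma>', act = (\<lambda>a\<in>Ob X. \<lparr>src = sp_el \<Sigma> a, trg = sp_el \<Sigma>' a, act = (\<lambda>x\<in>sp_el \<Sigma> a. h a x)\<rparr>)\<rparr>"
  shows "\<phi> \<in> hom (species_cat U X) \<Sigma> \<Sigma>'"
    and "\<And>a x. \<lbrakk>a \<in> Ob X; x \<in> sp_el \<Sigma> a\<rbrakk> \<Longrightarrow> sp_ap \<phi> a x = h a x"
proof -
  show ap: "sp_ap \<phi> a x = h a x" if "a \<in> Ob X" "x \<in> sp_el \<Sigma> a" for a x
    using that by (simp add: \<phi>_def sp_ap_def)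
  have "rel_map X (sp_el \<Sigma>) (sp_rel X \<Sigma>) (sp_el \<Sigma>') (sp_rel X \<Sigma>') (sp_ap \<phi>)"
    unfolding rel_map_def
  proof (intro conjI ballI allI impI)
    show "sp_ap \<phi> a x \<in> sp_el \<Sigma>' a" if "a \<in> Ob X" "x \<in> sp_el \<Sigma> a" for a x
      using ap[OF that] h that unfolding rel_map_def by simp
    show "sp_rel X \<Sigma>' u (sp_ap \<phi> a x) (sp_ap \<phi> b y)" if "u \<in> hom X a b" "x \<in> sp_el \<Sigma> a" "y \<in> sp_el \<Sigma> b"
      "sp_rel X \<Sigma> u x y" for u a b x y
      using ap[OF X.hom_Ob(1)[OF that(1)] that(2)] ap[OF X.hom_Ob(2)[OF that(1)] that(3)] h that
      unfolding rel_map_def by simp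
  qed
  then show "\<phi> \<in> hom (species_cat U X) \<Sigma> \<Sigma>'"
    unfolding hom_species_cat species_map_iff using sp by (simp add: \<phi>_def sp_ap_def)
qed

lemma species_map_rel_map:
  "\<phi> \<in> hom (species_cat U X) \<Sigma> \<Sigma>' \<Longrightarrow> rel_map X (sp_el \<Sigma>) (sp_rel X \<Sigma>) (sp_el \<Sigma>') (sp_rel X \<Sigma>') (sp_ap \<phi>)"
  by (auto simp: hom_species_cat species_map_iff)

lemma species_Id:
  assumes "is_species U X \<Sigma>"
  shows "Id (species_cat U X) \<Sigma> \<in> hom (species_cat U X) \<Sigma> \<Sigma>"
    and "\<And>a x. \<lbrakk>a \<in> Ob X; x \<in> sp_el \<Sigma> a\<rbrakk> \<Longrightarrow> sp_ap (Id (species_cat U X) \<Sigma>) a x = x"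
proof -
  have "rel_map X (sp_el \<Sigma>) (sp_rel X \<Sigma>) (sp_el \<Sigma>) (sp_rel X \<Sigma>) (\<lambda>a x. x)"
    by (simp add: rel_map_def)
  from ex_species_map[OF assms assms this]
  show "Id (species_cat U X) \<Sigma> \<in> hom (species_cat U X) \<Sigma> \<Sigma>"
    "\<And>a x. \<lbrakk>a \<in> Ob X; x \<in> sp_el \<Sigma> a\<rbrakk> \<Longrightarrow> sp_ap (Id (species_cat U X) \<Sigma>) a x = x"
    by (simp_all add: species_cat_def sp_el_def)
qed

lemma species_Comp:
  assumes \<phi>: "\<phi> \<in> hom (species_cat U X) \<Sigma> \<Sigma>'" and \<psi>: "\<psi> \<in> hom (species_cat U X) \<Sigma>' \<Sigma>''"
  shows "\<psi> \<cdot>\<^bsub>species_cat U X\<^esub> \<phi> \<in> hom (species_cat U X) \<Sigma> \<Sigma>''"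
    and "\<And>a x. \<lbrakk>a \<in> Ob X; x \<in> sp_el \<Sigma> a\<rbrakk> \<Longrightarrow> sp_ap (\<psi> \<cdot>\<^bsub>species_cat U X\<^esub> \<phi>) a x = sp_ap \<psi> a (sp_ap \<phi> a x)"
proof -
  have sp: "is_species U X \<Sigma>" "is_species U X \<Sigma>''" and st: "src \<phi> = \<Sigma>" "trg \<psi> = \<Sigma>''"
    and \<phi>': "\<And>a. a \<in> Ob X \<Longrightarrow> src (act \<phi> a) = sp_el \<Sigma> a" and \<psi>': "\<And>a. a \<in> Ob X \<Longrightarrow> trg (act \<psi> a) = sp_el \<Sigma>'' a"
    using \<phi> \<psi> by (auto simp: hom_species_cat species_map_iff)
  have eq: "\<psi> \<cdot>\<^bsub>species_cat U X\<^esub> \<phi> = \<lparr>src = \<Sigma>, trg = \<Sigma>'', act = (\<lambda>a\<in>Ob X. \<lparr>src = sp_el \<Sigma> a, trg = sp_el \<Sigma>'' a,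
      act = (\<lambda>x\<in>sp_el \<Sigma> a. sp_ap \<psi> a (sp_ap \<phi> a x))\<rparr>)\<rparr>"
    using \<phi>' \<psi>' st by (auto simp: species_cat_def sp_ap_def restrict_def)
  have "rel_map X (sp_el \<Sigma>) (sp_rel X \<Sigma>) (sp_el \<Sigma>'') (sp_rel X \<Sigma>'') (\<lambda>a x. sp_ap \<psi> a (sp_ap \<phi> a x))"
    using rel_map_comp[OF X.category_axioms species_map_rel_map[OF \<phi>] species_map_rel_map[OF \<psi>]] .
  from ex_species_map[OF sp this]
  show "\<psi> \<cdot>\<^bsub>species_cat U X\<^esub> \<phi> \<in> hom (species_cat U X) \<Sigma> \<Sigma>''"
    "\<And>a x. \<lbrakk>a \<in> Ob X; x \<in> sp_el \<Sigma> a\<rbrakk> \<Longrightarrow> sp_ap (\<psi> \<cdot>\<^bsub>species_cat U X\<^esub> \<phi>) a x = sp_ap \<psi> a (sp_ap \<phi> a x)"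
    unfolding eq by simp_all
qed

lemma Ob_species_cat: "\<Sigma> \<in> Ob (species_cat U X) \<longleftrightarrow> is_species U X \<Sigma>"
  by (simp add: species_cat_def)

lemma species_map_in:
  "\<lbrakk>\<phi> \<in> hom (species_cat U X) \<Sigma> \<Sigma>'; a \<in> Ob X; x \<in> sp_el \<Sigma> a\<rbrakk> \<Longrightarrow> sp_ap \<phi> a x \<in> sp_el \<Sigma>' a"
  using species_map_rel_map unfolding rel_map_def by blast

lemma category_species_cat: "category (species_cat U X)"
proof
  show "Dom (species_cat U X) f \<in> Ob (species_cat U X)" "Cod (species_cat U X) f \<in> Ob (species_cat U X)"
    if "f \<in> Mor (species_cat U X)" for f
    using that by (auto simp: species_cat_def species_map_iff)
  show "Id (species_cat U X) a \<in> hom (species_cat U X) a a" if "a \<in> Ob (species_cat U X)" for a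
    using species_Id that by (simp add: Ob_species_cat)
  show comp: "g \<cdot>\<^bsub>species_cat U X\<^esub> f \<in> hom (species_cat U X) a c"
    if "f \<in> hom (species_cat U X) a b" "g \<in> hom (species_cat U X) b c" for f g a b c
    using species_Comp(1)[OF that] .
  have sp: "is_species U X a" "is_species U X b" if "f \<in> hom (species_cat U X) a b" for f a b
    using that by (auto simp: hom_species_cat species_map_iff)
  show "f \<cdot>\<^bsub>species_cat U X\<^esub> Id (species_cat U X) a = f" if f: "f \<in> hom (species_cat U X) a b" for f a b
    by (rule species_map_eqI[OF comp[OF species_Id(1)[OF sp(1)[OF f]] f] f])
      (simp add: species_Comp(2)[OF species_Id(1)[OF sp(1)[OF f]] f] species_Id(2)[OF sp(1)[OF f]])
  show "Id (species_cat U X) b \<cdot>\<^bsub>species_cat U X\<^esub> f = f" if f: "f \<in> hom (species_cat U X) a b" for f a b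
    by (rule species_map_eqI[OF comp[OF f species_Id(1)[OF sp(2)[OF f]]] f])
      (simp add: species_Comp(2)[OF f species_Id(1)[OF sp(2)[OF f]]] species_Id(2)[OF sp(2)[OF f]] species_map_in[OF f])
  show "h \<cdot>\<^bsub>species_cat U X\<^esub> (g \<cdot>\<^bsub>species_cat U X\<^esub> f) = (h \<cdot>\<^bsub>species_cat U X\<^esub> g) \<cdot>\<^bsub>species_cat U X\<^esub> f"
    if f: "f \<in> hom (species_cat U X) a b" and g: "g \<in> hom (species_cat U X) b c" and h: "h \<in> hom (species_cat U X) c d"
    for f g h a b c d
    by (rule species_map_eqI[OF comp[OF comp[OF f g] h] comp[OF f comp[OF g h]]])
      (simp add: species_Comp(2)[OF comp[OF f g] h] species_Comp(2)[OF f comp[OF g h]]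
        species_Comp(2)[OF f g] species_Comp(2)[OF g h] species_map_in[OF f])
qed

end

section \<open>Every relational structure comes from a species\<close>

text \<open>The new codes are pairs \<open>{v, t}\<close> where \<open>t\<close> is a member of no element of \<open>B\<close>; hence none of them
  lies in \<open>B\<close>.\<close>

lemma (in universe) ex_code_extending:
  fixes f :: "'v \<Rightarrow> 'a"
  assumes A: "small U A" and B: "small U B" and f: "inj_on f B"
  obtains e where "inj_on e A" "\<And>b. b \<in> B \<Longrightarrow> e (f b) = b"
proof -
  obtain \<nu> :: "'a \<Rightarrow> 'v" where \<nu>: "inj_on \<nu> A" using small_inj[OF A] by blast
  obtain z where z: "U z = (\<Union>b\<in>B. U b)"
    using small_code[OF small_UN[of B U]] B by auto
  obtain t where t: "t \<notin> U z" using ex_not_in by blast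
  have "\<forall>v. \<exists>z. U z = {v, t}" using pair by blast
  then obtain d where d: "\<And>v. U (d v) = {v, t}" by metis
  have d_inj: "v = w" if "d v = d w" for v w
    using that d[of v] d[of w] by (auto simp: doubleton_eq_iff)
  have dB: "d v \<notin> B" for v using t z d[of v] by auto
  define e where "e y = (if y \<in> f ` B then inv_into B f y else d (\<nu> y))" for y
  show ?thesis
  proof (rule that[of e])
    show e: "e (f b) = b" if "b \<in> B" for b using that f by (simp add: e_def)
    show "inj_on e A"
    proof (rule inj_onI)
      fix x y assume "x \<in> A" "y \<in> A" and eq: "e x = e y"
      show "x = y"
      proof (cases "x \<in> f ` B"; cases "y \<in> f ` B")
        assume "x \<in> f ` B" "y \<in> f ` B"
        then show ?thesis using eq e by (metis imageE)
      next
        assume 1: "x \<in> f ` B" "y \<notin> f ` B"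
        then have "e x \<in> B" "e y \<notin> B" using e dB by (auto simp: e_def)
        then show ?thesis using eq by simp
      next
        assume 1: "x \<notin> f ` B" "y \<in> f ` B"
        then have "e x \<notin> B" "e y \<in> B" using e dB by (auto simp: e_def)
        then show ?thesis using eq by simp
      next
        assume "x \<notin> f ` B" "y \<notin> f ` B"
        then have "\<nu> x = \<nu> y" using eq d_inj by (simp add: e_def)
        then show ?thesis using \<nu> \<open>x \<in> A\<close> \<open>y \<in> A\<close> by (auto simp: inj_on_def)
      qed
    qed
  qed
qed

text \<open>An order \<open>E(a)\<close> is built from sets of pairs \<open>(w, z)\<close> with \<open>w\<close> a morphism out of \<open>a\<close> and \<open>z\<close> an
  element over its codomain, ordered by reverse inclusion; the element \<open>x\<close> is represented by the set
  of all \<open>(w, z)\<close> with \<open>R w x z\<close>.\<close>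

lemma (in species_base) ex_species:
  fixes E :: "'o \<Rightarrow> 'v set"
  assumes ER: "relational X E R" and small_E: "\<And>a. a \<in> Ob X \<Longrightarrow> small U (E a)"
    and small_X: "small U (Ob X)" "small U (Mor X)"
  shows "\<exists>\<Sigma>. is_species U X \<Sigma> \<and> (\<forall>a\<in>Ob X. sp_el \<Sigma> a = E a) \<and>
    (\<forall>a b. \<forall>u\<in>hom X a b. \<forall>x\<in>E a. \<forall>y\<in>E b. sp_rel X \<Sigma> u x y \<longleftrightarrow> R u x y)"
proof -
  interpret R: relational X E R by fact
  obtain p :: "'v \<times> 'v \<Rightarrow> 'v" where p: "inj p" using ex_pairing by blast
  define K where "K a = {(w, z). w \<in> Mor X \<and> Dom X w = a \<and> z \<in> E (Cod X w)}" for a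
  define up where "up a x = {(w, z) \<in> K a. R w x z}" for a x
  have K_I: "(w, z) \<in> K a" if "w \<in> hom X a b" "z \<in> E b" for w z a b
    using that by (auto simp: K_def hom_def)
  have K_D: "w \<in> hom X a (Cod X w)" "z \<in> E (Cod X w)" if "(w, z) \<in> K a" for w z a
    using that by (auto simp: K_def hom_def)
  have small_K: "small U (Pow (K a))" for a
  proof -
    have "K a \<subseteq> Mor X \<times> (\<Union>b\<in>Ob X. E b)" using X.Cod_in by (auto simp: K_def)
    moreover have "small U (Mor X \<times> (\<Union>b\<in>Ob X. E b))"
      using small_Times[OF small_X(2) small_UN[OF small_X(1), of E]] small_E by blast
    ultimately show ?thesis
      using small_Pow[OF small_subset] by blast
  qed
  have up_Id: "(Id X a, y) \<in> up a x \<longleftrightarrow> R (Id X a) x y" if "a \<in> Ob X" "y \<in> E a" for a x y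
    using K_I[OF X.Id_in[OF that(1)] that(2)] by (simp add: up_def)
  have up_inj: "inj_on (up a) (E a)" if a: "a \<in> Ob X" for a
  proof (rule inj_onI)
    fix x y assume x: "x \<in> E a" and y: "y \<in> E a" and "up a x = up a y"
    then have "R (Id X a) x y" "R (Id X a) y x"
      using up_Id[OF a x, of x] up_Id[OF a x, of y] up_Id[OF a y, of x] up_Id[OF a y, of y] R.refl[OF a] by auto
    then show "x = y" using R.antisym[OF a x y] by blast
  qed
  \<comment> \<open>\<open>S(a)\<close> has to be contained in the set of objects of
    \<open>E(a)\<close> itself. So the code of \<open>up a x\<close> is prescribed to be
    \<open>x\<close>, and only the other subsets receive new codes.\<close>
  have "\<exists>e. inj_on e (Pow (K a)) \<and> (\<forall>x\<in>E a. e (up a x) = x)" if a: "a \<in> Ob X" for a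
    by (rule ex_code_extending[OF small_K small_E[OF a] up_inj[OF a]]) blast
  then obtain e where e: "\<And>a. a \<in> Ob X \<Longrightarrow> inj_on (e a) (Pow (K a))"
    and e_up: "\<And>a x. a \<in> Ob X \<Longrightarrow> x \<in> E a \<Longrightarrow> e a (up a x) = x" by metis
  define D where "D a = e a ` Pow (K a)" for a
  define dec where "dec a = inv_into (Pow (K a)) (e a)" for a
  define L where "L a x y \<longleftrightarrow> dec a y \<subseteq> dec a x" for a x y
  have dec_e: "dec a (e a P) = P" if "a \<in> Ob X" "P \<subseteq> K a" for a P
    using e[OF that(1)] that(2) by (simp add: dec_def)
  have dec_K: "dec a x \<subseteq> K a" and e_dec: "e a (dec a x) = x" if "x \<in> D a" for a x
    using inv_into_into[of x "e a" "Pow (K a)"] f_inv_into_f[of x "e a" "Pow (K a)"] that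
    by (auto simp: D_def dec_def)
  have e_D: "e a P \<in> D a" if "P \<subseteq> K a" for a P
    using that by (simp add: D_def)
  have up_K: "up a x \<subseteq> K a" for a x by (auto simp: up_def)
  have E_D: "x \<in> D a" and dec_E: "dec a x = up a x" if "a \<in> Ob X" "x \<in> E a" for a x
    using e_D[OF up_K, of a x] dec_e[OF that(1) up_K, of x] e_up[OF that] by simp_all
  have D: "is_order_on (D a) (L a)" for a
  proof -
    have "x = y" if "x \<in> D a" "y \<in> D a" "dec a x = dec a y" for x y
      using that e_dec by metis
    then show ?thesis unfolding is_order_on_def L_def by blast
  qed
  have small_D: "small U (D a)" for a
    unfolding D_def using small_image[OF small_K] .
  define Q where "Q a = order_cat p (D a) (L a)" for a
  have Q: "order_category (Q a)" "small_category U (Q a)" for a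
    unfolding Q_def using order_category_order_cat[OF p D] small_category_order_cat[OF p D small_D] .
  \<comment> \<open>\<open>E(u)\<close> acts by precomposition in the first component. It is
    strictly functorial by associativity in \<open>X\<close>, although the relations compose only
    laxly.\<close>
  define sh where "sh u P = {(w, z) \<in> K (Cod X u). (w \<cdot>\<^bsub>X\<^esub> u, z) \<in> P}" for u P
  define m where "m u x = e (Cod X u) (sh u (dec (Dom X u) x))" for u x
  define M where "M u = mono_funct p (D (Dom X u)) (L (Dom X u)) (m u)" for u
  have sh_K: "sh u P \<subseteq> K (Cod X u)" for u P by (auto simp: sh_def)
  have m_D: "m u x \<in> D (Cod X u)" for u x
    unfolding m_def using e_D[OF sh_K] .
  have dec_m: "dec b (m u x) = sh u (dec a x)" if "u \<in> hom X a b" for u a b x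
    using dec_e[OF X.hom_Ob(2)[OF that] sh_K[of u, unfolded hom_Cod[OF that]]] hom_Dom[OF that] hom_Cod[OF that]
    by (simp add: m_def)
  have m_mono: "L b (m u x) (m u y)" if "u \<in> hom X a b" "L a x y" for u a b x y
    using that(2) unfolding L_def dec_m[OF that(1)] by (auto simp: sh_def)
  have M: "is_functor (Q a) (Q b) (M u)" if u: "u \<in> hom X a b" for u a b
    unfolding M_def Q_def hom_Dom[OF u]
    by (rule is_functor_mono_funct[OF p D D]) (use m_D[of u] m_mono[OF u] hom_Cod[OF u] in auto)
  have M_Id: "M (Id X a) = id_funct (Q a)" if a: "a \<in> Ob X" for a
  proof -
    note id = X.Id_in[OF a]
    have "m (Id X a) x = x" if x: "x \<in> D a" for x
    proof -
      have "sh (Id X a) (dec a x) = dec a x"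
        using dec_K[OF x] X.Comp_Id[OF K_D(1)] hom_Cod[OF id] by (auto simp: sh_def)
      then show ?thesis using e_dec[OF x] hom_Dom[OF id] hom_Cod[OF id] by (simp add: m_def)
    qed
    then show ?thesis
      unfolding M_def Q_def id_mono_funct[OF p] hom_Dom[OF id] by (rule mono_funct_cong[OF p])
  qed
  have M_Comp: "M (v \<cdot>\<^bsub>X\<^esub> u) = comp_funct (Q a) (M v) (M u)" if u: "u \<in> hom X a b" and v: "v \<in> hom X b c" for u v a b c
  proof -
    note vu = X.Comp_in[OF u v]
    have "m (v \<cdot>\<^bsub>X\<^esub> u) x = m v (m u x)" for x
    proof -
      have "sh (v \<cdot>\<^bsub>X\<^esub> u) (dec a x) = sh v (sh u (dec a x))"
      proof -
        have "(w \<cdot>\<^bsub>X\<^esub> (v \<cdot>\<^bsub>X\<^esub> u), z) \<in> P \<longleftrightarrow> (w \<cdot>\<^bsub>X\<^esub> v, z) \<in> K b \<and> ((w \<cdot>\<^bsub>X\<^esub> v) \<cdot>\<^bsub>X\<^esub> u, z) \<in> P"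
          if "(w, z) \<in> K c" for w z P
          using X.assoc[OF u v K_D(1)[OF that]] K_I[OF X.Comp_in[OF v K_D(1)[OF that]] K_D(2)[OF that]] by simp
        then show ?thesis
          unfolding sh_def hom_Cod[OF u] hom_Cod[OF v] hom_Cod[OF vu] by blast
      qed
      then show ?thesis
        using dec_m[OF u] hom_Dom[OF u] hom_Dom[OF v] hom_Dom[OF vu] hom_Cod[OF v] hom_Cod[OF vu]
        by (simp add: m_def)
    qed
    then have "M (v \<cdot>\<^bsub>X\<^esub> u) = mono_funct p (D a) (L a) (\<lambda>x. m v (m u x))"
      unfolding M_def hom_Dom[OF vu] by (intro mono_funct_cong[OF p]) simp
    also have "\<dots> = comp_funct (Q a) (M v) (M u)"
      unfolding M_def Q_def hom_Dom[OF u] hom_Dom[OF v]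
      by (rule comp_mono_funct[OF p, symmetric]) (use m_D[of u] m_mono[OF u] hom_Cod[OF u] in auto)
    finally show ?thesis .
  qed
  \<comment> \<open>The action of \<open>S\<close> on isomorphisms. Lifts are unique, so the choice
    is strictly functorial.\<close>
  define lf where "lf g x = (SOME y. y \<in> E (Cod X g) \<and> R g x y \<and>
    (\<exists>h. inverse_pair X (Dom X g) (Cod X g) g h \<and> R h y x))" for g x
  have lf: "lf g x \<in> E b \<and> R g x (lf g x) \<and> R h (lf g x) x" if gh: "inverse_pair X a b g h" and x: "x \<in> E a" for g h a b x
  proof -
    note g = inverse_pairD(1)[OF gh]
    obtain y where "y \<in> E b" "R g x y" "R h y x" using R.lift[OF gh x] by blast
    then have "\<exists>y. y \<in> E (Cod X g) \<and> R g x y \<and> (\<exists>h. inverse_pair X (Dom X g) (Cod X g) g h \<and> R h y x)"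
      using gh hom_Dom[OF g] hom_Cod[OF g] by auto
    from someI_ex[OF this] have "lf g x \<in> E b \<and> R g x (lf g x) \<and> (\<exists>h. inverse_pair X a b g h \<and> R h (lf g x) x)"
      using hom_Dom[OF g] hom_Cod[OF g] by (simp add: lf_def)
    then show ?thesis using X.inverse_pair_unique[OF gh] by blast
  qed
  have lf_Id: "lf (Id X a) x = x" if a: "a \<in> Ob X" and x: "x \<in> E a" for a x
    using R.antisym[OF a _ x] lf[OF X.inverse_pair_Id[OF a] x] by blast
  have lf_Comp: "lf (g2 \<cdot>\<^bsub>X\<^esub> g1) x = lf g2 (lf g1 x)" if g1: "inverse_pair X a b g1 h1" and g2: "inverse_pair X b c g2 h2"
    and x: "x \<in> E a" for g1 g2 h1 h2 a b c x
  proof -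
    note l1 = lf[OF g1 x]
    note l2 = lf[OF g2 conjunct1[OF l1]]
    note l3 = lf[OF X.inverse_pair_Comp[OF g1 g2] x]
    note gD = inverse_pairD[OF g1] and hD = inverse_pairD[OF g2]
    have "R (g2 \<cdot>\<^bsub>X\<^esub> g1) x (lf g2 (lf g1 x))" "R (h1 \<cdot>\<^bsub>X\<^esub> h2) (lf g2 (lf g1 x)) x"
      using R.trans[OF gD(1) hD(1) x] R.trans[OF hD(2) gD(2)] l1 l2 x by blast+
    then show ?thesis
      using R.lift_unique[OF X.inverse_pair_Comp[OF g1 g2] x] l2 l3 by blast
  qed
  \<comment> \<open>Along an isomorphism \<open>E\<close> sends the representing set of
    \<open>x\<close> to that of its lift, so it agrees there with \<open>S\<close>; this is the
    naturality of the inclusions.\<close>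
  have m_lf: "m g x = lf g x" if gh: "inverse_pair X a b g h" and x: "x \<in> E a" for g h a b x
  proof -
    note gD = inverse_pairD[OF gh] and l = lf[OF gh x]
    note ab = X.hom_Ob[OF gD(1)]
    have "R (w \<cdot>\<^bsub>X\<^esub> g) x z \<longleftrightarrow> R w (lf g x) z" if wz: "(w, z) \<in> K b" for w z
    proof
      note w = K_D(1)[OF wz] and z = K_D(2)[OF wz]
      show "R (w \<cdot>\<^bsub>X\<^esub> g) x z" if "R w (lf g x) z"
        using R.trans[OF gD(1) w x _ z _ that] l by blast
      show "R w (lf g x) z" if "R (w \<cdot>\<^bsub>X\<^esub> g) x z"
        using R.trans[OF gD(2) X.Comp_in[OF gD(1) w] _ x z _ that] l
          X.cancel_inverse_right[OF gh] X.cancel_inverse_right[OF gh w] by simp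
    qed
    moreover have "(w \<cdot>\<^bsub>X\<^esub> g, z) \<in> K a" if "(w, z) \<in> K b" for w z
      using K_I[OF X.Comp_in[OF gD(1) K_D(1)[OF that]] K_D(2)[OF that]] .
    ultimately have "sh g (up a x) = up b (lf g x)"
      using hom_Cod[OF gD(1)] by (auto simp: sh_def up_def)
    then show ?thesis
      using dec_E[OF ab(1) x] hom_Dom[OF gD(1)] hom_Cod[OF gD(1)] e_up[OF ab(2)] l by (simp add: m_def)
  qed
  define S where "S = \<lparr>ob_map = (\<lambda>a\<in>Ob X. E a), mor_map = (\<lambda>g\<in>Mor (core X).
    \<lparr>src = E (Dom X g), trg = E (Cod X g), act = (\<lambda>x\<in>E (Dom X g). lf g x)\<rparr>)\<rparr>"
  define F where "F = \<lparr>ob_map = (\<lambda>a\<in>Ob X. Q a), mor_map = (\<lambda>u\<in>Mor X.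
    \<lparr>src = Q (Dom X u), trg = Q (Cod X u), act = M u\<rparr>)\<rparr>"
  have F_mor: "mor_map F u = \<lparr>src = Q a, trg = Q b, act = M u\<rparr>" if "u \<in> hom X a b" for u a b
    using that by (auto simp: F_def hom_def)
  have iso_pair: "\<exists>h. inverse_pair X (Dom X g) (Cod X g) g h" if "is_iso X g" for g
    using that is_iso_iff_inverse_pair[of g X] by (auto simp: is_iso_def hom_def)
  have S_mor: "mor_map S g = \<lparr>src = E a, trg = E b, act = (\<lambda>x\<in>E a. lf g x)\<rparr>" if "inverse_pair X a b g h" for g h a b
    using inverse_pairD(1)[OF that] inverse_pair_is_iso[OF that] by (auto simp: S_def hom_def)
  have F: "is_functor X (ord_cat U) F"
    unfolding F_def
  proof (rule is_functorI[OF X.category_axioms])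
    let ?m = "\<lambda>u. \<lparr>src = Q (Dom X u), trg = Q (Cod X u), act = M u\<rparr>"
    show "Q a \<in> Ob (ord_cat U)" for a using Q by simp
    show "?m u \<in> hom (ord_cat U) (Q a) (Q b)" if "u \<in> hom X a b" for u a b
      using M[OF that] Q hom_Dom[OF that] hom_Cod[OF that] by (simp add: hom_def)
    show "?m (Id X a) = Id (ord_cat U) (Q a)" if "a \<in> Ob X" for a
      using M_Id[OF that] hom_Dom[OF X.Id_in[OF that]] hom_Cod[OF X.Id_in[OF that]] by simp
    show "?m (v \<cdot>\<^bsub>X\<^esub> u) = ?m v \<cdot>\<^bsub>ord_cat U\<^esub> ?m u" if "u \<in> hom X a b" "v \<in> hom X b c" for u v a b c
      using M_Comp[OF that] hom_Dom[OF that(1)] hom_Cod[OF that(2)] hom_Dom[OF X.Comp_in[OF that]]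
        hom_Cod[OF X.Comp_in[OF that]] by simp
  qed
  have S: "is_functor (core X) (set_cat U) S"
    unfolding is_functor_def
  proof (intro conjI ballI impI)
    show "ob_map S \<in> Ob (core X) \<rightarrow>\<^sub>E Ob (set_cat U)" using small_E by (simp add: S_def)
    have hom: "mor_map S f \<in> hom (set_cat U) (E (Dom X f)) (E (Cod X f))" if f: "is_iso X f" for f
    proof -
      obtain h where h: "inverse_pair X (Dom X f) (Cod X f) f h" using iso_pair[OF f] by blast
      note ab = X.hom_Ob[OF inverse_pairD(1)[OF h]]
      show ?thesis
        using S_mor[OF h] lf[OF h] small_E[OF ab(1)] small_E[OF ab(2)] by (simp add: hom_def)
    qed
    show "mor_map S \<in> Mor (core X) \<rightarrow>\<^sub>E Mor (set_cat U)"
    proof (rule PiE_I)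
      show "mor_map S f \<in> Mor (set_cat U)" if "f \<in> Mor (core X)" for f
        using hom_Mor[OF hom] that by simp
    qed (simp add: S_def)
    show "mor_map S f \<in> hom (set_cat U) (ob_map S (Dom (core X) f)) (ob_map S (Cod (core X) f))" if "f \<in> Mor (core X)" for f
    proof -
      have "f \<in> Mor X" using that by (simp add: is_iso_def)
      then show ?thesis using hom[of f] that X.Dom_in X.Cod_in by (simp add: S_def)
    qed
    show "mor_map S (Id (core X) a) = Id (set_cat U) (ob_map S a)" if a: "a \<in> Ob (core X)" for a
      using a S_mor[OF X.inverse_pair_Id, of a] lf_Id[of a] by (auto simp: S_def restrict_def)
    show "mor_map S (g \<cdot>\<^bsub>core X\<^esub> f) = mor_map S g \<cdot>\<^bsub>set_cat U\<^esub> mor_map S f"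
      if f: "f \<in> Mor (core X)" and g: "g \<in> Mor (core X)" and fg: "Cod (core X) f = Dom (core X) g" for f g
    proof -
      obtain h k where h: "inverse_pair X (Dom X f) (Dom X g) f h" and k: "inverse_pair X (Dom X g) (Cod X g) g k"
        using iso_pair[of f] iso_pair[of g] f g fg by auto
      show ?thesis
        using S_mor[OF h] S_mor[OF k] S_mor[OF X.inverse_pair_Comp[OF h k]] lf_Comp[OF h k] lf[OF h]
        by (auto simp: restrict_def)
    qed
  qed
  have incl_functor: "is_functor (dis (E a)) (Q a) (act (dis_incl (E a) (Q a)))" if a: "a \<in> Ob X" for a
  proof -
    have "p (x, x) \<in> hom (Q a) x x" if "x \<in> E a" for x
      using E_D[OF a that] D[of a] by (simp add: Q_def hom_order_cat[OF p] is_order_on_def)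
    then show ?thesis
      unfolding is_functor_def
      using E_D[OF a] by (auto simp: dis_incl_def dis_def Q_def Comp_order_cat[OF p] dest: hom_Mor)
  qed
  have nat: "nat_trans (core X) (ord_cat U) (comp_funct (core X) (Dis U) S) (comp_funct (core X) F (core_incl X))
      (\<lambda>a\<in>Ob X. dis_incl (ob_map S a) (ob_map F a))"
    unfolding nat_trans_def
  proof (intro conjI ballI)
    have "dis_incl (E a) (Q a) \<in> hom (ord_cat U) (dis (E a)) (Q a)" if "a \<in> Ob X" for a
      using incl_functor[OF that] Q[of a] order_category_dis small_category_dis[OF small_E[OF that]]
      by (simp add: hom_def dis_incl_def)
    then show "(\<lambda>a\<in>Ob X. dis_incl (ob_map S a) (ob_map F a)) \<in> (\<Pi>\<^sub>E a\<in>Ob (core X). hom (ord_cat U)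
        (ob_map (comp_funct (core X) (Dis U) S) a) (ob_map (comp_funct (core X) F (core_incl X)) a))"
      using small_E by (auto simp: comp_funct_def Dis_def core_incl_def S_def F_def)
    fix f assume f: "f \<in> Mor (core X)"
    define a b where "a = Dom X f" and "b = Cod X f"
    obtain h where h: "inverse_pair X a b f h"
      using iso_pair[of f] f by (auto simp: a_def b_def)
    note fh = inverse_pairD(1)[OF h]
    note ab = X.hom_Ob[OF fh]
    have Sf: "mor_map S f \<in> Mor (set_cat U)"
      using hom_Mor[OF functor_hom[OF S]] f Mor_hom[OF f] by blast
    have 1: "mor_map (comp_funct (core X) (Dis U) S) f =
        \<lparr>src = dis (E a), trg = dis (E b), act = \<lparr>ob_map = (\<lambda>x\<in>E a. lf f x), mor_map = (\<lambda>x\<in>E a. lf f x)\<rparr>\<rparr>"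
      using f Sf S_mor[OF h] by (simp add: comp_funct_def Dis_def)
    have 2: "mor_map (comp_funct (core X) F (core_incl X)) f = \<lparr>src = Q a, trg = Q b, act = M f\<rparr>"
      using f F_mor[OF fh] by (simp add: comp_funct_def core_incl_def)
    have M_ob: "ob_map (M f) x = lf f x" if "x \<in> E a" for x
      using m_lf[OF h that] E_D[OF ab(1) that] by (simp add: M_def mono_funct_def a_def)
    have M_mor: "mor_map (M f) (p (x, x)) = p (lf f x, lf f x)" if x: "x \<in> E a" for x
      using functor_Id[OF M[OF fh], of x] M_ob[OF x] E_D[OF ab(1) x] by (simp add: Q_def)
    have "comp_funct (dis (E a)) (act (dis_incl (E b) (Q b))) \<lparr>ob_map = (\<lambda>x\<in>E a. lf f x), mor_map = (\<lambda>x\<in>E a. lf f x)\<rparr> =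
        comp_funct (dis (E a)) (M f) (act (dis_incl (E a) (Q a)))"
      using lf[OF h] M_ob M_mor by (auto simp: comp_funct_def dis_def dis_incl_def Q_def restrict_def)
    then show "(\<lambda>a\<in>Ob X. dis_incl (ob_map S a) (ob_map F a)) (Cod (core X) f) \<cdot>\<^bsub>ord_cat U\<^esub>
          mor_map (comp_funct (core X) (Dis U) S) f =
        mor_map (comp_funct (core X) F (core_incl X)) f \<cdot>\<^bsub>ord_cat U\<^esub>
          (\<lambda>a\<in>Ob X. dis_incl (ob_map S a) (ob_map F a)) (Dom (core X) f)"
      unfolding 1 2 using ab by (simp add: S_def F_def dis_incl_def flip: a_def b_def)
  qed
  let ?\<Sigma> = "\<lparr>ordf = F, setf = S\<rparr>"
  show ?thesis
  proof (intro exI[of _ ?\<Sigma>] conjI ballI allI)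
    show "is_species U X ?\<Sigma>" unfolding is_species_def using F S nat by simp
    show "sp_el ?\<Sigma> a = E a" if "a \<in> Ob X" for a using that by (simp add: sp_el_def S_def)
    fix u a b x y assume u: "u \<in> hom X a b" and x: "x \<in> E a" and y: "y \<in> E b"
    note ab = X.hom_Ob[OF u]
    have "sp_rel X ?\<Sigma> u x y \<longleftrightarrow> le (Q b) (m u x) y"
      using F_mor[OF u] ab(2) hom_Dom[OF u] hom_Cod[OF u] E_D[OF ab(1) x]
      by (simp add: sp_rel_def F_def M_def mono_funct_def)
    also have "\<dots> \<longleftrightarrow> up b y \<subseteq> sh u (up a x)"
      using le_order_cat[OF p] m_D[of u x] hom_Cod[OF u] E_D[OF ab(2) y] dec_E[OF ab(2) y] dec_E[OF ab(1) x]
        dec_m[OF u] by (simp add: Q_def L_def)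
    \<comment> \<open>As in the Yoneda lemma, the inclusion is tested on the identity of
      \<open>b\<close> paired with \<open>y\<close>; the converse is transitivity.\<close>
    also have "\<dots> \<longleftrightarrow> R u x y"
    proof
      assume "up b y \<subseteq> sh u (up a x)"
      then have "(Id X b, y) \<in> sh u (up a x)" using up_Id[OF ab(2) y] R.refl[OF ab(2) y] by blast
      then show "R u x y" using X.Id_Comp[OF u] by (simp add: sh_def up_def)
    next
      assume xy: "R u x y"
      show "up b y \<subseteq> sh u (up a x)"
      proof (rule subrelI)
        fix w z assume "(w, z) \<in> up b y"
        then have wz: "(w, z) \<in> K b" and yz: "R w y z" by (simp_all add: up_def)
        have "R (w \<cdot>\<^bsub>X\<^esub> u) x z"
          using R.trans[OF u K_D(1)[OF wz] x y K_D(2)[OF wz] xy yz] .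
        then show "(w, z) \<in> sh u (up a x)"
          using wz K_I[OF X.Comp_in[OF u K_D(1)[OF wz]] K_D(2)[OF wz]] hom_Cod[OF u] by (simp add: sh_def up_def)
      qed
    qed
    finally show "sp_rel X ?\<Sigma> u x y \<longleftrightarrow> R u x y" .
  qed
qed

section \<open>Species present the relational structures over the base\<close>

lemma presentation_species:
  fixes U :: "'v \<Rightarrow> 'v set"
  assumes U: "universe U" and X: "small_category U X"
  shows "presentation (species_cat U X) X U sp_el sp_ap (sp_rel X)"
proof -
  interpret universe U by fact
  have catX: "category X" and small_X: "small U (Ob X)" "small U (Mor X)"
    using X by (simp_all add: small_category_def)
  interpret species_base U X
    by (simp add: species_base_def U catX)
  show ?thesis
  proof (intro presentation.intro presentation_axioms.intro category_species_cat catX)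
    fix E :: "_ \<Rightarrow> 'v set" and R
    assume ER: "relational X E R" "\<And>a. a \<in> Ob X \<Longrightarrow> small U (E a)"
    obtain \<Sigma> where \<Sigma>: "is_species U X \<Sigma>" "\<And>a. a \<in> Ob X \<Longrightarrow> sp_el \<Sigma> a = E a"
      "\<And>u a b x y. \<lbrakk>u \<in> hom X a b; x \<in> E a; y \<in> E b\<rbrakk> \<Longrightarrow> sp_rel X \<Sigma> u x y \<longleftrightarrow> R u x y"
      using ex_species[OF ER small_X] by blast
    have "rel_iso X E R (sp_el \<Sigma>) (sp_rel X \<Sigma>) (\<lambda>a x. x)"
      unfolding rel_iso_def using \<Sigma>(2,3) by (simp add: bij_betw_def)
    then show "\<exists>c\<in>Ob (species_cat U X). \<exists>h. rel_iso X E R (sp_el c) (sp_rel X c) h"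
      using \<Sigma>(1) Ob_species_cat by blast
  next
    fix c d h assume "c \<in> Ob (species_cat U X)" "d \<in> Ob (species_cat U X)"
      and "rel_map X (sp_el c) (sp_rel X c) (sp_el d) (sp_rel X d) h"
    from ex_species_map[OF _ _ this(3)] this(1,2)
    show "\<exists>f\<in>hom (species_cat U X) c d. \<forall>a\<in>Ob X. \<forall>x\<in>sp_el c a. sp_ap f a x = h a x"
      unfolding Ob_species_cat by blast
  next
    show "relational X (sp_el c) (sp_rel X c)" if "c \<in> Ob (species_cat U X)" for c
      using relational_species that by (simp add: Ob_species_cat)
    show "small U (sp_el c a)" if "c \<in> Ob (species_cat U X)" "a \<in> Ob X" for c a
      using small_sp_el that by (simp add: Ob_species_cat)
    show "sp_ap (Id (species_cat U X) c) a x = x" if "c \<in> Ob (species_cat U X)" "a \<in> Ob X" "x \<in> sp_el c a" for c a x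
      using species_Id(2) that by (simp add: Ob_species_cat)
  qed (fact species_map_rel_map species_Comp(2) species_map_eqI)+
qed

theorem theorem1:
  fixes U :: "'v \<Rightarrow> 'v set"
    and X :: "('o, 'm) cat"
    and X' :: "('p, 'n) cat"
  assumes "universe U"
    and "small_category U X" and "connected_category X"
    and "small_category U X'" and "connected_category X'"
  shows "(equivalent X X' \<or> equivalent (op_cat X) X') \<longleftrightarrow>
    equivalent (species_cat U X) (species_cat U X')"
proof -
  have X: "category X" and X': "category X'"
    using assms(2,4) by (simp_all add: small_category_def)
  have P: "presentation (species_cat U X) X U sp_el sp_ap (sp_rel X)"
    and P': "presentation (species_cat U X') X' U sp_el sp_ap (sp_rel X')"
    using presentation_species assms by blast+
  show ?thesis
  proof
    assume "equivalent X X' \<or> equivalent (op_cat X) X'"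
    then show "equivalent (species_cat U X) (species_cat U X')"
    proof
      assume "equivalent X X'"
      then obtain F where "weak_equivalence X X' F"
        using equivalent_imp_weak_equivalence[OF X X'] by blast
      \<comment> \<open>Restricted along \<open>F\<close>, the structures carried by species on
        \<open>X'\<close> live over \<open>X\<close>, so both categories present the same
        structures.\<close>
      from presentation_unique[OF P presentation.change_base[OF P' X this]]
      show ?thesis .
    next
      assume "equivalent (op_cat X) X'"
      then obtain F where "weak_equivalence (op_cat X) X' F"
        using equivalent_imp_weak_equivalence[OF category_op_cat[OF X] X'] by blast
      from presentation_unique[OF presentation_op_cat[OF P]
          presentation.change_base[OF P' category_op_cat[OF X] this]]
      show ?thesis .
    qed
  next
    assume "equivalent (species_cat U X) (species_cat U X')"
    then obtain \<Phi> where \<Phi>: "weak_equivalence (species_cat U X) (species_cat U X') \<Phi>"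
      using equivalent_imp_weak_equivalence[OF presentation.axioms(1)[OF P] presentation.axioms(1)[OF P']]
      by blast
    \<comment> \<open>Each species on \<open>X\<close> carries its own structure over
      \<open>X\<close> and that of its image under \<open>\<Phi>\<close> over
      \<open>X'\<close>.\<close>
    interpret two_presentations "species_cat U X" X X' U sp_el sp_ap "sp_rel X"
      "\<lambda>c. sp_el (ob_map \<Phi> c)" "\<lambda>f. sp_ap (mor_map \<Phi> f)" "\<lambda>c. sp_rel X' (ob_map \<Phi> c)"
      using P presentation.precompose_weak_equivalence[OF P' presentation.axioms(1)[OF P] \<Phi>] assms(1,2,4)
      by (simp add: two_presentations_def small_presentation_def small_presentation_axioms_def small_category_def)
    show "equivalent X X' \<or> equivalent (op_cat X) X'"
      using connected_imp_equivalent[OF assms(3)] .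
  qed
qed

end
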